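(* Let $F(z)=D+C(zI-A)^{-1}B$ with realization $\Sigma=(A,B,C,D)$, where $(C,A)$ is observable. Let the columns of $H_{fzk}(zI-\Lambda_{fzk})^{-1}$ provide a basis in $Z(F)\oplus\mathcal W(\ker F)$, let $\Pi_{fzk}$ be the corresponding solution of $A\Pi_{fzk}+BH_{fzk}=\Pi_{fzk}\Lambda_{fzk}$, $C\Pi_{fzk}+DH_{fzk}=0$, and let $(R_0,\alpha_0)$ be a maximal solution of $BR_0=\Pi_{fzk}\alpha_0$, $DR_0=0$, the columns of $R_0$ being orthonormal and the matrices partitioned as in the context. With $\sigma,\beta_k,L_0,L_\beta$ as in the context, let $F_{\rm r}=FL_\beta$. Then: (i) $F_{\rm r}$ has the (in general non-minimal) realization $\Sigma_{\rm r}=\bigl(A,\ (B+\Pi_k\sigma^{-1}H_k^* )L_0,\ C,\ DL_0\bigr)$, i.e. $F_{\rm r}(z)=DL_0+C(zI-A)^{-1}(B+\Pi_k\sigma^{-1}H_k^* )L_0$. (ii) $\mathcal V^*(\Sigma_{\rm r})=\mathcal V^*(\Sigma)$; $\ \mathcal V^*(\Sigma_{\rm r})\cap\mathcal C^*(\Sigma_{\rm r})=\{0\}$; $\ (\mathcal V^*(\Sigma)\cap\mathcal C^*(\Sigma))\vee\mathcal C^*(\Sigma_{\rm r})=\mathcal C^*(\Sigma)$; and $\mathcal W(\ker F_{\rm r})=\{0\}$. (iii) $\langle A\mid(B+\Pi_k\sigma^{-1}H_k^* )L_0\rangle\subset\langle A\mid B\rangle$. Moreover, if either (a) all the eigenvalues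 of $A$ have non-positive real part, or (b) $A$ and $-A^*$ have no common eigenvalues, and the pair $(A,\overline C^{*})$ is stabilizable (in the continuous-time sense), where $\overline C=CP+DB^*$ and $P$ is the solution of the Lyapunov equation $AP+PA^*+BB^*=0$, then $\langle A\mid B\rangle=\langle A\mid(B+\Pi_k\sigma^{-1}H_k^* )L_0\rangle$. (iv) If $\langle A\mid B\rangle=\langle A\mid(B+\Pi_k\sigma^{-1}H_k^* )L_0\rangle$, then the finite zero matrix of $F_{\rm r}$ is given by $$\Lambda_f(F_{\rm r})=\begin{bmatrix}-\sigma^{-1}(\Lambda_k+\alpha_k\beta_k)^*\sigma&\Lambda_{kf}+\sigma^{-1}(\beta_k^*R_0^*+H_k^* )H_f\\0&\Lambda_f\end{bmatrix}.$$
   Context: Notation. $A\in\mathbb C^{n\times n}$, $B\in\mathbb C^{n\times q}$, $C\in\mathbb C^{p\times n}$, $D\in\mathbb C^{p\times q}$. $\langle A\mid B\rangle=\operatorname{Im}[B,AB,A^2B,\dots]$; $\vee$ is the sum of subspaces; $M^*$ is the adjoint of a constant matrix $M$. $\mathcal V^*(\Sigma)$ is the largest subspace $\mathcal V\subset\mathbb C^n$ for which there is $K$ with $(A+BK)\mathcal V\subset\mathcal V\subset\ker(C+DK)$. $\mathcal C^*(\Sigma)$ is the set of $x\in\mathbb C^n$ for which there are $k\ge0$ and inputs $u(-k),\dots,u(0)$ such that the system $x(j+1)=Ax(j)+Bu(j)$, $y(j)=Cx(j)+Du(j)$ started at $x(-k)=0$ satisfies $y(j)=0$ for $-k\le j\le0$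 and $x(1)=x$. Let $\Omega U=\mathbb C[z]^q$, $\Omega Y=\mathbb C[z]^p$, let $z^{-1}\Omega_\infty U$ be the set of strictly proper rational $q$-tuples, $\ker F=\{g\in\mathbb C(z)^q:Fg=0\}$, $F^{-1}(\Omega Y)=\{g\in\mathbb C(z)^q: Fg\in\Omega Y\}$, and $\pi_-$ the map taking strictly proper parts. The finite zero module is $Z(F)=(F^{-1}(\Omega Y)+\Omega U)/(\ker F+\Omega U)$ and $\mathcal W(\ker F)=\pi_-(\ker F)/(\ker F\cap z^{-1}\Omega_\infty U)$. The space $Z(F)\oplus\mathcal W(\ker F)$ is identified with the space of strictly proper elements of $F^{-1}(\Omega Y)+\Omega U$ modulo $\ker F\cap z^{-1}\Omega_\infty U$; "the columns of $H_{fzk}(zI-\Lambda_{fzk})^{-1}$ provide a basis" means that they belong to $F^{-1}(\Omega Y)+\Omega U$ and their classes form a basis of this quotient. (Then the corresponding solution $\Pi_{fzk}$ exists, is unique, has trivial kernel, and has image $\mathcal V^*(\Sigma)\cap\langle A\mid B\rangle$.) A solution $(R_0,\alpha_0)$ of $BR_0=\Pi_{fzk}\alpha_0$, $DR_0=0$ is maximal if $\operatorname{Im}R_0$ contains $\operatorname{Im}R$ for every other solution $(R,\alpha)$. The basis is chosen so that $\Lambda_{fzk}=\begin{bmatrix}\Lambda_k&\Lambda_{kf}\\0&\Lambda_f\end{bmatrix}$, $\alpha_0=\begin{bmatrix}\alpha_k\\0\end{bmatrix}$ with $(\Lambda_k,\alpha_k)$ controllable, and accordingly $\Pi_{fzk}=[\Pi_k,\Pi_f]$,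 $H_{fzk}=[H_k,H_f]$. The matrix $\Lambda_f$ obtained this way is called the finite zero matrix of $F$ (determined up to similarity); the same definition applied to the realization $\Sigma_{\rm r}$ gives the finite zero matrix $\Lambda_f(F_{\rm r})$ of $F_{\rm r}$. $\sigma$ is the positive definite solution of the Riccati equation $$\sigma(\Lambda_k-\alpha_kR_0^*H_k)+(\Lambda_k-\alpha_kR_0^*H_k)^*\sigma-\sigma\alpha_k\alpha_k^*\sigma+H_k^*(I-R_0R_0^* )H_k=0,$$ $\beta_k=-\alpha_k^*\sigma-R_0^*H_k$; $L_0$ is chosen so that $[R_0,L_0]$ is unitary; and $$L_\beta(z)=L_0-(H_k+R_0\beta_k)\bigl(zI-(\Lambda_k+\alpha_k\beta_k)\bigr)^{-1}\sigma^{-1}(H_k+R_0\beta_k)^*L_0 .$$ *)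

theory Defs
  imports
    "Jordan_Normal_Form.Schur_Decomposition"
    "Jordan_Normal_Form.Char_Poly"
    "Jordan_Normal_Form.Matrix_Kernel"
    "HOL-Computational_Algebra.Fraction_Field"
    "HOL-Library.Set_Algebras"
begin

text \<open>
  Matrices are those of Jordan-Normal-Form, whose dimensions are carried by the value and may
  be zero. This is needed: any of the blocks indexed by the parts of a zero matrix, the matrix
  \<open>R0\<close> and its unitary complement \<open>L0\<close> can be empty. Sums of sets of vectors \<open>V + W\<close> and cosets
  \<open>x +o N\<close> are those of Set-Algebras.
\<close>

section \<open>Constant matrices\<close>

definition minv :: "'a::field mat \<Rightarrow> 'a mat" where
  "minv M = the (mat_inverse M)"

definition append_cols :: "'a::zero mat \<Rightarrow> 'a mat \<Rightarrow> 'a mat" where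
  "append_cols M N = four_block_mat M N (0\<^sub>m 0 (dim_col M)) (0\<^sub>m 0 (dim_col N))"

definition mat_image :: "'a::semiring_0 mat \<Rightarrow> 'a vec set" where
  "mat_image M = (*\<^sub>v) M ` carrier_vec (dim_col M)"

definition unitary_mat :: "complex mat \<Rightarrow> bool" where
  "unitary_mat U \<longleftrightarrow> square_mat U \<and>
     mat_adjoint U * U = 1\<^sub>m (dim_row U) \<and> U * mat_adjoint U = 1\<^sub>m (dim_row U)"

definition pos_def_mat :: "complex mat \<Rightarrow> bool" where
  "pos_def_mat M \<longleftrightarrow> square_mat M \<and> mat_adjoint M = M \<and>
     (\<forall>v \<in> carrier_vec (dim_row M). v \<noteq> 0\<^sub>v (dim_row M) \<longrightarrow> 0 < Re ((M *\<^sub>v v) \<bullet>c v))"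

section \<open>State space notions\<close>

definition vec_subspace :: "nat \<Rightarrow> complex vec set \<Rightarrow> bool" where
  "vec_subspace n V \<longleftrightarrow> VectorSpace.subspace class_ring V (module_vec TYPE(complex) n)"

text \<open>The space \<open>\<langle>A | B\<rangle>\<close>, the image of the infinite block row \<open>[B, AB, A\<^sup>2B, \<dots>]\<close>.\<close>

definition reachable :: "complex mat \<Rightarrow> complex mat \<Rightarrow> complex vec set" where
  "reachable A B = LinearCombinations.module.span class_ring (module_vec TYPE(complex) (dim_row A))
     (\<Union>k. mat_image (A ^\<^sub>m k * B))"

definition controllable :: "complex mat \<Rightarrow> complex mat \<Rightarrow> bool" where
  "controllable A B \<longleftrightarrow> reachable A B = carrier_vec (dim_row A)"

definition observable :: "complex mat \<Rightarrow> complex mat \<Rightarrow> bool" where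
  "observable C A \<longleftrightarrow> (\<Inter>k. mat_kernel (C * A ^\<^sub>m k)) = {0\<^sub>v (dim_row A)}"

text \<open>Stabilizability in the continuous-time sense.\<close>

definition stabilizable :: "complex mat \<Rightarrow> complex mat \<Rightarrow> bool" where
  "stabilizable A B \<longleftrightarrow> (\<exists>K \<in> carrier_mat (dim_col B) (dim_row A).
     \<forall>s. eigenvalue (A + B * K) s \<longrightarrow> Re s < 0)"

definition output_nulling ::
  "complex mat \<Rightarrow> complex mat \<Rightarrow> complex mat \<Rightarrow> complex mat \<Rightarrow> complex vec set \<Rightarrow> bool" where
  "output_nulling A B C D V \<longleftrightarrow> vec_subspace (dim_row A) V \<and>
     (\<exists>K \<in> carrier_mat (dim_col B) (dim_row A).
        (*\<^sub>v) (A + B * K) ` V \<subseteq> V \<and> V \<subseteq> mat_kernel (C + D * K))"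

text \<open>\<open>\<V>\<^sup>*\<close>; the order on sets is inclusion.\<close>

definition V_star ::
  "complex mat \<Rightarrow> complex mat \<Rightarrow> complex mat \<Rightarrow> complex mat \<Rightarrow> complex vec set" where
  "V_star A B C D = (GREATEST V. output_nulling A B C D V)"

text \<open>\<open>\<C>\<^sup>*\<close>; \<open>u\<close> and \<open>\<xi>\<close> are the input and state sequences, of which only the values at times
  \<open>-k, \<dots>, 0\<close> respectively \<open>-k, \<dots>, 1\<close> matter.\<close>

definition C_star ::
  "complex mat \<Rightarrow> complex mat \<Rightarrow> complex mat \<Rightarrow> complex mat \<Rightarrow> complex vec set" where
  "C_star A B C D = {x. \<exists>(k::nat) (u :: int \<Rightarrow> complex vec) (\<xi> :: int \<Rightarrow> complex vec).
     (\<forall>j \<in> {- int k..0}. u j \<in> carrier_vec (dim_col B)) \<and>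
     \<xi> (- int k) = 0\<^sub>v (dim_row A) \<and>
     (\<forall>j \<in> {- int k..0}. \<xi> (j + 1) = A *\<^sub>v \<xi> j + B *\<^sub>v u j) \<and>
     (\<forall>j \<in> {- int k..0}. C *\<^sub>v \<xi> j + D *\<^sub>v u j = 0\<^sub>v (dim_row C)) \<and>
     \<xi> 1 = x}"

section \<open>Rational vectors and matrices\<close>

type_synonym rat_fun = "complex poly fract"

definition of_poly :: "complex poly \<Rightarrow> rat_fun" where
  "of_poly p = Fraction_Field.Fract p 1"

abbreviation const_fun :: "complex \<Rightarrow> rat_fun" where
  "const_fun c \<equiv> of_poly [:c:]"

abbreviation const_mat :: "complex mat \<Rightarrow> rat_fun mat" where
  "const_mat \<equiv> map_mat const_fun"

abbreviation const_vec :: "complex vec \<Rightarrow> rat_fun vec" where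
  "const_vec \<equiv> map_vec const_fun"

definition resolvent :: "complex mat \<Rightarrow> rat_fun mat" where
  "resolvent A = minv (of_poly [:0, 1:] \<cdot>\<^sub>m 1\<^sub>m (dim_row A) - const_mat A)"

definition transfer_function ::
  "complex mat \<Rightarrow> complex mat \<Rightarrow> complex mat \<Rightarrow> complex mat \<Rightarrow> rat_fun mat" where
  "transfer_function A B C D = const_mat D + const_mat C * resolvent A * const_mat B"

text \<open>The zero function is included: it is \<open>0 / z\<close>.\<close>

definition strictly_proper :: "rat_fun \<Rightarrow> bool" where
  "strictly_proper f \<longleftrightarrow> (\<exists>a b. degree a < degree b \<and> f = Fraction_Field.Fract a b)"

definition strictly_proper_part :: "rat_fun \<Rightarrow> rat_fun" where
  "strictly_proper_part f = (THE g. strictly_proper g \<and> f - g \<in> range of_poly)"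

definition pi_minus :: "rat_fun vec \<Rightarrow> rat_fun vec" where
  "pi_minus = map_vec strictly_proper_part"

definition poly_vecs :: "nat \<Rightarrow> rat_fun vec set" where
  "poly_vecs m = {g \<in> carrier_vec m. \<forall>i<m. g $ i \<in> range of_poly}"

definition strictly_proper_vecs :: "nat \<Rightarrow> rat_fun vec set" where
  "strictly_proper_vecs m = {g \<in> carrier_vec m. \<forall>i<m. strictly_proper (g $ i)}"

section \<open>Zero spaces of a rational matrix\<close>

text \<open>\<open>F\<^sup>-\<^sup>1(\<Omega>Y)\<close>, for \<open>F\<close> not necessarily invertible.\<close>

definition poly_preimage :: "rat_fun mat \<Rightarrow> rat_fun vec set" where
  "poly_preimage F = {g \<in> carrier_vec (dim_col F). F *\<^sub>v g \<in> poly_vecs (dim_row F)}"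

definition quotient_space :: "rat_fun vec set \<Rightarrow> rat_fun vec set \<Rightarrow> rat_fun vec set set" where
  "quotient_space X N = (\<lambda>g. g +o N) ` X"

definition sp_kernel :: "rat_fun mat \<Rightarrow> rat_fun vec set" where
  "sp_kernel F = mat_kernel F \<inter> strictly_proper_vecs (dim_col F)"

text \<open>\<open>\<W>(ker F)\<close>; its zero element is the coset of the zero vector.\<close>

definition W_ker :: "rat_fun mat \<Rightarrow> rat_fun vec set set" where
  "W_ker F = quotient_space (pi_minus ` mat_kernel F) (sp_kernel F)"

text \<open>The strictly proper elements of \<open>F\<^sup>-\<^sup>1(\<Omega>Y) + \<Omega>U\<close>. Modulo \<open>sp_kernel F\<close> they represent the direct
  sum of the finite zero module and \<open>\<W>(ker F)\<close>.\<close>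

definition zero_space :: "rat_fun mat \<Rightarrow> rat_fun vec set" where
  "zero_space F = (poly_preimage F + poly_vecs (dim_col F)) \<inter> strictly_proper_vecs (dim_col F)"

text \<open>The classes of the columns of \<open>G\<close> form a basis, over the complex numbers, of the quotient of
  \<open>zero_space F\<close> by \<open>sp_kernel F\<close>: every class is exactly one linear combination of them.\<close>

definition zero_basis :: "rat_fun mat \<Rightarrow> rat_fun mat \<Rightarrow> bool" where
  "zero_basis F G \<longleftrightarrow> G \<in> carrier_mat (dim_col F) (dim_col G) \<and>
     (\<forall>j < dim_col G. col G j \<in> zero_space F) \<and>
     (\<forall>\<gamma> \<in> quotient_space (zero_space F) (sp_kernel F).
        \<exists>!c. c \<in> carrier_vec (dim_col G) \<and> \<gamma> = (G *\<^sub>v const_vec c) +o sp_kernel F)"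

section \<open>The finite zero matrix\<close>

definition R_solution ::
  "complex mat \<Rightarrow> complex mat \<Rightarrow> complex mat \<Rightarrow> complex mat \<Rightarrow> complex mat \<Rightarrow> bool" where
  "R_solution B D \<Pi>\<^sub>f\<^sub>z\<^sub>k R \<alpha> \<longleftrightarrow>
     R \<in> carrier_mat (dim_col B) (dim_col R) \<and> \<alpha> \<in> carrier_mat (dim_col \<Pi>\<^sub>f\<^sub>z\<^sub>k) (dim_col R) \<and>
     B * R = \<Pi>\<^sub>f\<^sub>z\<^sub>k * \<alpha> \<and> D * R = 0\<^sub>m (dim_row D) (dim_col R)"

definition maximal_R_solution ::
  "complex mat \<Rightarrow> complex mat \<Rightarrow> complex mat \<Rightarrow> complex mat \<Rightarrow> complex mat \<Rightarrow> bool" where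
  "maximal_R_solution B D \<Pi>\<^sub>f\<^sub>z\<^sub>k R\<^sub>0 \<alpha>\<^sub>0 \<longleftrightarrow> R_solution B D \<Pi>\<^sub>f\<^sub>z\<^sub>k R\<^sub>0 \<alpha>\<^sub>0 \<and>
     (\<forall>R \<alpha>. R_solution B D \<Pi>\<^sub>f\<^sub>z\<^sub>k R \<alpha> \<longrightarrow> mat_image R \<subseteq> mat_image R\<^sub>0)"

text \<open>All the data leading to a finite zero matrix, with the basis already chosen so that
  \<open>\<Lambda>\<^sub>f\<^sub>z\<^sub>k\<close>, \<open>\<alpha>\<^sub>0\<close>, \<open>\<Pi>\<^sub>f\<^sub>z\<^sub>k\<close> and \<open>H\<^sub>f\<^sub>z\<^sub>k\<close> are in partitioned form.\<close>

definition zero_data ::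
  "complex mat \<Rightarrow> complex mat \<Rightarrow> complex mat \<Rightarrow> complex mat \<Rightarrow>
   complex mat \<Rightarrow> complex mat \<Rightarrow> complex mat \<Rightarrow> complex mat \<Rightarrow> complex mat \<Rightarrow>
   complex mat \<Rightarrow> complex mat \<Rightarrow> complex mat \<Rightarrow> complex mat \<Rightarrow> bool" where
  "zero_data A B C D H\<^sub>k H\<^sub>f \<Lambda>\<^sub>k \<Lambda>\<^sub>k\<^sub>f \<Lambda>\<^sub>f \<Pi>\<^sub>k \<Pi>\<^sub>f R\<^sub>0 \<alpha>\<^sub>k \<longleftrightarrow>
    (let n = dim_row A; q = dim_col B; p = dim_row C;
         k = dim_row \<Lambda>\<^sub>k; f = dim_row \<Lambda>\<^sub>f; r = dim_col R\<^sub>0;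
         H = append_cols H\<^sub>k H\<^sub>f;
         \<Lambda> = four_block_mat \<Lambda>\<^sub>k \<Lambda>\<^sub>k\<^sub>f (0\<^sub>m f k) \<Lambda>\<^sub>f;
         \<Pi>\<^sub>f\<^sub>z\<^sub>k = append_cols \<Pi>\<^sub>k \<Pi>\<^sub>f;
         \<alpha>\<^sub>0 = \<alpha>\<^sub>k @\<^sub>r 0\<^sub>m f r
     in H\<^sub>k \<in> carrier_mat q k \<and> H\<^sub>f \<in> carrier_mat q f \<and>
        \<Lambda>\<^sub>k \<in> carrier_mat k k \<and> \<Lambda>\<^sub>k\<^sub>f \<in> carrier_mat k f \<and> \<Lambda>\<^sub>f \<in> carrier_mat f f \<and>
        \<Pi>\<^sub>k \<in> carrier_mat n k \<and> \<Pi>\<^sub>f \<in> carrier_mat n f \<and>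
        R\<^sub>0 \<in> carrier_mat q r \<and> \<alpha>\<^sub>k \<in> carrier_mat k r \<and>
        zero_basis (transfer_function A B C D) (const_mat H * resolvent \<Lambda>) \<and>
        A * \<Pi>\<^sub>f\<^sub>z\<^sub>k + B * H = \<Pi>\<^sub>f\<^sub>z\<^sub>k * \<Lambda> \<and> C * \<Pi>\<^sub>f\<^sub>z\<^sub>k + D * H = 0\<^sub>m p (k + f) \<and>
        maximal_R_solution B D \<Pi>\<^sub>f\<^sub>z\<^sub>k R\<^sub>0 \<alpha>\<^sub>0 \<and>
        controllable \<Lambda>\<^sub>k \<alpha>\<^sub>k)"

text \<open>The finite zero matrix is only determined up to similarity; \<open>M\<close> is one of its
  representatives.\<close>

definition finite_zero_matrix ::
  "complex mat \<Rightarrow> complex mat \<Rightarrow> complex mat \<Rightarrow> complex mat \<Rightarrow> complex mat \<Rightarrow> bool" where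
  "finite_zero_matrix A B C D M \<longleftrightarrow>
     (\<exists>H\<^sub>k H\<^sub>f \<Lambda>\<^sub>k \<Lambda>\<^sub>k\<^sub>f \<Pi>\<^sub>k \<Pi>\<^sub>f R\<^sub>0 \<alpha>\<^sub>k. zero_data A B C D H\<^sub>k H\<^sub>f \<Lambda>\<^sub>k \<Lambda>\<^sub>k\<^sub>f M \<Pi>\<^sub>k \<Pi>\<^sub>f R\<^sub>0 \<alpha>\<^sub>k)"

end

theory Submission
  imports Defs
begin

text \<open>
  Put \<open>\<Lambda>\<^sub>\<beta> = \<Lambda>\<^sub>k + \<alpha>\<^sub>k \<beta>\<^sub>k\<close> and \<open>N = H\<^sub>k + R\<^sub>0 \<beta>\<^sub>k\<close>. The Riccati equation says that \<open>\<sigma>\<close> solves the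
  Lyapunov equation \<open>\<sigma> \<Lambda>\<^sub>\<beta> + \<Lambda>\<^sub>\<beta>\<^sup>* \<sigma> + N\<^sup>* N = 0\<close>, and \<open>B R\<^sub>0 = \<Pi>\<^sub>k \<alpha>\<^sub>k\<close>, \<open>D R\<^sub>0 = 0\<close> turn the equations for
  \<open>\<Pi>\<^sub>k\<close> into \<open>A \<Pi>\<^sub>k + B N = \<Pi>\<^sub>k \<Lambda>\<^sub>\<beta>\<close>, \<open>C \<Pi>\<^sub>k + D N = 0\<close>. Therefore
  \<open>F N (z I - \<Lambda>\<^sub>\<beta>)\<^sup>-\<^sup>1 = - C (z I - A)\<^sup>-\<^sup>1 \<Pi>\<^sub>k\<close>, so the second term of \<open>L\<^sub>\<beta>\<close> only adds
  \<open>\<Pi>\<^sub>k \<sigma>\<^sup>-\<^sup>1 N\<^sup>* L\<^sub>0 = \<Pi>\<^sub>k \<sigma>\<^sup>-\<^sup>1 H\<^sub>k\<^sup>* L\<^sub>0\<close> to the input matrix. This is (i), see \<open>closed_loop_response\<close>.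

  The link between the rational zero spaces and the state space is \<open>zero_basis_iff\<close>: the columns of
  \<open>H (z I - \<Lambda>)\<^sup>-\<^sup>1\<close> are a basis of the zero space modulo the strictly proper kernel if and only if \<open>\<Pi>\<close>
  is injective with image \<open>\<V>\<^sup>* \<inter> \<langle>A | B\<rangle>\<close>. A strictly proper zero direction is the input of a
  trajectory with zero output, and it is sent to the initial state of this trajectory. By observability
  this state is unique. The initial states that occur for strictly proper inputs form \<open>\<V>\<^sup>*\<close>
  (\<open>nulling_in_V_star\<close>, \<open>V_star_nulling\<close>), and adding a polynomial input before time zero contributes
  the states in \<open>\<langle>A | B\<rangle>\<close>, which are the remainders on division by \<open>z I - A\<close>.

  For (ii), the image of \<open>\<Pi>\<^sub>k\<close> lies in \<open>\<V>\<^sup>* \<inter> \<C>\<^sup>*\<close> because \<open>(\<Lambda>\<^sub>k, \<alpha>\<^sub>k)\<close> is controllable. Passing from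
  \<open>\<Sigma>\<close> to \<open>\<Sigma>\<^sub>r\<close> drops the inputs \<open>R\<^sub>0\<close> and changes the others by states in this image, which neither
  changes \<open>\<V>\<^sup>*\<close> nor changes \<open>\<C>\<^sup>*\<close> modulo \<open>\<V>\<^sup>* \<inter> \<C>\<^sup>*\<close>. By the maximality of \<open>R\<^sub>0\<close> no nonzero input of
  \<open>\<Sigma>\<^sub>r\<close> moves the zero state into \<open>\<V>\<^sup>*\<close> with zero output (\<open>reduced_no_jump\<close>). Hence a trajectory of
  \<open>\<Sigma>\<^sub>r\<close> with zero output from the zero state to a state in \<open>\<V>\<^sup>*\<close> is zero, and the kernel of \<open>F\<^sub>r\<close> is zero.

  For (iii), \<open>B\<^sub>r L\<^sub>0\<^sup>* = B + \<Pi>\<^sub>k \<sigma>\<^sup>-\<^sup>1 N\<^sup>*\<close> turns the Lyapunov equation into the statement that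
  \<open>A (\<Pi>\<^sub>k \<sigma>\<^sup>-\<^sup>1) + (\<Pi>\<^sub>k \<sigma>\<^sup>-\<^sup>1) \<Lambda>\<^sub>\<beta>\<^sup>*\<close> is a multiple of \<open>B\<^sub>r\<close> (\<open>closed_loop_adjoint\<close>). So on the functionals
  that vanish on \<open>\<langle>A | B\<^sub>r\<rangle>\<close> the transpose of \<open>\<Pi>\<^sub>k \<sigma>\<^sup>-\<^sup>1\<close> intertwines \<open>A\<^sup>T\<close> with a matrix whose eigenvalues
  have positive real part, as \<open>\<Lambda>\<^sub>\<beta>\<close> is stable. If \<open>A\<^sup>T\<close> acts there without such eigenvalues, the
  transpose vanishes, and the functionals vanish on \<open>\<langle>A | B\<rangle>\<close> too. Under (b), \<open>A\<^sup>T\<close> acts there like the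
  transpose of a stabilized matrix.

  For (iv), the same \<open>\<Pi>\<close> satisfies the equations of \<open>\<Sigma>\<^sub>r\<close> with \<open>L\<^sub>0\<^sup>* [N, H\<^sub>f]\<close> in place of \<open>[H\<^sub>k, H\<^sub>f]\<close>
  and the stated matrix in place of \<open>\<Lambda>\<^sub>f\<^sub>z\<^sub>k\<close>; since the reachable subspaces agree, its image is the one
  that \<open>zero_basis_iff\<close> asks for.
\<close>

section \<open>Matrices acting on vectors\<close>

notation mult_mat_vec (infixl "*v" 70) and smult_vec (infixl "*s" 70)

abbreviation (input) adj :: "complex mat \<Rightarrow> complex mat" where
  "adj \<equiv> mat_adjoint"

text \<open>With the dimensions as equations between the arguments these identities can serve as rewrite
  rules.\<close>

lemma mv_add: "dim_vec v = dim_col M \<Longrightarrow> dim_vec w = dim_col M \<Longrightarrow>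
    M *v (v + w) = M *v v + M *v (w :: 'a::comm_ring_1 vec)"
  by (rule mult_add_distrib_mat_vec[of _ "dim_row M" "dim_col M"]) (auto intro: carrier_vecI)

lemma mv_diff: "dim_vec v = dim_col M \<Longrightarrow> dim_vec w = dim_col M \<Longrightarrow>
    M *v (v - w) = M *v v - M *v (w :: 'a::comm_ring_1 vec)"
  by (rule mult_minus_distrib_mat_vec[of _ "dim_row M" "dim_col M"]) (auto intro: carrier_vecI)

lemma mv_smult: "dim_vec v = dim_col M \<Longrightarrow> M *v (a *s v) = a *s (M *v (v :: 'a::field vec))"
  by (rule mult_mat_vec[of _ "dim_row M" "dim_col M"]) (auto intro: carrier_vecI)

lemma mv_uminus: "dim_vec v = dim_col M \<Longrightarrow> M *v (- v) = - (M *v (v :: 'a::comm_ring_1 vec))"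
  by (intro eq_vecI) (auto simp: scalar_prod_def sum_negf)

lemma mv_zero: "k = dim_col M \<Longrightarrow> M *v 0\<^sub>v k = (0\<^sub>v (dim_row M) :: 'a::comm_ring_1 vec)"
  by (intro eq_vecI) (auto simp: scalar_prod_def)

lemma zero_mv: "dim_vec v = k \<Longrightarrow> 0\<^sub>m l k *v v = (0\<^sub>v l :: 'a::comm_ring_1 vec)"
  by (intro eq_vecI) (auto simp: scalar_prod_def)

lemma mat_add_mv: "dim_row M = dim_row N \<Longrightarrow> dim_col M = dim_col N \<Longrightarrow> dim_vec v = dim_col N \<Longrightarrow>
    (M + N) *v v = M *v v + N *v (v :: 'a::comm_ring_1 vec)"
  by (rule add_mult_distrib_mat_vec[of _ "dim_row M" "dim_col M"]) (auto intro: carrier_vecI)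

lemma mat_diff_mv: "dim_row M = dim_row N \<Longrightarrow> dim_col M = dim_col N \<Longrightarrow> dim_vec v = dim_col N \<Longrightarrow>
    (M - N) *v v = M *v v - N *v (v :: 'a::comm_ring_1 vec)"
  by (rule minus_mult_distrib_mat_vec[of _ "dim_row M" "dim_col M"]) (auto intro: carrier_vecI)

lemma mat_mult_mv: "dim_col M = dim_row N \<Longrightarrow> dim_vec v = dim_col N \<Longrightarrow>
    (M * N) *v v = M *v (N *v (v :: 'a::comm_ring_1 vec))"
  by (rule assoc_mult_mat_vec[of _ "dim_row M" "dim_col M" _ "dim_col N"]) (auto intro: carrier_vecI)

lemma mat_smult_mv: "dim_vec v = dim_col M \<Longrightarrow> (a \<cdot>\<^sub>m M) *v v = a *s (M *v (v :: 'a::comm_ring_1 vec))"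
  by (intro eq_vecI) (auto simp: scalar_prod_def sum_distrib_left algebra_simps)

lemma one_mv: "dim_vec v = k \<Longrightarrow> 1\<^sub>m k *v v = (v :: 'a::comm_ring_1 vec)"
  by (rule one_mult_mat_vec) (auto intro: carrier_vecI)

lemmas mv_simps = mv_add mv_diff mv_smult mv_uminus mv_zero zero_mv mat_add_mv mat_diff_mv
  mat_mult_mv mat_smult_mv one_mv uminus_mult_mat_vec

lemma mat_mult_unit:
  fixes M :: "'a::comm_ring_1 mat"
  assumes "j < dim_col M"
  shows "M *v unit_vec (dim_col M) j = col M j"
  using assms by (intro eq_vecI) auto

lemma mat_eqI_mv:
  fixes M N :: "'a::comm_ring_1 mat"
  assumes "M \<in> carrier_mat n m" "N \<in> carrier_mat n m"
    and "\<And>v. v \<in> carrier_vec m \<Longrightarrow> M *v v = N *v v"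
  shows "M = N"
proof (rule eq_matI)
  fix i j assume "i < dim_row N" "j < dim_col N"
  with assms have i: "i < n" and j: "j < m" by auto
  have "M *v unit_vec m j = col M j" "N *v unit_vec m j = col N j"
    using assms(1,2) j by (auto simp: mat_mult_unit)
  then have "col M j = col N j" using assms(3)[of "unit_vec m j"] by simp
  then have "col M j $ i = col N j $ i" by simp
  then show "M $$ (i, j) = N $$ (i, j)" using assms(1,2) i j by simp
qed (use assms in auto)

lemma minv_inverse:
  fixes M :: "'a::field mat"
  assumes M: "M \<in> carrier_mat n n" and X: "X \<in> carrier_mat n n" "M * X = 1\<^sub>m n" "X * M = 1\<^sub>m n"
  shows "minv M = X"
proof (cases "mat_inverse M")
  case None
  have "M \<in> Units (ring_mat TYPE('a) n ())"
    using M X by (auto simp: Units_def ring_mat_def)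
  then show ?thesis using mat_inverse(1)[OF M None, of "()"] by blast
next
  case (Some Y)
  from mat_inverse(2)[OF M this] have Y: "M * Y = 1\<^sub>m n" "Y * M = 1\<^sub>m n" "Y \<in> carrier_mat n n" by auto
  have "Y = Y * (M * X)" using X Y by simp
  also have "\<dots> = (Y * M) * X" by (rule assoc_mult_mat[symmetric, of _ n n _ n _ n]) (use M X Y in auto)
  also have "\<dots> = X" using X Y by simp
  finally show ?thesis using Some by (simp add: minv_def)
qed

lemma invertible_if_injective:
  fixes M :: "'a::field mat"
  assumes M: "M \<in> carrier_mat n n"
    and inj: "\<And>v. v \<in> carrier_vec n \<Longrightarrow> M *v v = 0\<^sub>v n \<Longrightarrow> v = 0\<^sub>v n"
  shows "minv M \<in> carrier_mat n n" "M * minv M = 1\<^sub>m n" "minv M * M = 1\<^sub>m n"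
proof -
  have "det M \<noteq> 0" using det_0_iff_vec_prod_zero_field[OF M] inj by auto
  from det_non_zero_imp_unit[OF M this, of "()"] obtain X where
    X: "X \<in> carrier_mat n n" "M * X = 1\<^sub>m n" "X * M = 1\<^sub>m n"
    by (auto simp: Units_def ring_mat_def)
  then show "minv M \<in> carrier_mat n n" "M * minv M = 1\<^sub>m n" "minv M * M = 1\<^sub>m n"
    using minv_inverse[OF M X] by auto
qed

section \<open>Adjoints\<close>

lemma mat_adjoint_index:
  "adj M = mat (dim_col M) (dim_row M) (\<lambda>(i, j). cnj (M $$ (j, i)))"
  unfolding mat_adjoint_def by (rule eq_matI) (simp_all add: mat_of_rows_index)

lemma mat_adjoint_dims [simp]:
  fixes M :: "complex mat"
  shows "dim_row (adj M) = dim_col M" "dim_col (adj M) = dim_row M"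
  by (auto simp: mat_adjoint_index)

lemma mat_adjoint_carrier [simp]:
  fixes M :: "complex mat"
  shows "adj M \<in> carrier_mat n m \<longleftrightarrow> M \<in> carrier_mat m n"
  unfolding carrier_mat_def by auto

lemma mat_adjoint_mult:
  fixes M N :: "complex mat"
  assumes "dim_col M = dim_row N"
  shows "adj (M * N) = adj N * adj M"
  using assms by (intro eq_matI) (auto simp: mat_adjoint_index scalar_prod_def mult.commute)

lemma mat_adjoint_add:
  fixes M N :: "complex mat"
  assumes "dim_row M = dim_row N" "dim_col M = dim_col N"
  shows "adj (M + N) = adj M + adj N"
  using assms by (intro eq_matI) (auto simp: mat_adjoint_index)

lemma mat_adjoint_diff:
  fixes M N :: "complex mat"
  assumes "dim_row M = dim_row N" "dim_col M = dim_col N"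
  shows "adj (M - N) = adj M - adj N"
  using assms by (intro eq_matI) (auto simp: mat_adjoint_index)

lemma mat_adjoint_uminus: "adj (- M :: complex mat) = - adj M"
  by (intro eq_matI) (auto simp: mat_adjoint_index)

lemma mat_adjoint_adjoint [simp]: "adj (adj M) = (M :: complex mat)"
  by (intro eq_matI) (auto simp: mat_adjoint_index)

lemma mat_adjoint_one [simp]: "adj (1\<^sub>m n :: complex mat) = 1\<^sub>m n"
  by (intro eq_matI) (auto simp: mat_adjoint_index)

lemma mat_adjoint_zero [simp]: "adj (0\<^sub>m n m :: complex mat) = 0\<^sub>m m n"
  by (intro eq_matI) (auto simp: mat_adjoint_index)

lemmas mat_adjoint_simps = mat_adjoint_mult mat_adjoint_add mat_adjoint_diff mat_adjoint_uminus

lemma cscalar_prod_adjoint: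
  fixes M :: "complex mat"
  assumes "v \<in> carrier_vec (dim_col M)" "w \<in> carrier_vec (dim_row M)"
  shows "(M *v v) \<bullet>c w = v \<bullet>c (adj M *v w)"
proof -
  have "(M *v v) \<bullet>c w = (\<Sum>i<dim_row M. \<Sum>j<dim_col M. M $$ (i, j) * v $ j * cnj (w $ i))"
    using assms by (simp add: scalar_prod_def sum_distrib_right atLeast0LessThan)
  also have "\<dots> = (\<Sum>j<dim_col M. \<Sum>i<dim_row M. M $$ (i, j) * v $ j * cnj (w $ i))"
    by (rule sum.swap)
  also have "\<dots> = v \<bullet>c (adj M *v w)"
    using assms by (simp add: mat_adjoint_index scalar_prod_def sum_distrib_left atLeast0LessThan mult_ac)
  finally show ?thesis .
qed

lemma eigenvalue_adjoint:
  fixes M :: "complex mat"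
  assumes M: "M \<in> carrier_mat n n" and ev: "eigenvalue (adj M) s"
  shows "eigenvalue M (cnj s)"
proof (rule ccontr)
  assume no: "\<not> eigenvalue M (cnj s)"
  let ?X = "char_matrix M (cnj s)"
  have X: "?X \<in> carrier_mat n n" using M by simp
  have "det ?X \<noteq> 0" using no eigenvalue_det[OF M] by simp
  from det_non_zero_imp_unit[OF X this, of "()"] obtain Y where
    Y: "Y \<in> carrier_mat n n" "?X * Y = 1\<^sub>m n"
    by (auto simp: Units_def ring_mat_def)
  have adj: "adj ?X = char_matrix (adj M) s"
    using M by (intro eq_matI) (auto simp: mat_adjoint_index char_matrix_def)
  have "adj Y * adj ?X = 1\<^sub>m n"
    using arg_cong[OF Y(2), of adj] X Y(1) by (subst (asm) mat_adjoint_mult) auto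
  then have 1: "adj Y * char_matrix (adj M) s = 1\<^sub>m n" by (simp add: adj)
  obtain v where v: "v \<in> carrier_vec n" "v \<noteq> 0\<^sub>v n" "char_matrix (adj M) s *v v = 0\<^sub>v n"
    using ev M by (subst (asm) eigenvalue_char_matrix[of _ n]) auto
  have "v = (adj Y * char_matrix (adj M) s) *v v" using v 1 by simp
  also have "\<dots> = 0\<^sub>v n" using M Y v by (simp add: mat_mult_mv mv_zero char_matrix_def)
  finally show False using v by simp
qed

section \<open>Subspaces\<close>


lemma vec_subspace_iff:
  "vec_subspace n V \<longleftrightarrow> V \<subseteq> carrier_vec n \<and> 0\<^sub>v n \<in> V \<and>
     (\<forall>x\<in>V. \<forall>y\<in>V. x + y \<in> V) \<and> (\<forall>c. \<forall>x\<in>V. c *s x \<in> V)"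
proof -
  interpret vectorspace "class_ring :: complex ring" "module_vec TYPE(complex) n"
    by (rule vec_vs)
  show ?thesis
    unfolding vec_subspace_def VectorSpace.subspace_def submodule_def
    using vec_vs[where 'a=complex, of n] module_axioms
    by (auto simp: module_vec_simps class_ring_simps)
qed

lemma vec_subspaceD:
  assumes "vec_subspace n V"
  shows "V \<subseteq> carrier_vec n" "0\<^sub>v n \<in> V" "\<And>x y. x \<in> V \<Longrightarrow> y \<in> V \<Longrightarrow> x + y \<in> V"
    "\<And>c x. x \<in> V \<Longrightarrow> c *s x \<in> V" "\<And>x. x \<in> V \<Longrightarrow> x \<in> carrier_vec n"
  using assms by (auto simp: vec_subspace_iff)

lemma vec_subspace_uminus:
  assumes "vec_subspace n V" "x \<in> V"
  shows "- x \<in> V"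
proof -
  have "- x = (- 1) *s x" by (rule eq_vecI) auto
  then show ?thesis using vec_subspaceD(4)[OF assms] by metis
qed

lemma vec_subspace_diff:
  assumes "vec_subspace n V" "x \<in> V" "y \<in> V"
  shows "x - y \<in> V"
proof -
  have "x - y = x + - y" using vec_subspaceD(5)[OF assms(1)] assms(2,3) by (auto intro!: eq_vecI)
  then show ?thesis using vec_subspaceD(3)[OF assms(1)] vec_subspace_uminus assms by metis
qed

lemma vec_subspace_vimage:
  fixes M :: "complex mat"
  assumes M: "M \<in> carrier_mat n m" and V: "vec_subspace n V"
  shows "vec_subspace m {x \<in> carrier_vec m. M *v x \<in> V}"
  unfolding vec_subspace_iff
  using vec_subspaceD[OF V] M by (auto simp: mv_simps)

lemma vec_subspace_mat_image:
  fixes M :: "complex mat"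
  assumes M: "M \<in> carrier_mat n m"
  shows "vec_subspace n (mat_image M)"
  unfolding vec_subspace_iff mat_image_def
proof (intro conjI ballI allI)
  show "(*\<^sub>v) M ` carrier_vec (dim_col M) \<subseteq> carrier_vec n" using M by auto
  show "0\<^sub>v n \<in> (*\<^sub>v) M ` carrier_vec (dim_col M)"
    by (rule image_eqI[of _ _ "0\<^sub>v m"]) (use M in \<open>auto simp: mv_simps\<close>)
next
  fix x y assume "x \<in> (*\<^sub>v) M ` carrier_vec (dim_col M)" "y \<in> (*\<^sub>v) M ` carrier_vec (dim_col M)"
  then obtain a b where "a \<in> carrier_vec m" "b \<in> carrier_vec m" "x = M *v a" "y = M *v b"
    using M by auto
  then show "x + y \<in> (*\<^sub>v) M ` carrier_vec (dim_col M)"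
    by (intro image_eqI[of _ _ "a + b"]) (use M in \<open>auto simp: mv_simps\<close>)
next
  fix c x assume "x \<in> (*\<^sub>v) M ` carrier_vec (dim_col M)"
  then obtain a where "a \<in> carrier_vec m" "x = M *v a" using M by auto
  then show "c *s x \<in> (*\<^sub>v) M ` carrier_vec (dim_col M)"
    by (intro image_eqI[of _ _ "c *s a"]) (use M in \<open>auto simp: mv_simps\<close>)
qed

text \<open>An oblique projector onto a subspace is built one coordinate at a time: onto the vectors of
  \<open>V\<close> supported in the first \<open>m + 1\<close> coordinates one projects by subtracting a multiple of a vector
  whose coordinate \<open>m\<close> is one, and then projecting onto the vectors supported in the first \<open>m\<close>
  coordinates.\<close>

lemma projector_exists:
  assumes V: "vec_subspace n V"
  obtains P where "P \<in> carrier_mat n n" "\<And>x. x \<in> carrier_vec n \<Longrightarrow> P *v x \<in> V"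
    "\<And>v. v \<in> V \<Longrightarrow> P *v v = v"
proof -
  note [simp] = vec_subspaceD(2)[OF V]
  note VD = vec_subspaceD[OF V]
  have "\<exists>P \<in> carrier_mat n n. (\<forall>x \<in> carrier_vec n. P *v x \<in> V) \<and>
     (\<forall>v \<in> V. (\<forall>i. m \<le> i \<and> i < n \<longrightarrow> v $ i = 0) \<longrightarrow> P *v v = v)" if "m \<le> n" for m
    using that
  proof (induction m)
    case 0
    show ?case
    proof (intro bexI[of _ "0\<^sub>m n n"] conjI ballI impI)
      fix v assume "v \<in> V" "\<forall>i. 0 \<le> i \<and> i < n \<longrightarrow> v $ i = 0"
      then have "v = 0\<^sub>v n" using VD(5)[of v] by (intro eq_vecI) auto
      then show "0\<^sub>m n n *v v = v" by (simp add: mv_simps)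
    qed (auto simp: mv_simps)
  next
    case (Suc m)
    then obtain P where P: "P \<in> carrier_mat n n" "\<And>x. x \<in> carrier_vec n \<Longrightarrow> P *v x \<in> V"
      "\<And>v. v \<in> V \<Longrightarrow> (\<And>i. m \<le> i \<Longrightarrow> i < n \<Longrightarrow> v $ i = 0) \<Longrightarrow> P *v v = v" by auto
    show ?case
    proof (cases "\<exists>w \<in> V. (\<forall>i. Suc m \<le> i \<and> i < n \<longrightarrow> w $ i = 0) \<and> w $ m \<noteq> 0")
      case False
      show ?thesis
      proof (intro bexI[of _ P] conjI ballI impI)
        fix v assume v: "v \<in> V" "\<forall>i. Suc m \<le> i \<and> i < n \<longrightarrow> v $ i = 0"
        then have "v $ m = 0" using False by auto
        then show "P *v v = v"
          using v P(3)[of v] by (metis le_eq_less_or_eq Suc_leI)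
      qed (use P in auto)
    next
      case True
      then obtain w0 where w0: "w0 \<in> V" "\<And>i. Suc m \<le> i \<Longrightarrow> i < n \<Longrightarrow> w0 $ i = 0" "w0 $ m \<noteq> 0"
        by auto
      define w where "w = (1 / w0 $ m) *s w0"
      have m: "m < n" using Suc.prems by simp
      have w: "w \<in> V" "\<And>i. Suc m \<le> i \<Longrightarrow> i < n \<Longrightarrow> w $ i = 0" "w $ m = 1"
        using w0 m VD(4)[of w0] VD(5)[OF w0(1)] by (auto simp: w_def)
      have wn: "dim_vec w = n" using VD(5)[OF w(1)] by simp
      define d where "d = w - P *v w"
      have d: "d \<in> V" "dim_vec d = n"
        using w(1) wn P(1,2) VD(5) vec_subspace_diff[OF V] by (auto simp: d_def)
      define E where "E = mat n n (\<lambda>(i, j). if j = m then d $ i else 0)"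
      have E: "E \<in> carrier_mat n n" by (simp add: E_def)
      have Ex: "E *v x = x $ m *s d" if "dim_vec x = n" for x
      proof (rule eq_vecI)
        fix i assume "i < dim_vec (x $ m *s d)"
        then have i: "i < n" using d by simp
        have "(E *v x) $ i = (\<Sum>j<n. (if j = m then d $ i else 0) * x $ j)"
          using i that by (simp add: E_def scalar_prod_def atLeast0LessThan)
        also have "\<dots> = (\<Sum>j<n. if j = m then d $ i * x $ j else 0)"
          by (rule sum.cong) auto
        also have "\<dots> = x $ m * d $ i" using m by simp
        finally show "(E *v x) $ i = (x $ m *s d) $ i" using i d by simp
      qed (use d in \<open>simp add: E_def\<close>)
      show ?thesis
      proof (intro bexI[of _ "P + E"] conjI ballI impI)
        fix x :: "complex vec" assume "x \<in> carrier_vec n"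
        then show "(P + E) *v x \<in> V" using P(1,2) E VD(3,4) d by (auto simp: mv_simps Ex)
      next
        fix v assume v: "v \<in> V" "\<forall>i. Suc m \<le> i \<and> i < n \<longrightarrow> v $ i = 0"
        have vn: "dim_vec v = n" using VD(5)[OF v(1)] by simp
        define u where "u = v - v $ m *s w"
        have u: "u \<in> V" "dim_vec u = n" "v = u + v $ m *s w"
          using v(1) w(1) wn vn VD(4) vec_subspace_diff[OF V] by (auto simp: u_def)
        have "P *v u = u"
        proof (rule P(3)[OF u(1)])
          fix i assume "m \<le> i" "i < n"
          then show "u $ i = 0" using v w vn wn by (cases "i = m") (auto simp: u_def)
        qed
        then have "P *v (u + v $ m *s w) = u + v $ m *s (P *v w)"
          using P(1) u(2) wn by (simp add: mv_simps)
        then have Pv: "P *v v = u + v $ m *s (P *v w)" by (simp flip: u(3))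
        have "(P + E) *v v = P *v v + v $ m *s d"
          using P(1) E vn by (simp add: mv_simps Ex)
        also have "\<dots> = v"
          unfolding Pv d_def using P(1) wn u vn
          by (intro eq_vecI) (simp_all add: u_def algebra_simps del: index_mult_mat_vec)
        finally show "(P + E) *v v = v" .
      qed (use P E in auto)
    qed
  qed
  from this[OF order_refl] show thesis using that by (metis leD)
qed

text \<open>For a projector \<open>P\<close> onto \<open>V\<close>, the rows of \<open>I - P\<close> vanish on \<open>V\<close> and have no other common zeros.\<close>

lemma separating_functional:
  assumes V: "vec_subspace n V" and x: "x \<in> carrier_vec n" "x \<notin> V"
  obtains y where "y \<in> carrier_vec n" "\<And>v. v \<in> V \<Longrightarrow> y \<bullet> v = 0" "y \<bullet> x \<noteq> 0"
proof -
  obtain P where P: "P \<in> carrier_mat n n" "\<And>x. x \<in> carrier_vec n \<Longrightarrow> P *v x \<in> V"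
    "\<And>v. v \<in> V \<Longrightarrow> P *v v = v" using projector_exists[OF V] by metis
  have "P *v x \<noteq> x" using P(2) x by metis
  then obtain i where i: "i < n" "(P *v x) $ i \<noteq> x $ i"
    using P(1) x(1) by (metis carrier_vecD dim_mult_mat_vec carrier_matD(1) eq_vecI)
  define y where "y = row (1\<^sub>m n - P) i"
  have y: "y \<bullet> v = v $ i - (P *v v) $ i" if "v \<in> carrier_vec n" for v
  proof -
    have "y \<bullet> v = ((1\<^sub>m n - P) *v v) $ i" using P(1) i(1) by (simp add: y_def)
    also have "\<dots> = (v - P *v v) $ i" using P(1) that by (simp add: mv_simps)
    finally show ?thesis using P(1) i(1) that by simp
  qed
  show thesis
  proof (rule that)
    show "y \<in> carrier_vec n" using P(1) by (auto simp: y_def intro: carrier_vecI)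
    show "y \<bullet> v = 0" if "v \<in> V" for v using y[OF vec_subspaceD(5)[OF V that]] P(3)[OF that] by simp
    show "y \<bullet> x \<noteq> 0" using y[OF x(1)] i by simp
  qed
qed

lemma vec_subspace_sum:
  assumes V: "vec_subspace n V" and W: "vec_subspace n W"
  shows "vec_subspace n (V + W)"
  unfolding vec_subspace_iff
proof (intro conjI ballI allI)
  note VD = vec_subspaceD[OF V] and WD = vec_subspaceD[OF W]
  show "V + W \<subseteq> carrier_vec n" using VD(5) WD(5) by (auto elim!: set_plus_elim)
  have "0\<^sub>v n + 0\<^sub>v n \<in> V + W" using VD(2) WD(2) by (rule set_plus_intro)
  then show "0\<^sub>v n \<in> V + W" by simp
  fix x assume "x \<in> V + W"
  then obtain v w where x: "x = v + w" "v \<in> V" "w \<in> W" by (auto elim!: set_plus_elim)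
  have d: "dim_vec v = n" "dim_vec w = n" using VD(5) WD(5) x by auto
  have "c *s x = c *s v + c *s w" for c
    unfolding x(1) using d by (intro eq_vecI) (auto simp: distrib_left)
  then show "c *s x \<in> V + W" for c using VD(4) WD(4) x by (metis set_plus_intro)
  fix y assume "y \<in> V + W"
  then obtain v' w' where y: "y = v' + w'" "v' \<in> V" "w' \<in> W" by (auto elim!: set_plus_elim)
  have d': "dim_vec v' = n" "dim_vec w' = n" using VD(5) WD(5) y by auto
  have "x + y = (v + v') + (w + w')"
    unfolding x(1) y(1) using d d' by (intro eq_vecI) auto
  then show "x + y \<in> V + W" using VD(3)[OF x(2) y(2)] WD(3)[OF x(3) y(3)] by (metis set_plus_intro)
qed

lemma mat_mult_in_subspace:
  fixes M :: "complex mat"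
  assumes M: "M \<in> carrier_mat n m" and V: "vec_subspace n V" and c: "c \<in> carrier_vec m"
    and cols: "\<And>j. j < m \<Longrightarrow> M *v unit_vec m j \<in> V"
  shows "M *v c \<in> V"
proof -
  note VD = vec_subspaceD[OF V]
  have "M *v vec m (\<lambda>i. if i < k then c $ i else 0) \<in> V" if "k \<le> m" for k
    using that
  proof (induction k)
    case 0
    have "vec m (\<lambda>i. if i < 0 then c $ i else 0) = 0\<^sub>v m" by (rule eq_vecI) auto
    then show ?case using M VD(2) by (simp add: mv_simps)
  next
    case (Suc k)
    have eq: "vec m (\<lambda>i. if i < Suc k then c $ i else 0) =
        vec m (\<lambda>i. if i < k then c $ i else 0) + c $ k *s unit_vec m k"
      by (rule eq_vecI) (auto simp: less_Suc_eq unit_vec_def)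
    show ?case
      unfolding eq using M Suc VD(3,4) cols[of k] by (simp add: mv_simps)
  qed
  moreover have "vec m (\<lambda>i. if i < m then c $ i else 0) = c" using c by (intro eq_vecI) auto
  ultimately show ?thesis by (metis order_refl)
qed

lemma smult_zero_vec_right: "c *s 0\<^sub>v k = (0\<^sub>v k :: 'a::comm_ring_1 vec)"
  by (intro eq_vecI) auto

section \<open>Reachable subspaces\<close>

lemma pow_mat_Suc_mv:
  fixes A :: "'a::comm_ring_1 mat"
  assumes "A \<in> carrier_mat n n" "x \<in> carrier_vec n"
  shows "A ^\<^sub>m Suc k *v x = A *v (A ^\<^sub>m k *v x)"
  using assms(2)
proof (induction k arbitrary: x)
  case 0
  then show ?case using assms(1) by (simp add: mv_simps)
next
  case (Suc k)
  have "A ^\<^sub>m Suc (Suc k) *v x = A ^\<^sub>m Suc k *v (A *v x)"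
    using assms(1) Suc.prems by (subst pow_mat.simps) (simp add: mv_simps del: pow_mat.simps)
  also have "\<dots> = A *v (A ^\<^sub>m k *v (A *v x))"
    using assms(1) Suc.prems by (intro Suc.IH) auto
  also have "A ^\<^sub>m k *v (A *v x) = A ^\<^sub>m Suc k *v x"
    using assms(1) Suc.prems by (simp add: mv_simps)
  finally show ?case .
qed

lemma reachable_subspace:
  assumes A: "A \<in> carrier_mat n n" and B: "B \<in> carrier_mat n q"
  shows "vec_subspace n (reachable A B)"
proof -
  interpret vectorspace "class_ring :: complex ring" "module_vec TYPE(complex) n"
    by (rule vec_vs)
  have "(\<Union>k. mat_image (A ^\<^sub>m k * B)) \<subseteq> carrier_vec n"
    using A B by (auto simp: mat_image_def intro!: carrier_vecI)
  then have "VectorSpace.subspace class_ring (span (\<Union>k. mat_image (A ^\<^sub>m k * B))) (module_vec TYPE(complex) n)"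
    by (intro span_is_subspace) (simp add: module_vec_simps)
  then show ?thesis using A by (simp add: reachable_def vec_subspace_def)
qed

lemma reachable_contains:
  assumes A: "A \<in> carrier_mat n n" and B: "B \<in> carrier_mat n q" and u: "u \<in> carrier_vec q"
  shows "A ^\<^sub>m k *v (B *v u) \<in> reachable A B"
proof -
  interpret vectorspace "class_ring :: complex ring" "module_vec TYPE(complex) n"
    by (rule vec_vs)
  have sub: "(\<Union>k. mat_image (A ^\<^sub>m k * B)) \<subseteq> carrier_vec n"
    using A B by (auto simp: mat_image_def intro!: carrier_vecI)
  have "A ^\<^sub>m k *v (B *v u) = (A ^\<^sub>m k * B) *v u"
    using A B u by (simp add: mv_simps)
  then have "A ^\<^sub>m k *v (B *v u) \<in> mat_image (A ^\<^sub>m k * B)"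
    unfolding mat_image_def using B u by auto
  then show ?thesis
    unfolding reachable_def using A sub in_own_span[of "\<Union>k. mat_image (A ^\<^sub>m k * B)"]
    by (auto simp: module_vec_simps)
qed

lemma reachable_least:
  assumes A: "A \<in> carrier_mat n n" and B: "B \<in> carrier_mat n q" and S: "vec_subspace n S"
    and sub: "\<And>k u. u \<in> carrier_vec q \<Longrightarrow> A ^\<^sub>m k *v (B *v u) \<in> S"
  shows "reachable A B \<subseteq> S"
proof -
  interpret vectorspace "class_ring :: complex ring" "module_vec TYPE(complex) n"
    by (rule vec_vs)
  have "(\<Union>k. mat_image (A ^\<^sub>m k * B)) \<subseteq> S"
    using A B sub by (auto simp: mat_image_def mv_simps)
  moreover have "submodule class_ring S (module_vec TYPE(complex) n)"
    using S by (simp add: vec_subspace_def VectorSpace.subspace_def)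
  ultimately have "span (\<Union>k. mat_image (A ^\<^sub>m k * B)) \<subseteq> S" by (rule span_is_subset)
  then show ?thesis using A by (simp add: reachable_def)
qed

lemma reachable_input:
  assumes "A \<in> carrier_mat n n" "B \<in> carrier_mat n q" "u \<in> carrier_vec q"
  shows "B *v u \<in> reachable A B"
  using reachable_contains[OF assms, of 0] assms by (simp add: mv_simps)

lemma reachable_invariant:
  assumes A: "A \<in> carrier_mat n n" and B: "B \<in> carrier_mat n q" and x: "x \<in> reachable A B"
  shows "A *v x \<in> reachable A B"
proof -
  have "reachable A B \<subseteq> {x \<in> carrier_vec n. A *v x \<in> reachable A B}"
  proof (rule reachable_least[OF A B])
    show "vec_subspace n {x \<in> carrier_vec n. A *v x \<in> reachable A B}"
      by (rule vec_subspace_vimage[OF A reachable_subspace[OF A B]])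
    fix k u assume u: "(u :: complex vec) \<in> carrier_vec q"
    have "A *v (A ^\<^sub>m k *v (B *v u)) = A ^\<^sub>m Suc k *v (B *v u)"
      using pow_mat_Suc_mv[OF A, of "B *v u" k] B u by simp
    then show "A ^\<^sub>m k *v (B *v u) \<in> {x \<in> carrier_vec n. A *v x \<in> reachable A B}"
      using reachable_contains[OF A B u, of "Suc k"] A B u by (auto intro!: carrier_vecI simp del: pow_mat.simps)
  qed
  then show ?thesis using x by auto
qed

lemma reachable_induct:
  assumes A: "A \<in> carrier_mat n n" and B: "B \<in> carrier_mat n q" and S: "vec_subspace n S"
    and input: "\<And>u. u \<in> carrier_vec q \<Longrightarrow> B *v u \<in> S"
    and step: "\<And>x. x \<in> S \<Longrightarrow> A *v x \<in> S"
  shows "reachable A B \<subseteq> S"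
proof (rule reachable_least[OF A B S])
  fix k u assume u: "(u :: complex vec) \<in> carrier_vec q"
  show "A ^\<^sub>m k *v (B *v u) \<in> S"
  proof (induction k)
    case 0
    then show ?case using A B u input by (simp add: mv_simps)
  next
    case (Suc k)
    then show ?case using pow_mat_Suc_mv[OF A, of "B *v u" k] step B u by simp
  qed
qed

section \<open>Output nulling and controllability subspaces\<close>

locale lti =
  fixes n q p :: nat and A B C D :: "complex mat"
  assumes A: "A \<in> carrier_mat n n" and B: "B \<in> carrier_mat n q"
    and C: "C \<in> carrier_mat p n" and D: "D \<in> carrier_mat p q"
begin

lemma dims [simp]:
  "dim_row A = n" "dim_col A = n" "dim_row B = n" "dim_col B = q"
  "dim_row C = p" "dim_col C = n" "dim_row D = p" "dim_col D = q"
  using A B C D by auto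

text \<open>The form of output nulling in which the input may depend on the state in any way; it is equivalent
  to the existence of a linear feedback.\<close>

definition weakly_invariant :: "complex vec set \<Rightarrow> bool" where
  "weakly_invariant V \<longleftrightarrow> vec_subspace n V \<and>
     (\<forall>v\<in>V. \<exists>u\<in>carrier_vec q. A *v v + B *v u \<in> V \<and> C *v v + D *v u = 0\<^sub>v p)"

text \<open>The inputs that keep the images of the unit vectors under a projector \<open>P\<close> onto \<open>V\<close> in \<open>V\<close> are
  the columns of a feedback \<open>K\<close> for all of \<open>V\<close>.\<close>

lemma weakly_invariant_feedback:
  assumes wi: "weakly_invariant V"
  obtains P K where "P \<in> carrier_mat n n" "K \<in> carrier_mat q n" "\<And>v. v \<in> V \<Longrightarrow> P *v v = v"
    "\<And>x. x \<in> carrier_vec n \<Longrightarrow> (A * P + B * K) *v x \<in> V" "C * P + D * K = 0\<^sub>m p n"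
    "P * (A * P + B * K) = A * P + B * K"
proof -
  have V: "vec_subspace n V" using wi by (simp add: weakly_invariant_def)
  obtain P where P: "P \<in> carrier_mat n n" "\<And>x. x \<in> carrier_vec n \<Longrightarrow> P *v x \<in> V"
    "\<And>v. v \<in> V \<Longrightarrow> P *v v = v" using projector_exists[OF V] by metis
  have "\<forall>j. \<exists>u. u \<in> carrier_vec q \<and> A *v (P *v unit_vec n j) + B *v u \<in> V \<and>
      C *v (P *v unit_vec n j) + D *v u = 0\<^sub>v p"
    using wi P(2) by (fastforce simp: weakly_invariant_def)
  then obtain u where u: "\<And>j. u j \<in> carrier_vec q"
    "\<And>j. A *v (P *v unit_vec n j) + B *v u j \<in> V"
    "\<And>j. C *v (P *v unit_vec n j) + D *v u j = 0\<^sub>v p" by metis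
  define K where "K = mat_of_cols q (map u [0..<n])"
  have K: "K \<in> carrier_mat q n" by (simp add: K_def mat_of_cols_def)
  have Ku: "K *v unit_vec n j = u j" if "j < n" for j
    using that K u(1) mat_mult_unit[of j K] by (simp add: K_def)
  have cols: "(A * P + B * K) *v unit_vec n j \<in> V \<and> (C * P + D * K) *v unit_vec n j = 0\<^sub>v p"
    if "j < n" for j
    using u[of j] that P(1) K by (simp add: mv_simps Ku)
  have cl: "A * P + B * K \<in> carrier_mat n n" using P(1) K by (intro carrier_matI) auto
  have in_V: "(A * P + B * K) *v x \<in> V" if "x \<in> carrier_vec n" for x
    using mat_mult_in_subspace[OF cl V that] cols by simp
  have zero: "C * P + D * K = 0\<^sub>m p n"
  proof (rule eq_matI)
    fix i j assume ij: "i < dim_row (0\<^sub>m p n :: complex mat)" "j < dim_col (0\<^sub>m p n :: complex mat)"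
    then have "((C * P + D * K) *v unit_vec n j) $ i = 0" using cols[of j] by (simp del: index_mult_mat_vec)
    then show "(C * P + D * K) $$ (i, j) = 0\<^sub>m p n $$ (i, j)"
      using ij mat_mult_unit[of j "C * P + D * K"] P(1) K by simp
  qed (use P K in auto)
  have "P * (A * P + B * K) = A * P + B * K"
    by (rule mat_eqI_mv[OF _ cl]) (use P cl in_V in \<open>auto simp: mat_mult_mv\<close>)
  then show thesis using that P(1,3) K in_V zero by blast
qed

lemma output_nulling_iff: "output_nulling A B C D V \<longleftrightarrow> weakly_invariant V"
proof
  assume "output_nulling A B C D V"
  then obtain K where V: "vec_subspace n V" and K: "K \<in> carrier_mat q n"
    "\<And>v. v \<in> V \<Longrightarrow> (A + B * K) *v v \<in> V" "\<And>v. v \<in> V \<Longrightarrow> (C + D * K) *v v = 0\<^sub>v p"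
    by (auto simp: output_nulling_def mat_kernel_def image_subset_iff subset_iff)
  show "weakly_invariant V"
    unfolding weakly_invariant_def
  proof (intro conjI ballI V)
    fix v assume v: "v \<in> V"
    then have "dim_vec v = n" using vec_subspaceD(5)[OF V] by auto
    then show "\<exists>u\<in>carrier_vec q. A *v v + B *v u \<in> V \<and> C *v v + D *v u = 0\<^sub>v p"
      using K(1) K(2,3)[OF v] by (intro bexI[of _ "K *v v"]) (auto simp: mv_simps intro!: carrier_vecI)
  qed
next
  assume wi: "weakly_invariant V"
  then have V: "vec_subspace n V" by (simp add: weakly_invariant_def)
  obtain P K where PK: "P \<in> carrier_mat n n" "K \<in> carrier_mat q n" "\<And>v. v \<in> V \<Longrightarrow> P *v v = v"
    "\<And>x. x \<in> carrier_vec n \<Longrightarrow> (A * P + B * K) *v x \<in> V" "C * P + D * K = 0\<^sub>m p n"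
    using weakly_invariant_feedback[OF wi] by metis
  show "output_nulling A B C D V"
    unfolding output_nulling_def
  proof (intro conjI bexI[of _ K])
    show "vec_subspace (dim_row A) V" using V by simp
    show "K \<in> carrier_mat (dim_col B) (dim_row A)" using PK by simp
    show "(*\<^sub>v) (A + B * K) ` V \<subseteq> V"
    proof clarify
      fix v assume v: "v \<in> V"
      then have vn: "v \<in> carrier_vec n" using vec_subspaceD[OF V] by auto
      have "(A + B * K) *v v = (A * P + B * K) *v v"
        using PK(1,2) PK(3)[OF v] vn by (simp add: mv_simps)
      then show "(A + B * K) *v v \<in> V" using PK(4)[OF vn] by simp
    qed
    show "V \<subseteq> mat_kernel (C + D * K)"
    proof
      fix v assume v: "v \<in> V"
      then have vn: "v \<in> carrier_vec n" using vec_subspaceD[OF V] by auto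
      have "(C + D * K) *v v = (C * P + D * K) *v v"
        using PK(1,2) PK(3)[OF v] vn by (simp add: mv_simps)
      also have "\<dots> = 0\<^sub>v p" using vn by (simp add: PK(5) mv_simps)
      finally show "v \<in> mat_kernel (C + D * K)" using vn PK(2) by (simp add: mat_kernel_def)
    qed
  qed
qed

definition null_step :: "complex vec \<Rightarrow> complex vec \<Rightarrow> complex vec \<Rightarrow> bool" where
  "null_step x u y \<longleftrightarrow> x \<in> carrier_vec n \<and> u \<in> carrier_vec q \<and> y = A *v x + B *v u \<and> C *v x + D *v u = 0\<^sub>v p"

lemma null_step_zero: "null_step (0\<^sub>v n) (0\<^sub>v q) (0\<^sub>v n)"
  by (simp add: null_step_def mv_zero)

lemma null_step_add:
  assumes 1: "null_step x u y" and 2: "null_step x' u' y'"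
  shows "null_step (x + x') (u + u') (y + y')"
proof -
  have d: "dim_vec x = n" "dim_vec u = q" "dim_vec x' = n" "dim_vec u' = q" using 1 2 by (auto simp: null_step_def)
  have "y + y' = A *v (x + x') + B *v (u + u')"
    using 1 2 d unfolding null_step_def by (intro eq_vecI) (simp_all add: mv_simps del: index_mult_mat_vec)
  moreover have "C *v (x + x') + D *v (u + u') = (C *v x + D *v u) + (C *v x' + D *v u')"
    using d by (intro eq_vecI) (simp_all add: mv_simps del: index_mult_mat_vec)
  ultimately show ?thesis using 1 2 unfolding null_step_def by simp
qed

lemma null_step_smult:
  assumes 1: "null_step x u y"
  shows "null_step (c *s x) (c *s u) (c *s y)"
proof -
  have d: "dim_vec x = n" "dim_vec u = q" using 1 by (auto simp: null_step_def)
  have "c *s y = A *v (c *s x) + B *v (c *s u)"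
    using 1 d unfolding null_step_def
    by (intro eq_vecI) (simp_all add: mv_simps distrib_left del: index_mult_mat_vec)
  moreover have "C *v (c *s x) + D *v (c *s u) = c *s (C *v x + D *v u)"
    using d by (intro eq_vecI) (simp_all add: mv_simps distrib_left del: index_mult_mat_vec)
  ultimately show ?thesis using 1 unfolding null_step_def by (simp add: smult_zero_vec_right)
qed

lemma weakly_invariant_iff:
  "weakly_invariant V \<longleftrightarrow> vec_subspace n V \<and> (\<forall>v\<in>V. \<exists>u. \<exists>y\<in>V. null_step v u y)"
  unfolding weakly_invariant_def null_step_def using vec_subspaceD(5) by blast

lemma weakly_invariant_sum:
  assumes V: "weakly_invariant V" and W: "weakly_invariant W"
  shows "weakly_invariant (V + W)"
  unfolding weakly_invariant_iff
proof (intro conjI ballI)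
  show "vec_subspace n (V + W)" using V W by (auto simp: weakly_invariant_def intro: vec_subspace_sum)
  fix x assume "x \<in> V + W"
  then obtain v w where x: "x = v + w" "v \<in> V" "w \<in> W" by (auto elim!: set_plus_elim)
  obtain a v' b w' where "null_step v a v'" "v' \<in> V" "null_step w b w'" "w' \<in> W"
    using V W x unfolding weakly_invariant_iff by metis
  then show "\<exists>u. \<exists>y\<in>V + W. null_step x u y" unfolding x(1) by (metis null_step_add set_plus_intro)
qed

text \<open>Sums of weakly invariant subspaces are weakly invariant, so there is a largest one.\<close>

lemma V_star_greatest:
  shows "weakly_invariant (V_star A B C D)"
    and "weakly_invariant V \<Longrightarrow> V \<subseteq> V_star A B C D"
proof -
  define U where "U = \<Union>{V. weakly_invariant V}"
  have zero: "weakly_invariant {0\<^sub>v n}"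
    by (auto simp: weakly_invariant_def vec_subspace_iff mv_simps intro!: bexI[of _ "0\<^sub>v q"])
  have U: "weakly_invariant U"
    unfolding weakly_invariant_def
  proof (intro conjI ballI)
    show "vec_subspace n U"
      unfolding vec_subspace_iff
    proof (intro conjI ballI allI)
      show "U \<subseteq> carrier_vec n"
        unfolding U_def by (rule Union_least) (simp add: weakly_invariant_def vec_subspaceD(1))
      show "0\<^sub>v n \<in> U" using zero unfolding U_def by blast
      fix x assume "x \<in> U"
      then obtain V where V: "x \<in> V" "weakly_invariant V" unfolding U_def by blast
      show "c *s x \<in> U" for c
        using V vec_subspaceD(4)[of n V x c] unfolding U_def weakly_invariant_def by blast
      fix y assume "y \<in> U"
      then obtain W where W: "y \<in> W" "weakly_invariant W" unfolding U_def by blast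
      show "x + y \<in> U"
        using weakly_invariant_sum[OF V(2) W(2)] set_plus_intro[OF V(1) W(1)]
        unfolding U_def by blast
    qed
    fix v assume "v \<in> U"
    then show "\<exists>u\<in>carrier_vec q. A *v v + B *v u \<in> U \<and> C *v v + D *v u = 0\<^sub>v p"
      unfolding U_def weakly_invariant_def by blast
  qed
  then have "V_star A B C D = U"
    unfolding V_star_def output_nulling_iff by (intro Greatest_equality) (use U in \<open>auto simp: U_def\<close>)
  then show "weakly_invariant (V_star A B C D)"
    and "weakly_invariant V \<Longrightarrow> V \<subseteq> V_star A B C D" using U by (auto simp: U_def)
qed

lemma V_star_subspace: "vec_subspace n (V_star A B C D)"
  using V_star_greatest(1) by (simp add: weakly_invariant_def)

lemma V_star_step:
  assumes "v \<in> V_star A B C D"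
  obtains u where "u \<in> carrier_vec q" "A *v v + B *v u \<in> V_star A B C D" "C *v v + D *v u = 0\<^sub>v p"
  using V_star_greatest(1) assms by (auto simp: weakly_invariant_def)

text \<open>The states from which one step with zero output leads into \<open>\<V>\<^sup>*\<close> form a weakly invariant subspace
  that contains \<open>\<V>\<^sup>*\<close>.\<close>

lemma V_star_backward:
  assumes x: "x \<in> carrier_vec n" and u: "u \<in> carrier_vec q"
    and next_state: "A *v x + B *v u \<in> V_star A B C D" and out: "C *v x + D *v u = 0\<^sub>v p"
  shows "x \<in> V_star A B C D"
proof -
  let ?V = "V_star A B C D"
  let ?W = "{x. \<exists>u. \<exists>y\<in>?V. null_step x u y}"
  note VD = vec_subspaceD[OF V_star_subspace]
  have VW: "?V \<subseteq> ?W" using V_star_greatest(1) unfolding weakly_invariant_iff by blast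
  have "weakly_invariant ?W"
    unfolding weakly_invariant_iff vec_subspace_iff
  proof (intro conjI ballI allI)
    show "?W \<subseteq> carrier_vec n" by (auto simp: null_step_def)
    show "0\<^sub>v n \<in> ?W" using VW VD(2) by blast
    show "x + y \<in> ?W" if "x \<in> ?W" "y \<in> ?W" for x y using that null_step_add VD(3) by blast
    show "c *s x \<in> ?W" if "x \<in> ?W" for c x using that null_step_smult VD(4) by blast
    show "\<exists>u. \<exists>y\<in>?W. null_step v u y" if "v \<in> ?W" for v using that VW by blast
  qed
  moreover have "x \<in> ?W" using assms by (auto simp: null_step_def)
  ultimately show ?thesis using V_star_greatest(2) by blast
qed

text \<open>The stages of \<open>\<C>\<^sup>*\<close>. They increase because a trajectory may rest at zero first, so their union
  is a subspace.\<close>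

primrec nulled_reach :: "nat \<Rightarrow> complex vec set" where
  "nulled_reach 0 = {0\<^sub>v n}"
| "nulled_reach (Suc k) = {y. \<exists>x\<in>nulled_reach k. \<exists>u. null_step x u y}"

lemma nulled_reach_subspace: "vec_subspace n (nulled_reach k)"
proof (induction k)
  case 0
  show ?case by (auto simp: vec_subspace_iff)
next
  case (Suc k)
  note VD = vec_subspaceD[OF Suc]
  show ?case
    unfolding vec_subspace_iff nulled_reach.simps
  proof (intro conjI ballI allI)
    show "{y. \<exists>x\<in>nulled_reach k. \<exists>u. null_step x u y} \<subseteq> carrier_vec n"
      by (auto simp: null_step_def intro!: carrier_vecI)
  qed (use VD(2-4) null_step_zero null_step_add null_step_smult in blast)+
qed

lemma nulled_reach_mono: "j \<le> k \<Longrightarrow> nulled_reach j \<subseteq> nulled_reach k"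
proof (rule lift_Suc_mono_le[of nulled_reach])
  fix i show "nulled_reach i \<subseteq> nulled_reach (Suc i)"
  proof (induction i)
    case 0
    then show ?case using vec_subspaceD(2)[OF nulled_reach_subspace[of "Suc 0"]] by auto
  next
    case (Suc i)
    then show ?case unfolding nulled_reach.simps(2)[of "Suc i"] nulled_reach.simps(2)[of i] by blast
  qed
qed

lemma C_star_eq: "C_star A B C D = (\<Union>k. nulled_reach k)"
proof
  show "C_star A B C D \<subseteq> (\<Union>k. nulled_reach k)"
  proof
    fix x assume "x \<in> C_star A B C D"
    then obtain k :: nat and u \<xi> :: "int \<Rightarrow> complex vec" where
      u: "\<forall>j\<in>{- int k..0}. u j \<in> carrier_vec q" and
      start: "\<xi> (- int k) = 0\<^sub>v n" and
      step: "\<forall>j\<in>{- int k..0}. \<xi> (j + 1) = A *v \<xi> j + B *v u j" and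
      out: "\<forall>j\<in>{- int k..0}. C *v \<xi> j + D *v u j = 0\<^sub>v p" and
      x: "\<xi> 1 = x"
      unfolding C_star_def mem_Collect_eq dims by blast
    have "\<xi> (- int k + int i) \<in> nulled_reach i" if "i \<le> k + 1" for i
      using that
    proof (induction i)
      case 0
      then show ?case using start by simp
    next
      case (Suc i)
      let ?j = "- int k + int i"
      have IH: "\<xi> ?j \<in> nulled_reach i" using Suc by simp
      have "?j \<in> {- int k..0}" using Suc.prems by auto
      then have "null_step (\<xi> ?j) (u ?j) (\<xi> (?j + 1))"
        unfolding null_step_def using u step out vec_subspaceD(5)[OF nulled_reach_subspace IH] by blast
      moreover have "?j + 1 = - int k + int (Suc i)" by simp
      ultimately show ?case unfolding nulled_reach.simps mem_Collect_eq using IH by metis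
    qed
    from this[of "k + 1"] x show "x \<in> (\<Union>k. nulled_reach k)"
      by (auto simp del: nulled_reach.simps)
  qed
  show "(\<Union>k. nulled_reach k) \<subseteq> C_star A B C D"
  proof
    fix x assume "x \<in> (\<Union>k. nulled_reach k)"
    then obtain j where "x \<in> nulled_reach j" by blast
    then have "x \<in> nulled_reach (Suc j)" using nulled_reach_mono[of j "Suc j"] by auto
    then obtain k where x: "x \<in> nulled_reach (Suc k)" by blast
    have "\<exists>(u :: nat \<Rightarrow> complex vec) (\<xi> :: nat \<Rightarrow> complex vec). (\<forall>j<k. u j \<in> carrier_vec q) \<and> \<xi> 0 = 0\<^sub>v n \<and>
        (\<forall>j<k. \<xi> (Suc j) = A *v \<xi> j + B *v u j) \<and> (\<forall>j<k. C *v \<xi> j + D *v u j = 0\<^sub>v p) \<and> \<xi> k = x"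
      if "x \<in> nulled_reach k" for k x
      using that
    proof (induction k arbitrary: x)
      case 0
      then show ?case by auto
    next
      case (Suc k)
      then obtain y a where y: "x = A *v y + B *v a" "y \<in> nulled_reach k" "a \<in> carrier_vec q"
        "C *v y + D *v a = 0\<^sub>v p" by (auto simp: null_step_def)
      from Suc.IH[OF y(2)] obtain u \<xi> where
        *: "\<And>j. j < k \<Longrightarrow> u j \<in> carrier_vec q" "\<xi> 0 = 0\<^sub>v n"
        "\<And>j. j < k \<Longrightarrow> \<xi> (Suc j) = A *v \<xi> j + B *v u j"
        "\<And>j. j < k \<Longrightarrow> C *v \<xi> j + D *v u j = 0\<^sub>v p" "\<xi> k = y" by blast
      show ?case
        by (rule exI[of _ "u(k := a)"], rule exI[of _ "\<xi>(Suc k := x)"])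
          (use * y in \<open>auto simp: less_Suc_eq\<close>)
    qed
    from this[OF x] obtain u \<xi> where
      *: "\<And>j. j < Suc k \<Longrightarrow> u j \<in> carrier_vec q" "\<xi> 0 = 0\<^sub>v n"
      "\<And>j. j < Suc k \<Longrightarrow> \<xi> (Suc j) = A *v \<xi> j + B *v u j"
      "\<And>j. j < Suc k \<Longrightarrow> C *v \<xi> j + D *v u j = 0\<^sub>v p" "\<xi> (Suc k) = x" by blast
    define \<xi>' u' where "\<xi>' = (\<lambda>j. \<xi> (nat (j + int k)))" and "u' = (\<lambda>j. u (nat (j + int k)))"
    have "\<xi>' (j + 1) = A *v \<xi>' j + B *v u' j" "C *v \<xi>' j + D *v u' j = 0\<^sub>v p"
      "u' j \<in> carrier_vec q" if "j \<in> {- int k..0}" for j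
    proof -
      have "nat (j + 1 + int k) = Suc (nat (j + int k))" "nat (j + int k) < Suc k"
        using that by auto
      then show "\<xi>' (j + 1) = A *v \<xi>' j + B *v u' j" "C *v \<xi>' j + D *v u' j = 0\<^sub>v p"
        "u' j \<in> carrier_vec q" using * by (auto simp: \<xi>'_def u'_def)
    qed
    moreover have "\<xi>' (- int k) = 0\<^sub>v n" "\<xi>' 1 = x"
      using * by (auto simp: \<xi>'_def nat_add_distrib)
    ultimately show "x \<in> C_star A B C D"
      unfolding C_star_def mem_Collect_eq dims
      by (intro exI[of _ k] exI[of _ u'] exI[of _ \<xi>'] conjI ballI)
  qed
qed

lemma C_star_subspace: "vec_subspace n (C_star A B C D)"
proof -
  have "x + y \<in> (\<Union>k. nulled_reach k)" if "x \<in> nulled_reach i" "y \<in> nulled_reach j" for x y i j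
  proof -
    have "x \<in> nulled_reach (max i j)" "y \<in> nulled_reach (max i j)"
      using that nulled_reach_mono[of i "max i j"] nulled_reach_mono[of j "max i j"] by auto
    then show ?thesis using vec_subspaceD(3)[OF nulled_reach_subspace] by blast
  qed
  then show ?thesis
    unfolding C_star_eq vec_subspace_iff
    using vec_subspaceD(2,4,5)[OF nulled_reach_subspace] by (auto simp del: nulled_reach.simps) blast+
qed

lemma C_star_step:
  assumes "x \<in> C_star A B C D" "u \<in> carrier_vec q" "C *v x + D *v u = 0\<^sub>v p"
  shows "A *v x + B *v u \<in> C_star A B C D"
proof -
  from assms(1) obtain k where "x \<in> nulled_reach k" by (auto simp: C_star_eq)
  moreover from this have "null_step x u (A *v x + B *v u)"
    using assms vec_subspaceD(5)[OF nulled_reach_subspace] by (simp add: null_step_def)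
  ultimately have "A *v x + B *v u \<in> nulled_reach (Suc k)" by auto
  then show ?thesis unfolding C_star_eq by blast
qed

lemma C_star_induct [consumes 1, case_names zero step]:
  assumes "x \<in> C_star A B C D" and "P (0\<^sub>v n)"
    and "\<And>x u. x \<in> C_star A B C D \<Longrightarrow> P x \<Longrightarrow> u \<in> carrier_vec q \<Longrightarrow> C *v x + D *v u = 0\<^sub>v p \<Longrightarrow>
      P (A *v x + B *v u)"
  shows "P x"
proof -
  have "P x" if "x \<in> nulled_reach k" for k x
    using that
  proof (induction k arbitrary: x)
    case (Suc k)
    then obtain y u where y: "x = A *v y + B *v u" "y \<in> nulled_reach k" "u \<in> carrier_vec q"
      "C *v y + D *v u = 0\<^sub>v p" by (auto simp: null_step_def)
    have "y \<in> C_star A B C D" using y(2) unfolding C_star_eq by blast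
    then show ?case using assms(3) Suc.IH[OF y(2)] y by auto
  qed (use assms(2) in simp)
  then show ?thesis using assms(1) unfolding C_star_eq by blast
qed

end

section \<open>Rational functions\<close>

abbreviation zz :: rat_fun where "zz \<equiv> of_poly [:0, 1:]"

lemma of_poly_hom: "comm_ring_hom of_poly"
  by unfold_locales (simp_all add: of_poly_def Zero_fract_def One_fract_def)

interpretation of_poly: comm_ring_hom of_poly by (rule of_poly_hom)

lemma of_poly_eq_0_iff [simp]: "of_poly p = 0 \<longleftrightarrow> p = 0"
  by (auto simp: of_poly_def Zero_fract_def eq_fract)

lemma of_poly_eq_iff [simp]: "of_poly p = of_poly r \<longleftrightarrow> p = r"
  by (auto simp: of_poly_def eq_fract)

lemma const_fun_hom: "comm_ring_hom const_fun"
  by unfold_locales (simp_all flip: of_poly.hom_add of_poly.hom_mult of_poly.hom_one)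

interpretation const_fun: comm_ring_hom const_fun by (rule const_fun_hom)

lemma rat_fun_cases:
  fixes f :: rat_fun
  obtains a b where "b \<noteq> 0" "f = Fraction_Field.Fract a b"
  by (rule Fract_cases)

lemma strictly_proper_Fract:
  assumes "b \<noteq> 0"
  shows "strictly_proper (Fraction_Field.Fract a b) \<longleftrightarrow> a = 0 \<or> degree a < degree b"
proof
  assume "strictly_proper (Fraction_Field.Fract a b)"
  then obtain c d where cd: "degree c < degree d" "Fraction_Field.Fract a b = Fraction_Field.Fract c d"
    by (auto simp: strictly_proper_def)
  then have d: "d \<noteq> 0" by auto
  have eq: "a * d = c * b" using cd(2) assms d by (simp add: eq_fract)
  show "a = 0 \<or> degree a < degree b"
  proof (cases "a = 0")
    case False
    then have "c \<noteq> 0" using eq d by auto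
    then have "degree a + degree d = degree c + degree b"
      using arg_cong[OF eq, of degree] False assms d by (simp add: degree_mult_eq)
    then show ?thesis using cd(1) by simp
  qed simp
next
  assume "a = 0 \<or> degree a < degree b"
  then show "strictly_proper (Fraction_Field.Fract a b)"
  proof
    assume "a = 0"
    then show ?thesis unfolding strictly_proper_def
      by (intro exI[of _ 0] exI[of _ "[:0, 1:]"]) (simp add: fract_collapse)
  qed (auto simp: strictly_proper_def)
qed

lemma strictly_proper_zero [simp]: "strictly_proper 0"
  using strictly_proper_Fract[of 1 0] by (simp add: Zero_fract_def)

lemma strictly_proper_add:
  assumes "strictly_proper f" "strictly_proper g"
  shows "strictly_proper (f + g)"
proof -
  obtain a b where f: "b \<noteq> 0" "f = Fraction_Field.Fract a b" by (rule rat_fun_cases)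
  obtain c d where g: "d \<noteq> 0" "g = Fraction_Field.Fract c d" by (rule rat_fun_cases)
  have a: "a = 0 \<or> degree a < degree b" and c: "c = 0 \<or> degree c < degree d"
    using assms f g by (simp_all add: strictly_proper_Fract)
  have "a * d = 0 \<or> degree (a * d) < degree b + degree d" "c * b = 0 \<or> degree (c * b) < degree b + degree d"
    using a c f(1) g(1) by (auto simp: degree_mult_eq)
  then have "a * d + c * b = 0 \<or> degree (a * d + c * b) < degree b + degree d"
    by (auto intro: degree_add_less)
  then show ?thesis using f g by (simp add: strictly_proper_Fract degree_mult_eq)
qed

lemma strictly_proper_mult:
  assumes "strictly_proper f" "strictly_proper g"
  shows "strictly_proper (f * g)"
proof -
  obtain a b where f: "b \<noteq> 0" "f = Fraction_Field.Fract a b" by (rule rat_fun_cases)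
  obtain c d where g: "d \<noteq> 0" "g = Fraction_Field.Fract c d" by (rule rat_fun_cases)
  have "a = 0 \<or> degree a < degree b" "c = 0 \<or> degree c < degree d"
    using assms f g by (simp_all add: strictly_proper_Fract)
  then show ?thesis using f g by (auto simp: strictly_proper_Fract degree_mult_eq)
qed

lemma strictly_proper_const_mult:
  assumes "strictly_proper f"
  shows "strictly_proper (const_fun c * f)"
proof -
  obtain a b where f: "b \<noteq> 0" "f = Fraction_Field.Fract a b" by (rule rat_fun_cases)
  have "a = 0 \<or> degree a < degree b"
    using assms f by (simp add: strictly_proper_Fract)
  then show ?thesis using f by (auto simp: of_poly_def strictly_proper_Fract)
qed

lemma strictly_proper_uminus: "strictly_proper f \<Longrightarrow> strictly_proper (- f)"
  using strictly_proper_const_mult[of f "- 1"] by (simp add: const_fun.hom_uminus del: minus_pCons)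

lemma strictly_proper_diff: "strictly_proper f \<Longrightarrow> strictly_proper g \<Longrightarrow> strictly_proper (f - g)"
  using strictly_proper_add[of f "- g"] strictly_proper_uminus[of g] by simp

lemma strictly_proper_sum: "(\<And>i. i \<in> I \<Longrightarrow> strictly_proper (f i)) \<Longrightarrow> strictly_proper (sum f I)"
  by (induction I rule: infinite_finite_induct) (auto intro: strictly_proper_add)

lemma strictly_proper_polynomial:
  assumes "strictly_proper (of_poly a)"
  shows "a = 0"
  using assms strictly_proper_Fract[of 1 a] by (auto simp: of_poly_def)

text \<open>The constant is the leading coefficient of the expansion of \<open>f\<close> at infinity.\<close>

lemma strictly_proper_shift:
  assumes "strictly_proper f"
  shows "\<exists>c. strictly_proper (zz * f - const_fun c)"
proof -
  obtain a b where f: "b \<noteq> 0" "f = Fraction_Field.Fract a b" by (rule rat_fun_cases)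
  have a: "a = 0 \<or> degree a < degree b"
    using assms f by (simp add: strictly_proper_Fract)
  define c where "c = coeff (pCons 0 a) (degree b) / lead_coeff b"
  define r where "r = pCons 0 a - smult c b"
  have "degree r \<le> degree b"
    unfolding r_def by (intro degree_diff_le) (use a in \<open>auto simp: degree_pCons_eq_if\<close>)
  moreover have "coeff r (degree b) = 0" using f(1) by (simp add: r_def c_def)
  ultimately have "r = 0 \<or> degree r < degree b"
    by (metis eq_zero_or_degree_less)
  then have "strictly_proper (Fraction_Field.Fract r b)" using f by (simp add: strictly_proper_Fract)
  moreover have "zz * f - const_fun c = Fraction_Field.Fract r b"
    using f by (simp add: of_poly_def r_def)
  ultimately show ?thesis by metis
qed

lemma zero_if_all_shifts_strictly_proper:
  assumes "\<And>k. strictly_proper (zz ^ k * f)"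
  shows "f = 0"
proof (rule ccontr)
  assume "f \<noteq> 0"
  obtain a b where f: "b \<noteq> 0" "f = Fraction_Field.Fract a b" by (rule rat_fun_cases)
  have a: "a \<noteq> 0" using \<open>f \<noteq> 0\<close> f by (auto simp: fract_collapse)
  have "zz ^ degree b * f = of_poly ([:0, 1:] ^ degree b) * f" by (simp add: of_poly.hom_power)
  also have "\<dots> = Fraction_Field.Fract ([:0, 1:] ^ degree b * a) b"
    using f by (simp add: of_poly_def)
  finally have "strictly_proper (Fraction_Field.Fract ([:0, 1:] ^ degree b * a) b)"
    using assms[of "degree b"] by simp
  then show False using a f(1) by (simp add: strictly_proper_Fract degree_mult_eq degree_power_eq)
qed

lemma strictly_proper_after_division:
  "\<exists>k. \<forall>j\<ge>k. strictly_proper (f / zz ^ j)"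
proof -
  obtain a b where f: "b \<noteq> 0" "f = Fraction_Field.Fract a b" by (rule rat_fun_cases)
  have "strictly_proper (f / zz ^ j)" if "Suc (degree a) \<le> j" for j
  proof -
    have "f / zz ^ j = f / of_poly ([:0, 1:] ^ j)" by (simp add: of_poly.hom_power)
    also have "\<dots> = Fraction_Field.Fract a (b * [:0, 1:] ^ j)"
      using f by (simp add: of_poly_def divide_fract)
    finally show ?thesis
      using that f(1) by (simp add: strictly_proper_Fract degree_mult_eq degree_power_eq)
  qed
  then show ?thesis by blast
qed

lemma strictly_proper_part_zero [simp]: "strictly_proper_part 0 = 0"
proof -
  have "g = 0" if g: "strictly_proper g" "0 - g \<in> range of_poly" for g
  proof -
    from g(2) obtain a where a: "- g = of_poly a" by auto
    with strictly_proper_uminus[OF g(1)] have "strictly_proper (of_poly a)" by simp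
    then have "- g = 0" using a strictly_proper_polynomial by simp
    then show ?thesis by simp
  qed
  moreover have "(0 :: rat_fun) - 0 \<in> range of_poly" by (rule range_eqI[of _ _ 0]) simp
  ultimately show ?thesis
    unfolding strictly_proper_part_def by (intro the_equality) auto
qed

section \<open>Rational vectors\<close>

lemma range_of_poly_closed:
  "0 \<in> range of_poly" "f \<in> range of_poly \<Longrightarrow> g \<in> range of_poly \<Longrightarrow> f + g \<in> range of_poly"
  "f \<in> range of_poly \<Longrightarrow> g \<in> range of_poly \<Longrightarrow> f * g \<in> range of_poly"
  "f \<in> range of_poly \<Longrightarrow> - f \<in> range of_poly"
  by (auto simp flip: of_poly.hom_add of_poly.hom_mult of_poly.hom_uminus of_poly.hom_zero)

lemma range_of_poly_sum: "(\<And>i. i \<in> I \<Longrightarrow> f i \<in> range of_poly) \<Longrightarrow> sum f I \<in> range of_poly"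
  by (induction I rule: infinite_finite_induct) (auto intro: range_of_poly_closed)

lemma poly_vecs_iff: "g \<in> poly_vecs m \<longleftrightarrow> dim_vec g = m \<and> (\<forall>i<m. g $ i \<in> range of_poly)"
  unfolding poly_vecs_def carrier_vec_def by auto

lemma strictly_proper_vecs_iff:
  "g \<in> strictly_proper_vecs m \<longleftrightarrow> dim_vec g = m \<and> (\<forall>i<m. strictly_proper (g $ i))"
  unfolding strictly_proper_vecs_def carrier_vec_def by auto

lemma poly_vecs_add: "g \<in> poly_vecs m \<Longrightarrow> h \<in> poly_vecs m \<Longrightarrow> g + h \<in> poly_vecs m"
  by (auto simp: poly_vecs_iff intro: range_of_poly_closed)

lemma poly_vecs_uminus: "g \<in> poly_vecs m \<Longrightarrow> - g \<in> poly_vecs m"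
  by (auto simp: poly_vecs_iff intro: range_of_poly_closed)

lemma poly_vecs_smult: "g \<in> poly_vecs m \<Longrightarrow> of_poly a *s g \<in> poly_vecs m"
  by (auto simp: poly_vecs_iff intro: range_of_poly_closed)

lemma poly_vecs_const: "v \<in> carrier_vec m \<Longrightarrow> const_vec v \<in> poly_vecs m"
  by (auto simp: poly_vecs_iff)

lemma poly_vecs_zero: "0\<^sub>v m \<in> poly_vecs m"
  by (auto simp: poly_vecs_iff intro: range_of_poly_closed)

lemma poly_vecs_mult:
  assumes "M \<in> carrier_mat k m" "g \<in> poly_vecs m"
  shows "const_mat M *v g \<in> poly_vecs k"
  using assms unfolding poly_vecs_iff
  by (auto simp: scalar_prod_def intro!: range_of_poly_sum range_of_poly_closed(3))

lemma strictly_proper_vecs_add: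
  "g \<in> strictly_proper_vecs m \<Longrightarrow> h \<in> strictly_proper_vecs m \<Longrightarrow> g + h \<in> strictly_proper_vecs m"
  by (auto simp: strictly_proper_vecs_iff intro: strictly_proper_add)

lemma strictly_proper_vecs_diff:
  "g \<in> strictly_proper_vecs m \<Longrightarrow> h \<in> strictly_proper_vecs m \<Longrightarrow> g - h \<in> strictly_proper_vecs m"
  by (auto simp: strictly_proper_vecs_iff intro: strictly_proper_diff)

lemma strictly_proper_vecs_zero: "0\<^sub>v m \<in> strictly_proper_vecs m"
  by (auto simp: strictly_proper_vecs_iff)

lemma strictly_proper_vecs_smult:
  "g \<in> strictly_proper_vecs m \<Longrightarrow> const_fun c *s g \<in> strictly_proper_vecs m"
  by (auto simp: strictly_proper_vecs_iff intro: strictly_proper_const_mult)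

lemma strictly_proper_vecs_mult:
  assumes "M \<in> carrier_mat k m" "g \<in> strictly_proper_vecs m"
  shows "const_mat M *v g \<in> strictly_proper_vecs k"
  using assms unfolding strictly_proper_vecs_iff
  by (auto simp: scalar_prod_def intro!: strictly_proper_sum strictly_proper_const_mult)

lemma polynomial_and_strictly_proper_vec:
  assumes "g \<in> poly_vecs m" "g \<in> strictly_proper_vecs m"
  shows "g = 0\<^sub>v m"
proof (rule eq_vecI)
  fix i assume "i < dim_vec (0\<^sub>v m :: rat_fun vec)"
  then have i: "i < m" by simp
  then obtain a where "g $ i = of_poly a" using assms(1) by (auto simp: poly_vecs_iff)
  moreover have "strictly_proper (g $ i)" using assms(2) i by (auto simp: strictly_proper_vecs_iff)
  ultimately show "g $ i = 0\<^sub>v m $ i" using strictly_proper_polynomial i by auto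
qed (use assms in \<open>simp add: poly_vecs_iff\<close>)

lemma strictly_proper_vecs_shift:
  assumes "g \<in> strictly_proper_vecs m"
  obtains c where "c \<in> carrier_vec m" "zz *s g - const_vec c \<in> strictly_proper_vecs m"
proof -
  have "\<forall>i<m. \<exists>c. strictly_proper (zz * g $ i - const_fun c)"
    using assms strictly_proper_shift by (auto simp: strictly_proper_vecs_iff)
  then obtain c where c: "\<And>i. i < m \<Longrightarrow> strictly_proper (zz * g $ i - const_fun (c i))" by metis
  show thesis
    by (rule that[of "vec m c"]) (use c assms in \<open>auto simp: strictly_proper_vecs_iff\<close>)
qed

section \<open>Resolvents\<close>

text \<open>The resolvent is the adjugate of \<open>z I - A\<close> divided by the characteristic polynomial. The entries of
  the adjugate are minors of size \<open>n - 1\<close> with entries of degree at most one.\<close>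

lemma resolvent:
  assumes A: "A \<in> carrier_mat n n"
  defines "M \<equiv> zz \<cdot>\<^sub>m 1\<^sub>m n - const_mat A"
  shows "resolvent A \<in> carrier_mat n n" "M * resolvent A = 1\<^sub>m n" "resolvent A * M = 1\<^sub>m n"
    and "i < n \<Longrightarrow> j < n \<Longrightarrow> strictly_proper (resolvent A $$ (i, j))"
proof -
  let ?L = "char_poly_matrix A" and ?\<chi> = "char_poly A"
  let ?X = "(1 / of_poly ?\<chi>) \<cdot>\<^sub>m map_mat of_poly (adj_mat ?L)"
  have L: "?L \<in> carrier_mat n n" using A by (simp add: char_poly_matrix_def)
  have M: "M \<in> carrier_mat n n" unfolding M_def using A by (intro carrier_matI) auto
  have \<chi>: "?\<chi> \<noteq> 0" "degree ?\<chi> = n" using degree_monic_char_poly[OF A] by auto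
  have linear: "of_poly (pCons a 1) = zz + const_fun a" for a
    by (simp flip: of_poly.hom_add)
  have M_eq: "M = map_mat of_poly ?L"
    unfolding M_def char_poly_matrix_def using A linear
    by (intro eq_matI) (auto simp: const_fun.hom_uminus)
  note adj = adj_mat[OF L, folded char_poly_def]
  have X: "?X \<in> carrier_mat n n" using adj(1) by simp
  have smult_one: "map_mat of_poly (?\<chi> \<cdot>\<^sub>m 1\<^sub>m n) = of_poly ?\<chi> \<cdot>\<^sub>m 1\<^sub>m n"
    by (intro eq_matI) auto
  have "M * ?X = (1 / of_poly ?\<chi>) \<cdot>\<^sub>m (map_mat of_poly ?L * map_mat of_poly (adj_mat ?L))"
    unfolding M_eq using L adj(1) by (intro mult_smult_distrib[of _ n n]) auto
  also have "map_mat of_poly ?L * map_mat of_poly (adj_mat ?L) = of_poly ?\<chi> \<cdot>\<^sub>m 1\<^sub>m n"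
    using of_poly.mat_hom_mult[OF L adj(1)] adj(2) smult_one by simp
  finally have MX: "M * ?X = 1\<^sub>m n" using \<chi> by (auto intro!: eq_matI)
  have "?X * M = (1 / of_poly ?\<chi>) \<cdot>\<^sub>m (map_mat of_poly (adj_mat ?L) * map_mat of_poly ?L)"
    unfolding M_eq using L adj(1) by (intro mult_smult_assoc_mat[of _ n n]) auto
  also have "map_mat of_poly (adj_mat ?L) * map_mat of_poly ?L = of_poly ?\<chi> \<cdot>\<^sub>m 1\<^sub>m n"
    using of_poly.mat_hom_mult[OF adj(1) L] adj(3) smult_one by simp
  finally have XM: "?X * M = 1\<^sub>m n" using \<chi> by (auto intro!: eq_matI)
  have res: "resolvent A = ?X"
    unfolding resolvent_def using minv_inverse[OF M X MX XM] A by (simp add: M_def)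
  show "resolvent A \<in> carrier_mat n n" "M * resolvent A = 1\<^sub>m n" "resolvent A * M = 1\<^sub>m n"
    using X MX XM by (simp_all add: res)
  assume i: "i < n" and j: "j < n"
  let ?D = "mat_delete ?L j i"
  have "degree (det ?D) \<le> 1 * (n - 1)"
  proof (rule degree_det_le)
    show "?D \<in> carrier_mat (n - 1) (n - 1)" using L by (rule mat_delete_carrier)
    fix k l assume "k < n - 1" "l < n - 1"
    then have "?D $$ (k, l) = ?L $$ (insert_index j k, insert_index i l)"
      using L i j by (simp add: mat_delete_index[of _ "n - 1"])
    moreover have "insert_index j k < n" "insert_index i l < n"
      using \<open>k < n - 1\<close> \<open>l < n - 1\<close> by (auto simp: insert_index_def)
    ultimately show "degree (?D $$ (k, l)) \<le> 1"
      using A by (auto simp: char_poly_matrix_def)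
  qed
  moreover have "adj_mat ?L $$ (i, j) = (- 1) ^ (j + i) * det ?D"
    using L i j by (simp add: adj_mat_def cofactor_def)
  moreover have "(- 1 :: complex poly) ^ (j + i) = 1 \<or> (- 1 :: complex poly) ^ (j + i) = - 1"
    by (cases "even (j + i)") auto
  ultimately have "degree (adj_mat ?L $$ (i, j)) < degree ?\<chi>"
    using i \<chi>(2) by auto
  moreover have "?X $$ (i, j) = Fraction_Field.Fract (adj_mat ?L $$ (i, j)) ?\<chi>"
    using adj(1) i j by (simp add: of_poly_def divide_fract One_fract_def)
  ultimately show "strictly_proper (resolvent A $$ (i, j))"
    unfolding res by (auto simp: strictly_proper_def)
qed

lemma resolvent_dims [simp]:
  assumes "A \<in> carrier_mat n n"
  shows "dim_row (resolvent A) = n" "dim_col (resolvent A) = n"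
  using resolvent(1)[OF assms] by auto

lemma resolvent_mult_eq_iff:
  assumes A: "A \<in> carrier_mat n n" and b: "b \<in> carrier_vec n" and x: "x \<in> carrier_vec n"
  shows "x = resolvent A *v b \<longleftrightarrow> zz *s x = const_mat A *v x + b"
proof -
  let ?M = "zz \<cdot>\<^sub>m 1\<^sub>m n - const_mat A"
  note R = resolvent[OF A]
  have M: "?M \<in> carrier_mat n n" using A by (intro carrier_matI) auto
  have Mx: "?M *v x = zz *s x - const_mat A *v x" using A x by (simp add: mv_simps)
  have "x = resolvent A *v b \<longleftrightarrow> ?M *v x = b"
  proof
    assume "x = resolvent A *v b"
    then have "?M *v x = (?M * resolvent A) *v b" using M R(1) b by (simp add: mat_mult_mv)
    then show "?M *v x = b" using R(2) b by simp
  next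
    assume "?M *v x = b"
    then have "resolvent A *v b = (resolvent A * ?M) *v x"
      using M R(1) x by (simp add: mat_mult_mv)
    then show "x = resolvent A *v b" using R(3) x by simp
  qed
  also have "\<dots> \<longleftrightarrow> zz *s x = const_mat A *v x + b"
    unfolding Mx using A x b by (auto simp: vec_eq_iff algebra_simps simp del: index_mult_mat_vec)
  finally show ?thesis .
qed

lemma resolvent_strictly_proper:
  assumes A: "A \<in> carrier_mat n n" and b: "b \<in> strictly_proper_vecs n \<or> b \<in> const_vec ` carrier_vec n"
  shows "resolvent A *v b \<in> strictly_proper_vecs n"
proof -
  note R = resolvent[OF A]
  have d: "dim_vec b = n" using b by (auto simp: strictly_proper_vecs_iff)
  have "strictly_proper (\<Sum>j<n. resolvent A $$ (i, j) * b $ j)" if i: "i < n" for i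
  proof (rule strictly_proper_sum)
    fix j assume "j \<in> {..<n}"
    then have j: "j < n" by simp
    from b show "strictly_proper (resolvent A $$ (i, j) * b $ j)"
    proof
      assume "b \<in> strictly_proper_vecs n"
      then show ?thesis using R(4)[OF i j] j by (auto simp: strictly_proper_vecs_iff intro: strictly_proper_mult)
    next
      assume "b \<in> const_vec ` carrier_vec n"
      then obtain c where "b $ j = const_fun c" using j by auto
      then show ?thesis using strictly_proper_const_mult[OF R(4)[OF i j], of c] by (simp add: mult.commute)
    qed
  qed
  then show ?thesis
    unfolding strictly_proper_vecs_iff using R(1) d
    by (auto simp: scalar_prod_def atLeast0LessThan)
qed

section \<open>Trajectories with zero output as rational vectors\<close>

lemma mv_carrier_iff [simp]: "M *v v \<in> carrier_vec k \<longleftrightarrow> dim_row M = k"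
  unfolding carrier_vec_def by auto

lemma add_carrier_iff [simp]: "v + w \<in> carrier_vec k \<longleftrightarrow> dim_vec w = k"
  unfolding carrier_vec_def by auto

lemma add_zero_vec: "dim_vec v = k \<Longrightarrow> v + 0\<^sub>v k = (v :: 'a::comm_ring_1 vec)"
  by (intro eq_vecI) auto

lemma const_vec_add: "dim_vec x = dim_vec y \<Longrightarrow> const_vec (x + y) = const_vec x + const_vec y"
  by (intro eq_vecI) (auto simp: const_fun.hom_add)

lemma const_vec_smult: "const_vec (c *s x) = const_fun c *s const_vec x"
  by (intro eq_vecI) (auto simp: const_fun.hom_mult)

lemma const_vec_zero: "const_vec (0\<^sub>v m) = 0\<^sub>v m"
  by (intro eq_vecI) auto

lemma const_vec_mult: "dim_vec x = dim_col M \<Longrightarrow> const_vec (M *v x) = const_mat M *v const_vec x"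
  by (rule const_fun.mult_mat_vec_hom[of _ "dim_row M" "dim_col M"]) (auto intro: carrier_vecI)

lemma const_mat_mult: "dim_col M = dim_row N \<Longrightarrow> const_mat (M * N) = const_mat M * const_mat N"
  by (rule const_fun.mat_hom_mult[of _ "dim_row M" "dim_col M" _ "dim_col N"]) auto

lemma const_mat_add: "dim_row M = dim_row N \<Longrightarrow> dim_col M = dim_col N \<Longrightarrow>
    const_mat (M + N) = const_mat M + const_mat N"
  by (intro eq_matI) (auto simp: const_fun.hom_add)

lemma const_mat_zero: "const_mat (0\<^sub>m k l) = 0\<^sub>m k l"
  by (intro eq_matI) auto

lemmas const_simps = const_vec_add const_vec_smult const_vec_zero const_vec_mult const_mat_mult
  const_mat_add const_mat_zero

lemma strictly_proper_plus_constant: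
  assumes s: "s \<in> strictly_proper_vecs m" and v: "v \<in> carrier_vec m" and sum: "s + const_vec v = 0\<^sub>v m"
  shows "v = 0\<^sub>v m" "s = 0\<^sub>v m"
proof -
  have sm: "dim_vec s = m" using s by (simp add: strictly_proper_vecs_iff)
  have "const_vec v = (s + const_vec v) - s" using sm v by (intro eq_vecI) simp_all
  also have "\<dots> \<in> strictly_proper_vecs m"
    unfolding sum by (intro strictly_proper_vecs_diff strictly_proper_vecs_zero s)
  finally have "const_vec v = 0\<^sub>v m"
    using poly_vecs_const[OF v] polynomial_and_strictly_proper_vec by blast
  then have "const_fun (v $ i) = 0" if "i < m" for i using that v by (auto simp: vec_eq_iff)
  then show "v = 0\<^sub>v m" using v by (intro eq_vecI) auto
  then show "s = 0\<^sub>v m" using sum sm by (simp add: const_vec_zero add_zero_vec)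
qed

context lti
begin

abbreviation F :: "rat_fun mat" where "F \<equiv> transfer_function A B C D"

lemma F_carrier: "F \<in> carrier_mat p q"
  unfolding transfer_function_def using resolvent(1)[OF A] by (intro carrier_matI) auto

lemma F_dims [simp]: "dim_row F = p" "dim_col F = q"
  using F_carrier by auto

lemma F_mult:
  assumes "g \<in> carrier_vec q"
  shows "F *v g = const_mat C *v (resolvent A *v (const_mat B *v g)) + const_mat D *v g"
proof -
  have "F *v g = const_mat D *v g + const_mat C *v (resolvent A *v (const_mat B *v g))"
    unfolding transfer_function_def using assms resolvent_dims[OF A] by (simp add: mv_simps)
  also have "\<dots> = const_mat C *v (resolvent A *v (const_mat B *v g)) + const_mat D *v g"
    by (intro eq_vecI) (simp_all add: add.commute del: index_mult_mat_vec)
  finally show ?thesis .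
qed

text \<open>The generating functions \<open>\<xi> = \<Sum>\<^sub>j x\<^sub>j z\<^sup>-\<^sup>j\<^sup>-\<^sup>1\<close> and \<open>g = \<Sum>\<^sub>j u\<^sub>j z\<^sup>-\<^sup>j\<^sup>-\<^sup>1\<close>, with \<open>j \<ge> 0\<close>, of the states and
  inputs of a trajectory with \<open>x\<^sub>0 = x\<close> and zero output satisfy these equations, which make sense without
  power series and for arbitrary rational \<open>\<xi>\<close> and \<open>g\<close>.\<close>

definition nulling :: "rat_fun vec \<Rightarrow> rat_fun vec \<Rightarrow> complex vec \<Rightarrow> bool" where
  "nulling \<xi> g x \<longleftrightarrow> \<xi> \<in> carrier_vec n \<and> g \<in> carrier_vec q \<and> x \<in> carrier_vec n \<and>
     zz *s \<xi> = const_mat A *v \<xi> + const_mat B *v g + const_vec x \<and>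
     const_mat C *v \<xi> + const_mat D *v g = 0\<^sub>v p"

lemma nullingD:
  assumes "nulling \<xi> g x"
  shows "\<xi> \<in> carrier_vec n" "g \<in> carrier_vec q" "x \<in> carrier_vec n"
    "zz *s \<xi> = const_mat A *v \<xi> + const_mat B *v g + const_vec x"
    "const_mat C *v \<xi> + const_mat D *v g = 0\<^sub>v p"
  using assms by (auto simp: nulling_def)

lemma nulling_add:
  assumes 1: "nulling \<xi> g x" and 2: "nulling \<eta> h y"
  shows "nulling (\<xi> + \<eta>) (g + h) (x + y)"
proof -
  note a = nullingD[OF 1] and b = nullingD[OF 2]
  have "zz *s (\<xi> + \<eta>) = zz *s \<xi> + zz *s \<eta>"
    using a(1) b(1) by (rule smult_add_distrib_vec)
  also have "\<dots> = const_mat A *v (\<xi> + \<eta>) + const_mat B *v (g + h) + const_vec (x + y)"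
    unfolding a(4) b(4) using a(1-3) b(1-3)
    by (intro eq_vecI) (simp_all add: mv_simps const_simps del: index_mult_mat_vec)
  finally have "zz *s (\<xi> + \<eta>) = \<dots>" .
  moreover have "const_mat C *v (\<xi> + \<eta>) + const_mat D *v (g + h) =
      (const_mat C *v \<xi> + const_mat D *v g) + (const_mat C *v \<eta> + const_mat D *v h)"
    using a(1-3) b(1-3) by (intro eq_vecI) (simp_all add: mv_simps del: index_mult_mat_vec)
  ultimately show ?thesis unfolding nulling_def using a b by auto
qed

lemma nulling_smult:
  assumes 1: "nulling \<xi> g x"
  shows "nulling (const_fun c *s \<xi>) (const_fun c *s g) (c *s x)"
proof -
  note a = nullingD[OF 1]
  have "zz *s (const_fun c *s \<xi>) = const_fun c *s (zz *s \<xi>)"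
    by (simp add: smult_smult_assoc mult.commute)
  also have "\<dots> = const_mat A *v (const_fun c *s \<xi>) + const_mat B *v (const_fun c *s g) + const_vec (c *s x)"
    unfolding a(4) using a(1-3)
    by (intro eq_vecI) (simp_all add: mv_simps const_simps distrib_left del: index_mult_mat_vec)
  finally have "zz *s (const_fun c *s \<xi>) = \<dots>" .
  moreover have "const_mat C *v (const_fun c *s \<xi>) + const_mat D *v (const_fun c *s g) =
      const_fun c *s (const_mat C *v \<xi> + const_mat D *v g)"
    using a(1-3) by (intro eq_vecI) (simp_all add: mv_simps distrib_left del: index_mult_mat_vec)
  ultimately show ?thesis unfolding nulling_def using a by (auto simp: smult_zero_vec_right)
qed

lemma nulling_diff:
  assumes 1: "nulling \<xi> g x" and 2: "nulling \<eta> h y"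
  shows "nulling (\<xi> - \<eta>) (g - h) (x - y)"
proof -
  have c: "const_fun (- 1) = - 1" by (simp add: const_fun.hom_uminus)
  have "\<xi> + const_fun (- 1) *s \<eta> = \<xi> - \<eta>" "g + const_fun (- 1) *s h = g - h"
    "x + (- 1) *s y = x - y"
    using nullingD(1-3)[OF 1] nullingD(1-3)[OF 2] by (intro eq_vecI; simp add: c)+
  then show ?thesis using nulling_add[OF 1 nulling_smult[OF 2, of "- 1"]] by simp
qed

lemma state_strictly_proper:
  assumes "\<xi> \<in> carrier_vec n" "g \<in> strictly_proper_vecs q" "x \<in> carrier_vec n"
    and eq: "zz *s \<xi> = const_mat A *v \<xi> + const_mat B *v g + const_vec x"
  shows "\<xi> \<in> strictly_proper_vecs n"
proof -
  have g: "dim_vec g = q" using assms(2) by (simp add: strictly_proper_vecs_iff)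
  have Bg: "const_mat B *v g \<in> strictly_proper_vecs n" using strictly_proper_vecs_mult[OF B assms(2)] .
  have "zz *s \<xi> = const_mat A *v \<xi> + (const_mat B *v g + const_vec x)"
    unfolding eq using assms(1,3) g by (intro eq_vecI) (simp_all add: add.assoc del: index_mult_mat_vec)
  then have "\<xi> = resolvent A *v (const_mat B *v g + const_vec x)"
    using resolvent_mult_eq_iff[OF A _ assms(1), of "const_mat B *v g + const_vec x"] assms(3) by simp
  also have "\<dots> = resolvent A *v (const_mat B *v g) + resolvent A *v const_vec x"
    using assms(3) resolvent_dims[OF A] by (simp add: mv_simps)
  also have "\<dots> \<in> strictly_proper_vecs n"
    using assms(3) Bg by (intro strictly_proper_vecs_add resolvent_strictly_proper[OF A]) auto
  finally show ?thesis .
qed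

lemma nulling_strictly_proper:
  "nulling \<xi> g x \<Longrightarrow> g \<in> strictly_proper_vecs q \<Longrightarrow> \<xi> \<in> strictly_proper_vecs n"
  using state_strictly_proper nullingD by blast

lemma kernel_iff: "g \<in> mat_kernel F \<longleftrightarrow> (\<exists>\<xi>. nulling \<xi> g (0\<^sub>v n))"
proof -
  have res: "zz *s \<xi> = const_mat A *v \<xi> + const_mat B *v g + const_vec (0\<^sub>v n) \<longleftrightarrow>
      \<xi> = resolvent A *v (const_mat B *v g)" if "g \<in> carrier_vec q" "\<xi> \<in> carrier_vec n" for \<xi>
  proof -
    have "const_mat A *v \<xi> + const_mat B *v g + const_vec (0\<^sub>v n) = const_mat A *v \<xi> + const_mat B *v g"
      using that by (intro eq_vecI) (simp_all del: index_mult_mat_vec)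
    then show ?thesis
      using resolvent_mult_eq_iff[OF A, of "const_mat B *v g" \<xi>] that by simp
  qed
  have "g \<in> mat_kernel F \<longleftrightarrow> g \<in> carrier_vec q \<and> F *v g = 0\<^sub>v p" by (simp add: mat_kernel_def)
  also have "\<dots> \<longleftrightarrow> (\<exists>\<xi>. nulling \<xi> g (0\<^sub>v n))"
  proof
    assume g: "g \<in> carrier_vec q \<and> F *v g = 0\<^sub>v p"
    let ?\<xi> = "resolvent A *v (const_mat B *v g)"
    have "?\<xi> \<in> carrier_vec n" using resolvent_dims[OF A] by (auto intro: carrier_vecI)
    then have "nulling ?\<xi> g (0\<^sub>v n)" using g res[of ?\<xi>] F_mult[of g] by (auto simp: nulling_def)
    then show "\<exists>\<xi>. nulling \<xi> g (0\<^sub>v n)" ..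
  next
    assume "\<exists>\<xi>. nulling \<xi> g (0\<^sub>v n)"
    then obtain \<xi> where nul: "nulling \<xi> g (0\<^sub>v n)" ..
    note a = nullingD[OF nul]
    have "\<xi> = resolvent A *v (const_mat B *v g)" using res[OF a(2,1)] a(4) by simp
    then show "g \<in> carrier_vec q \<and> F *v g = 0\<^sub>v p" using a(2,5) F_mult[OF a(2)] by simp
  qed
  finally show ?thesis .
qed

text \<open>One time step: \<open>c\<close> is the input at time \<open>0\<close>.\<close>

lemma nulling_shift:
  assumes nul: "nulling \<xi> g x" and g: "g \<in> strictly_proper_vecs q"
    and c: "c \<in> carrier_vec q" "zz *s g - const_vec c \<in> strictly_proper_vecs q"
  shows "nulling (zz *s \<xi> - const_vec x) (zz *s g - const_vec c) (A *v x + B *v c)"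
    and "C *v x + D *v c = 0\<^sub>v p"
proof -
  note a = nullingD[OF nul]
  let ?\<xi> = "zz *s \<xi> - const_vec x" and ?g = "zz *s g - const_vec c"
  have z\<xi>: "zz *s \<xi> = ?\<xi> + const_vec x" and zg: "zz *s g = ?g + const_vec c"
    using a(1-3) c(1) by (intro eq_vecI; simp)+
  have \<xi>': "?\<xi> = const_mat A *v \<xi> + const_mat B *v g"
    unfolding a(4) using a(1-3) by (intro eq_vecI) (simp_all del: index_mult_mat_vec)
  also have "\<dots> \<in> strictly_proper_vecs n"
    using nulling_strictly_proper[OF nul g] g
    by (intro strictly_proper_vecs_add strictly_proper_vecs_mult[OF A] strictly_proper_vecs_mult[OF B])
  finally have sp: "?\<xi> \<in> strictly_proper_vecs n" .
  have d: "dim_vec ?\<xi> = n" "dim_vec ?g = q" using a(1-3) c(1) by simp_all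
  have "const_mat C *v ?\<xi> + const_mat D *v ?g + const_vec (C *v x + D *v c) =
      const_mat C *v (?\<xi> + const_vec x) + const_mat D *v (?g + const_vec c)"
    using d a(3) c(1) by (intro eq_vecI) (simp_all add: mv_add const_simps del: index_mult_mat_vec)
  also have "\<dots> = zz *s (const_mat C *v \<xi> + const_mat D *v g)"
    unfolding z\<xi>[symmetric] zg[symmetric] using a(1-3)
    by (intro eq_vecI) (simp_all add: mv_simps distrib_left del: index_mult_mat_vec)
  also have "\<dots> = 0\<^sub>v p" by (simp add: a(5) smult_zero_vec_right)
  finally have sum: "const_mat C *v ?\<xi> + const_mat D *v ?g + const_vec (C *v x + D *v c) = 0\<^sub>v p" .
  have "const_mat C *v ?\<xi> + const_mat D *v ?g \<in> strictly_proper_vecs p"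
    using sp c(2) by (intro strictly_proper_vecs_add strictly_proper_vecs_mult[OF C] strictly_proper_vecs_mult[OF D])
  from strictly_proper_plus_constant[OF this _ sum] C D
  have out: "C *v x + D *v c = 0\<^sub>v p" "const_mat C *v ?\<xi> + const_mat D *v ?g = 0\<^sub>v p" by auto
  show "C *v x + D *v c = 0\<^sub>v p" by (rule out(1))
  have "zz *s ?\<xi> = const_mat A *v (zz *s \<xi>) + const_mat B *v (zz *s g)"
    unfolding \<xi>' using a(1-3)
    by (intro eq_vecI) (simp_all add: mv_simps distrib_left del: index_mult_mat_vec)
  also have "\<dots> = const_mat A *v ?\<xi> + const_mat B *v ?g + const_vec (A *v x + B *v c)"
    by (subst z\<xi>, subst zg) (use d a(3) c(1) in
      \<open>intro eq_vecI; simp add: mv_add const_simps del: index_mult_mat_vec\<close>)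
  finally show "nulling ?\<xi> ?g (A *v x + B *v c)"
    unfolding nulling_def using out(2) d a(3) c(1) by (auto intro!: carrier_vecI)
qed

text \<open>Repeated shifts of a free motion with zero output show that \<open>C A\<^sup>k x = 0\<close> for all \<open>k\<close>.\<close>

lemma nulling_without_input:
  assumes obs: "observable C A" and nul: "nulling \<xi> (0\<^sub>v q) x"
  shows "x = 0\<^sub>v n"
proof -
  have "C *v (A ^\<^sub>m k *v x) = 0\<^sub>v p" for k
    using nul
  proof (induction k arbitrary: \<xi> x)
    case (0 \<xi> x)
    have z: "zz *s 0\<^sub>v q - const_vec (0\<^sub>v q) = 0\<^sub>v q" by (intro eq_vecI) auto
    then show ?case
      using nulling_shift(2)[OF 0 strictly_proper_vecs_zero, of "0\<^sub>v q"] strictly_proper_vecs_zero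
        nullingD(3)[OF 0] by (simp add: mv_simps add_zero_vec)
  next
    case (Suc k \<xi> x)
    have z: "zz *s 0\<^sub>v q - const_vec (0\<^sub>v q) = 0\<^sub>v q" by (intro eq_vecI) auto
    have "nulling (zz *s \<xi> - const_vec x) (0\<^sub>v q) (A *v x)"
      using nulling_shift(1)[OF Suc.prems strictly_proper_vecs_zero, of "0\<^sub>v q"] strictly_proper_vecs_zero z
        nullingD(3)[OF Suc.prems] by (simp add: mv_simps add_zero_vec)
    from Suc.IH[OF this] show ?case
      using nullingD(3)[OF Suc.prems] pow_carrier_mat[OF A] by (simp add: mat_mult_mv)
  qed
  then have "x \<in> (\<Inter>k. mat_kernel (C * A ^\<^sub>m k))"
    using nullingD(3)[OF nul] pow_carrier_mat[OF A] by (auto simp: mat_kernel_def mat_mult_mv)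
  then show ?thesis using obs unfolding observable_def dims by blast
qed

lemma nulling_state_unique:
  assumes obs: "observable C A" and "nulling \<xi> g x" "nulling \<eta> g y"
  shows "x = y"
proof -
  have c: "x \<in> carrier_vec n" "y \<in> carrier_vec n" "g \<in> carrier_vec q"
    using assms(2,3)[THEN nullingD(3)] nullingD(2)[OF assms(2)] by auto
  then have "nulling (\<xi> - \<eta>) (0\<^sub>v q) (x - y)" using nulling_diff[OF assms(2,3)] by simp
  then have "x - y = 0\<^sub>v n" by (rule nulling_without_input[OF obs])
  then show ?thesis using c by (auto simp: vec_eq_iff)
qed

lemma nulling_zero: "nulling (0\<^sub>v n) (0\<^sub>v q) (0\<^sub>v n)"
  by (auto simp: nulling_def mv_simps const_simps smult_zero_vec_right add_zero_vec)

text \<open>The initial states of such trajectories form a weakly invariant subspace, since a trajectory can be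
  shifted by one step.\<close>

lemma nulling_in_V_star:
  assumes "nulling \<xi> g x" "g \<in> strictly_proper_vecs q"
  shows "x \<in> V_star A B C D"
proof -
  let ?W = "{x. \<exists>\<xi> g. g \<in> strictly_proper_vecs q \<and> nulling \<xi> g x}"
  have "weakly_invariant ?W"
    unfolding weakly_invariant_def vec_subspace_iff
  proof (intro conjI ballI allI)
    show "?W \<subseteq> carrier_vec n" using nullingD(3) by blast
    show "0\<^sub>v n \<in> ?W" using nulling_zero strictly_proper_vecs_zero by blast
    show "x + y \<in> ?W" if "x \<in> ?W" "y \<in> ?W" for x y
      using that nulling_add strictly_proper_vecs_add by blast
    show "c *s x \<in> ?W" if "x \<in> ?W" for c x
      using that nulling_smult strictly_proper_vecs_smult by blast
    fix v assume "v \<in> ?W"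
    then obtain \<xi> g where g: "g \<in> strictly_proper_vecs q" and nul: "nulling \<xi> g v" by blast
    obtain c where c: "c \<in> carrier_vec q" "zz *s g - const_vec c \<in> strictly_proper_vecs q"
      using strictly_proper_vecs_shift[OF g] .
    show "\<exists>u\<in>carrier_vec q. A *v v + B *v u \<in> ?W \<and> C *v v + D *v u = 0\<^sub>v p"
      using nulling_shift[OF nul g c] c by blast
  qed
  from V_star_greatest(2)[OF this] assms show ?thesis by blast
qed

text \<open>With a projector \<open>P\<close> onto \<open>\<V>\<^sup>*\<close> and a feedback \<open>K\<close>, the state \<open>P \<eta>\<close> and the input \<open>K \<eta>\<close> for
  \<open>\<eta> = (z I - (A P + B K))\<^sup>-\<^sup>1 x\<close> form a trajectory: the columns of \<open>A P + B K\<close> lie in \<open>\<V>\<^sup>*\<close>, where \<open>P\<close>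
  is the identity.\<close>

lemma V_star_nulling:
  assumes x: "x \<in> V_star A B C D"
  obtains \<xi> g where "nulling \<xi> g x" "g \<in> strictly_proper_vecs q"
proof -
  obtain P K where P: "P \<in> carrier_mat n n" "\<And>v. v \<in> V_star A B C D \<Longrightarrow> P *v v = v" and
    K: "K \<in> carrier_mat q n" and CP: "C * P + D * K = 0\<^sub>m p n" and
    PA: "P * (A * P + B * K) = A * P + B * K"
    using weakly_invariant_feedback[OF V_star_greatest(1)] by metis
  have xn: "x \<in> carrier_vec n" using vec_subspaceD(5)[OF V_star_subspace x] .
  let ?M = "A * P + B * K"
  have M: "?M \<in> carrier_mat n n" using P(1) K by (intro carrier_matI) auto
  define \<eta> where "\<eta> = resolvent ?M *v const_vec x"
  have \<eta>: "\<eta> \<in> carrier_vec n" using resolvent_dims[OF M] by (simp add: \<eta>_def)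
  have eq: "zz *s \<eta> = const_mat ?M *v \<eta> + const_vec x"
    using resolvent_mult_eq_iff[OF M _ \<eta>, of "const_vec x"] xn by (simp add: \<eta>_def)
  have sp: "\<eta> \<in> strictly_proper_vecs n"
    unfolding \<eta>_def using xn by (intro resolvent_strictly_proper[OF M]) auto
  have "zz *s (const_mat P *v \<eta>) = const_mat P *v (zz *s \<eta>)"
    using P(1) \<eta> by (simp add: mv_simps)
  also have "\<dots> = const_mat P *v (const_mat ?M *v \<eta>) + const_mat P *v const_vec x"
    unfolding eq using P(1) K xn by (simp add: mv_simps)
  also have "const_mat P *v (const_mat ?M *v \<eta>) = const_mat (P * ?M) *v \<eta>"
    using P(1) K \<eta> by (simp add: const_mat_mult mat_mult_mv)
  also have "const_mat (P * ?M) *v \<eta> = const_mat A *v (const_mat P *v \<eta>) + const_mat B *v (const_mat K *v \<eta>)"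
    unfolding PA using P(1) K \<eta> by (simp add: const_simps mv_simps)
  also have "const_mat P *v const_vec x = const_vec x"
    using P xn x by (simp flip: const_vec_mult)
  finally have 1: "zz *s (const_mat P *v \<eta>) =
    const_mat A *v (const_mat P *v \<eta>) + const_mat B *v (const_mat K *v \<eta>) + const_vec x" .
  have "const_mat C *v (const_mat P *v \<eta>) + const_mat D *v (const_mat K *v \<eta>) =
      const_mat (C * P + D * K) *v \<eta>"
    using P(1) K \<eta> by (simp add: const_simps mv_simps)
  also have "\<dots> = 0\<^sub>v p" unfolding CP using \<eta> by (simp add: const_simps mv_simps)
  finally have "nulling (const_mat P *v \<eta>) (const_mat K *v \<eta>) x"
    unfolding nulling_def using 1 P(1) K xn by simp
  moreover have "const_mat K *v \<eta> \<in> strictly_proper_vecs q"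
    by (rule strictly_proper_vecs_mult[OF K sp])
  ultimately show thesis by (rule that)
qed

text \<open>If an input that moves the zero state within \<open>\<V>\<^sup>*\<close> without an immediate output is zero, then a
  strictly proper element of the kernel stays strictly proper under every multiplication by \<open>z\<close>.\<close>

lemma kernel_trivial:
  assumes no_jump: "\<And>w. w \<in> carrier_vec q \<Longrightarrow> B *v w \<in> V_star A B C D \<Longrightarrow> D *v w = 0\<^sub>v p \<Longrightarrow> w = 0\<^sub>v q"
  shows "mat_kernel F = {0\<^sub>v q}"
proof -
  note closed = mat_kernel_smult[OF F_carrier]
  have step: "zz *s g \<in> strictly_proper_vecs q" if g: "g \<in> mat_kernel F" "g \<in> strictly_proper_vecs q" for g
  proof -
    obtain \<xi> where nul: "nulling \<xi> g (0\<^sub>v n)" using g(1) kernel_iff by blast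
    obtain c where c: "c \<in> carrier_vec q" "zz *s g - const_vec c \<in> strictly_proper_vecs q"
      using strictly_proper_vecs_shift[OF g(2)] .
    note s = nulling_shift[OF nul g(2) c]
    have "A *v 0\<^sub>v n + B *v c = B *v c" "C *v 0\<^sub>v n + D *v c = D *v c"
      by (simp_all add: mv_zero)
    then have "c = 0\<^sub>v q" using no_jump[OF c(1)] nulling_in_V_star[OF s(1) c(2)] s(2) by metis
    moreover have "zz *s g - const_vec (0\<^sub>v q) = zz *s g"
      using g(2) by (intro eq_vecI) (auto simp: strictly_proper_vecs_iff)
    ultimately show ?thesis using c(2) by simp
  qed
  have sp_zero: "g = 0\<^sub>v q" if g: "g \<in> mat_kernel F" "g \<in> strictly_proper_vecs q" for g
  proof -
    have gq: "dim_vec g = q" using g(2) by (simp add: strictly_proper_vecs_iff)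
    have all: "zz ^ k *s g \<in> strictly_proper_vecs q" for k
    proof (induction k)
      case (Suc k)
      have "zz *s (zz ^ k *s g) \<in> strictly_proper_vecs q" by (rule step[OF closed[OF g(1)] Suc])
      then show ?case by (simp add: smult_smult_assoc)
    qed (use g in simp)
    show ?thesis
    proof (rule eq_vecI)
      fix i assume "i < dim_vec (0\<^sub>v q :: rat_fun vec)"
      then have i: "i < q" by simp
      have "strictly_proper (zz ^ k * g $ i)" for k
        using all[of k] i gq by (auto simp: strictly_proper_vecs_iff)
      then show "g $ i = 0\<^sub>v q $ i" using i zero_if_all_shifts_strictly_proper by simp
    qed (simp add: gq)
  qed
  have "g = 0\<^sub>v q" if g: "g \<in> mat_kernel F" for g
  proof -
    have gq: "dim_vec g = q" using g mat_kernel_carrier[OF F_carrier] by auto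
    have "\<forall>i. \<exists>k. \<forall>j\<ge>k. strictly_proper (g $ i / zz ^ j)"
      using strictly_proper_after_division by blast
    then obtain k where k: "\<And>i j. k i \<le> j \<Longrightarrow> strictly_proper (g $ i / zz ^ j)" by metis
    define j where "j = Max (k ` {..<q})"
    have "k i \<le> j" if "i < q" for i unfolding j_def using that by (intro Max_ge) auto
    then have "(1 / zz ^ j) *s g \<in> strictly_proper_vecs q"
      using k gq by (simp add: strictly_proper_vecs_iff)
    then have "(1 / zz ^ j) *s g = 0\<^sub>v q" by (rule sp_zero[OF closed[OF g]])
    then have "(1 / zz ^ j) * g $ i = 0" if "i < q" for i
      using that gq by (auto simp: vec_eq_iff)
    then show ?thesis using gq by (intro eq_vecI) auto
  qed
  moreover have "0\<^sub>v q \<in> mat_kernel F" using nulling_zero kernel_iff by blast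
  ultimately show ?thesis by blast
qed

section \<open>The zero space and the state space\<close>

text \<open>Division of the polynomial \<open>B h\<close> by \<open>z I - A\<close>, with quotient \<open>X\<close> and constant remainder \<open>r\<close>. The
  remainders that occur are the reachable states.\<close>

definition division :: "rat_fun vec \<Rightarrow> rat_fun vec \<Rightarrow> complex vec \<Rightarrow> bool" where
  "division h X r \<longleftrightarrow> h \<in> poly_vecs q \<and> X \<in> poly_vecs n \<and> r \<in> carrier_vec n \<and>
     const_mat B *v h + const_mat A *v X = zz *s X + const_vec r"

lemma division_dims:
  assumes "division h X r"
  shows "dim_vec h = q" "dim_vec X = n" "dim_vec r = n"
  using assms by (auto simp: division_def poly_vecs_iff)

lemma division_zero: "division (0\<^sub>v q) (0\<^sub>v n) (0\<^sub>v n)"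
  by (simp add: division_def poly_vecs_zero mv_zero const_vec_zero smult_zero_vec_right)

lemma division_add:
  assumes 1: "division h X r" and 2: "division h' X' r'"
  shows "division (h + h') (X + X') (r + r')"
proof -
  note d = division_dims[OF 1] division_dims[OF 2]
  have "const_mat B *v (h + h') + const_mat A *v (X + X') =
    (const_mat B *v h + const_mat A *v X) + (const_mat B *v h' + const_mat A *v X')"
    using d by (intro eq_vecI) (simp_all add: mv_simps del: index_mult_mat_vec)
  also have "\<dots> = (zz *s X + const_vec r) + (zz *s X' + const_vec r')"
    using 1 2 by (simp add: division_def)
  also have "\<dots> = zz *s (X + X') + const_vec (r + r')"
    using d by (intro eq_vecI) (simp_all add: const_simps distrib_left)
  finally show ?thesis using 1 2 by (auto simp: division_def intro: poly_vecs_add)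
qed

lemma division_smult:
  assumes 1: "division h X r"
  shows "division (const_fun c *s h) (const_fun c *s X) (c *s r)"
proof -
  note d = division_dims[OF 1]
  have "const_mat B *v (const_fun c *s h) + const_mat A *v (const_fun c *s X) =
    const_fun c *s (const_mat B *v h + const_mat A *v X)"
    using d by (intro eq_vecI) (simp_all add: mv_simps distrib_left del: index_mult_mat_vec)
  also have "\<dots> = const_fun c *s (zz *s X + const_vec r)" using 1 by (simp add: division_def)
  also have "\<dots> = zz *s (const_fun c *s X) + const_vec (c *s r)"
    using d by (intro eq_vecI) (simp_all add: const_simps distrib_left mult.left_commute)
  finally show ?thesis using 1 by (auto simp: division_def intro: poly_vecs_smult)
qed

text \<open>Horner's rule: appending the constant coefficient \<open>c\<close> to the input changes the remainder by one
  step of the state equation.\<close>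

lemma division_step:
  assumes 1: "division h X r" and c: "c \<in> carrier_vec q"
  shows "division (zz *s h + const_vec c) (zz *s X + const_vec r) (A *v r + B *v c)"
proof -
  note d = division_dims[OF 1]
  let ?X = "zz *s X + const_vec r" and ?r = "A *v r + B *v c"
  have "const_mat B *v (zz *s h + const_vec c) + const_mat A *v ?X =
    zz *s (const_mat B *v h + const_mat A *v X) + const_vec ?r"
    using d c by (intro eq_vecI) (simp_all add: mv_simps const_simps distrib_left del: index_mult_mat_vec)
  also have "\<dots> = zz *s ?X + const_vec ?r" using 1 by (simp add: division_def)
  finally show ?thesis
    using 1 c d by (auto simp: division_def intro!: poly_vecs_add poly_vecs_smult poly_vecs_const intro: carrier_vecI)
qed

lemma polynomial_input_division:
  assumes h: "h \<in> poly_vecs q"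
  obtains X r where "division h X r" "r \<in> reachable A B"
proof -
  note RD = vec_subspaceD[OF reachable_subspace[OF A B]]
  have ex: "\<exists>X r. division (map_vec of_poly H) X r \<and> r \<in> reachable A B"
    if "dim_vec H = q" "\<And>i j. i < q \<Longrightarrow> d \<le> j \<Longrightarrow> coeff (H $ i) j = 0" for H d
    using that
  proof (induction d arbitrary: H)
    case 0
    then have "H = 0\<^sub>v q" by (intro eq_vecI) (auto intro: poly_eqI)
    then have "map_vec of_poly H = 0\<^sub>v q" by (intro eq_vecI) auto
    then show ?case using division_zero RD(2) by auto
  next
    case (Suc d)
    define H' where "H' = map_vec (poly_shift 1) H"
    define c where "c = map_vec (\<lambda>a. coeff a 0) H"
    have c: "dim_vec c = q" "dim_vec H' = q" using Suc.prems by (simp_all add: c_def H'_def)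
    have pc: "a = pCons (coeff a 0) (poly_shift 1 a)" for a :: "complex poly"
      by (rule poly_eqI) (simp add: coeff_pCons coeff_poly_shift split: nat.split)
    have H: "map_vec of_poly H = zz *s map_vec of_poly H' + const_vec c"
    proof (rule eq_vecI)
      fix i assume "i < dim_vec (zz *s map_vec of_poly H' + const_vec c)"
      then have i: "i < q" using c by simp
      have "of_poly (H $ i) = of_poly (pCons (coeff (H $ i) 0) (poly_shift 1 (H $ i)))"
        using pc[of "H $ i"] by simp
      also have "\<dots> = zz * of_poly (poly_shift 1 (H $ i)) + const_fun (coeff (H $ i) 0)"
        by (simp flip: of_poly.hom_add of_poly.hom_mult)
      finally show "map_vec of_poly H $ i = (zz *s map_vec of_poly H' + const_vec c) $ i"
        using i Suc.prems by (simp add: H'_def c_def)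
    qed (use Suc.prems c in simp)
    have "\<exists>X r. division (map_vec of_poly H') X r \<and> r \<in> reachable A B"
      by (rule Suc.IH) (use Suc.prems in \<open>auto simp: H'_def coeff_poly_shift\<close>)
    then obtain X r where X: "division (map_vec of_poly H') X r" and r: "r \<in> reachable A B" by blast
    have cq: "c \<in> carrier_vec q" using c(1) by (rule carrier_vecI)
    show ?case
      unfolding H using division_step[OF X cq] RD(3)[OF reachable_invariant[OF A B r] reachable_input[OF A B cq]]
      by blast
  qed
  have "\<forall>i<q. \<exists>a. h $ i = of_poly a" using h by (auto simp: poly_vecs_iff)
  then obtain a where a: "\<And>i. i < q \<Longrightarrow> h $ i = of_poly (a i)" by metis
  define H where "H = vec q a"
  have hH: "h = map_vec of_poly H" using a h by (intro eq_vecI) (auto simp: H_def poly_vecs_iff)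
  define d where "d = Suc (Max ((\<lambda>i. degree (a i)) ` {..<q}))"
  have "coeff (H $ i) j = 0" if "i < q" "d \<le> j" for i j
  proof -
    have "degree (a i) < d" unfolding d_def less_Suc_eq_le using that by (intro Max_ge) auto
    then show ?thesis using that by (simp add: H_def coeff_eq_0)
  qed
  then show thesis using ex[of H d] that by (auto simp: hH H_def)
qed

lemma reachable_remainder:
  assumes r: "r \<in> reachable A B"
  obtains h X where "division h X r"
proof -
  have "reachable A B \<subseteq> {r. \<exists>h X. division h X r}"
  proof (rule reachable_induct[OF A B])
    show "vec_subspace n {r. \<exists>h X. division h X r}"
      unfolding vec_subspace_iff using division_zero division_add division_smult
      by (auto simp: division_dims(3) intro: carrier_vecI) blast+
    fix u assume u: "(u :: complex vec) \<in> carrier_vec q"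
    have "A *v 0\<^sub>v n + B *v u = B *v u" by (simp add: mv_zero)
    then show "B *v u \<in> {r. \<exists>h X. division h X r}" using division_step[OF division_zero u] by auto
  next
    fix x assume "x \<in> {r. \<exists>h X. division h X r}"
    then obtain h X where 1: "division h X x" by blast
    have "A *v x + B *v 0\<^sub>v q = A *v x" by (simp add: mv_zero add_zero_vec)
    then show "A *v x \<in> {r. \<exists>h X. division h X r}" using division_step[OF 1 zero_carrier_vec] by auto
  qed
  with r that show thesis by blast
qed

text \<open>Subtracting a polynomial input \<open>h\<close> from \<open>g\<close> subtracts the quotient of \<open>B h\<close> by \<open>z I - A\<close> from the
  state and shifts the initial state by the remainder. What is left of the output is a polynomial part
  and a strictly proper part, which have to vanish separately.\<close>

lemma zero_space_iff:
  "g \<in> zero_space F \<longleftrightarrow> g \<in> strictly_proper_vecs q \<and> (\<exists>x\<in>reachable A B. \<exists>\<xi>. nulling \<xi> g x)"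
proof
  note R = reachable_subspace[OF A B]
  assume "g \<in> zero_space F"
  then obtain f h where g: "g = f + h" "g \<in> strictly_proper_vecs q" and f: "f \<in> carrier_vec q"
    "F *v f \<in> poly_vecs p" and h: "h \<in> poly_vecs q"
    by (auto simp: zero_space_def poly_preimage_def elim!: set_plus_elim)
  obtain X r where div: "division h X r" and r: "r \<in> reachable A B"
    using polynomial_input_division[OF h] .
  then have X: "X \<in> poly_vecs n" and
    eq: "const_mat B *v h + const_mat A *v X = zz *s X + const_vec r" by (auto simp: division_def)
  have d: "dim_vec f = q" "dim_vec h = q" "dim_vec X = n" "dim_vec r = n"
    using f division_dims[OF div] by auto
  define \<eta> where "\<eta> = resolvent A *v (const_mat B *v f)"
  have \<eta>: "\<eta> \<in> carrier_vec n" using resolvent_dims[OF A] by (simp add: \<eta>_def)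
  have \<eta>eq: "zz *s \<eta> = const_mat A *v \<eta> + const_mat B *v f"
    using resolvent_mult_eq_iff[OF A _ \<eta>, of "const_mat B *v f"] by (simp add: \<eta>_def)
  let ?\<xi> = "\<eta> + X"
  have zX: "zz *s X = const_mat B *v h + const_mat A *v X - const_vec r"
    unfolding eq using d by (intro eq_vecI) simp_all
  have "zz *s ?\<xi> = zz *s \<eta> + zz *s X"
    using \<eta> d by (intro eq_vecI) (simp_all add: distrib_left)
  also have "\<dots> = const_mat A *v ?\<xi> + const_mat B *v g + const_vec (- r)"
    unfolding \<eta>eq zX g(1) using d \<eta>
    by (intro eq_vecI) (simp_all add: mv_simps const_fun.hom_uminus del: index_mult_mat_vec)
  finally have state: "zz *s ?\<xi> = const_mat A *v ?\<xi> + const_mat B *v g + const_vec (- r)" .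
  have sp: "?\<xi> \<in> strictly_proper_vecs n"
    by (rule state_strictly_proper[OF _ g(2) _ state]) (use d in \<open>auto intro: carrier_vecI\<close>)
  have "const_mat C *v ?\<xi> + const_mat D *v g = F *v f + (const_mat C *v X + const_mat D *v h)"
    unfolding F_mult[OF f(1)] g(1) \<eta>_def[symmetric] using d \<eta>
    by (intro eq_vecI) (simp_all add: mv_simps del: index_mult_mat_vec)
  also have "\<dots> \<in> poly_vecs p"
    using f(2) X h by (intro poly_vecs_add poly_vecs_mult[OF C] poly_vecs_mult[OF D])
  finally have "const_mat C *v ?\<xi> + const_mat D *v g = 0\<^sub>v p"
    using polynomial_and_strictly_proper_vec
      strictly_proper_vecs_add[OF strictly_proper_vecs_mult[OF C sp] strictly_proper_vecs_mult[OF D g(2)]]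
    by blast
  then have "nulling ?\<xi> g (- r)"
    unfolding nulling_def using state d g by (auto intro: carrier_vecI)
  then show "g \<in> strictly_proper_vecs q \<and> (\<exists>x\<in>reachable A B. \<exists>\<xi>. nulling \<xi> g x)"
    using g(2) vec_subspace_uminus[OF R r] by blast
next
  note R = reachable_subspace[OF A B]
  assume "g \<in> strictly_proper_vecs q \<and> (\<exists>x\<in>reachable A B. \<exists>\<xi>. nulling \<xi> g x)"
  then obtain x \<xi> where g: "g \<in> strictly_proper_vecs q" and x: "x \<in> reachable A B" and nul: "nulling \<xi> g x"
    by blast
  note a = nullingD[OF nul]
  obtain h X where "division h X (- x)" using reachable_remainder[OF vec_subspace_uminus[OF R x]] .
  then have h: "h \<in> poly_vecs q" and X: "X \<in> poly_vecs n" and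
    eq: "const_mat B *v h + const_mat A *v X = zz *s X + const_vec (- x)" by (auto simp: division_def)
  have d: "dim_vec h = q" "dim_vec X = n" using h X by (auto simp: poly_vecs_iff)
  let ?\<eta> = "\<xi> - X" and ?f = "g - h"
  have zX: "zz *s X = const_mat B *v h + const_mat A *v X + const_vec x"
    unfolding eq using d a(3) by (intro eq_vecI) (simp_all add: const_fun.hom_uminus)
  have "zz *s ?\<eta> = zz *s \<xi> - zz *s X"
    using a(1) d by (intro eq_vecI) (simp_all add: right_diff_distrib)
  also have "\<dots> = const_mat A *v ?\<eta> + const_mat B *v ?f"
    unfolding a(4) zX using a(1-3) d by (intro eq_vecI) (simp_all add: mv_simps del: index_mult_mat_vec)
  finally have \<eta>eq: "zz *s ?\<eta> = const_mat A *v ?\<eta> + const_mat B *v ?f" .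
  have cl: "?\<eta> \<in> carrier_vec n" "?f \<in> carrier_vec q" "const_mat B *v ?f \<in> carrier_vec n"
    using a(1-3) d by (auto intro: carrier_vecI)
  have "?\<eta> = resolvent A *v (const_mat B *v ?f)"
    using \<eta>eq resolvent_mult_eq_iff[OF A cl(3,1)] by blast
  then have "F *v ?f = const_mat C *v ?\<eta> + const_mat D *v ?f"
    using F_mult[OF cl(2)] by metis
  also have "\<dots> = (const_mat C *v \<xi> + const_mat D *v g) + - (const_mat C *v X + const_mat D *v h)"
    using a(1-3) d by (intro eq_vecI) (simp_all add: mv_simps del: index_mult_mat_vec)
  also have "\<dots> = - (const_mat C *v X + const_mat D *v h)"
    unfolding a(5) by (intro eq_vecI) (simp_all del: index_mult_mat_vec)
  also have "\<dots> \<in> poly_vecs p"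
    using X h by (intro poly_vecs_uminus poly_vecs_add poly_vecs_mult[OF C] poly_vecs_mult[OF D])
  finally have "?f \<in> poly_preimage F" using cl(2) by (simp add: poly_preimage_def)
  moreover have "g = ?f + h" using a(2) d by (intro eq_vecI) simp_all
  ultimately show "g \<in> zero_space F"
    unfolding zero_space_def using g h set_plus_intro[of ?f _ h] by auto
qed

lemma sp_kernel_iff: "g \<in> sp_kernel F \<longleftrightarrow> g \<in> strictly_proper_vecs q \<and> (\<exists>\<xi>. nulling \<xi> g (0\<^sub>v n))"
  by (auto simp: sp_kernel_def kernel_iff)

lemma sp_kernel_coset_eq_iff:
  assumes g: "g \<in> carrier_vec q" and h: "h \<in> carrier_vec q"
  shows "g +o sp_kernel F = h +o sp_kernel F \<longleftrightarrow> g - h \<in> sp_kernel F"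
proof -
  have sub: "h +o sp_kernel F \<subseteq> g +o sp_kernel F"
    if g: "g \<in> carrier_vec q" and h: "h \<in> carrier_vec q" and k: "h - g \<in> sp_kernel F" for g h
  proof
    fix x assume "x \<in> h +o sp_kernel F"
    then obtain m where m: "m \<in> sp_kernel F" "x = h + m" by (auto simp: elt_set_plus_def)
    have "(h - g) + m \<in> sp_kernel F"
      using m(1) k nulling_add[of _ "h - g" "0\<^sub>v n" _ m "0\<^sub>v n"] strictly_proper_vecs_add[of "h - g" q m]
      by (auto simp: sp_kernel_iff)
    moreover have "x = g + ((h - g) + m)"
      using g h m by (intro eq_vecI) (auto simp: sp_kernel_iff strictly_proper_vecs_iff)
    ultimately show "x \<in> g +o sp_kernel F" by (auto simp: elt_set_plus_def)
  qed
  have neg: "h - g \<in> sp_kernel F" if "g - h \<in> sp_kernel F"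
  proof -
    have "0\<^sub>v q - (g - h) = h - g" "0\<^sub>v n - 0\<^sub>v n = (0\<^sub>v n :: complex vec)"
      using g h by (intro eq_vecI; simp)+
    then show ?thesis
      using that nulling_diff[OF nulling_zero, of _ "g - h" "0\<^sub>v n"]
        strictly_proper_vecs_diff[OF strictly_proper_vecs_zero, of "g - h" q]
      by (auto simp: sp_kernel_iff)
  qed
  show ?thesis
  proof
    assume eq: "g +o sp_kernel F = h +o sp_kernel F"
    have "0\<^sub>v q \<in> sp_kernel F" using nulling_zero strictly_proper_vecs_zero by (auto simp: sp_kernel_iff)
    then have "g \<in> g +o sp_kernel F" using g by (auto simp: elt_set_plus_def intro!: bexI[of _ "0\<^sub>v q"])
    then obtain m where m: "m \<in> sp_kernel F" "g = h + m" unfolding eq by (auto simp: elt_set_plus_def)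
    have "g - h = m" unfolding m(2) using h m(1)
      by (intro eq_vecI) (auto simp: sp_kernel_iff strictly_proper_vecs_iff)
    then show "g - h \<in> sp_kernel F" using m by simp
  next
    assume k: "g - h \<in> sp_kernel F"
    show "g +o sp_kernel F = h +o sp_kernel F"
      using sub[OF h g k] sub[OF g h neg[OF k]] by (rule subset_antisym)
  qed
qed

end

context lti
begin

text \<open>The map that sends a strictly proper zero direction to the initial state of the trajectory it
  generates identifies the zero space modulo the strictly proper kernel with
  \<open>\<V>\<^sup>* \<inter> \<langle>A | B\<rangle>\<close>. The columns of \<open>H (z I - \<Lambda>)\<^sup>-\<^sup>1\<close> are sent to the columns of \<open>\<Pi>\<^sub>z\<close>.\<close>

theorem zero_basis_iff:
  assumes obs: "observable C A"
    and \<Pi>\<^sub>z: "\<Pi>\<^sub>z \<in> carrier_mat n k" and H: "H \<in> carrier_mat q k" and \<Lambda>: "\<Lambda> \<in> carrier_mat k k"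
    and state: "A * \<Pi>\<^sub>z + B * H = \<Pi>\<^sub>z * \<Lambda>" and out: "C * \<Pi>\<^sub>z + D * H = 0\<^sub>m p k"
  shows "zero_basis F (const_mat H * resolvent \<Lambda>) \<longleftrightarrow>
    (\<forall>c \<in> carrier_vec k. \<Pi>\<^sub>z *v c = 0\<^sub>v n \<longrightarrow> c = 0\<^sub>v k) \<and> mat_image \<Pi>\<^sub>z = V_star A B C D \<inter> reachable A B"
proof -
  let ?G = "const_mat H * resolvent \<Lambda>"
  note Rsub = reachable_subspace[OF A B]
  have G: "?G \<in> carrier_mat q k" using H resolvent(1)[OF \<Lambda>] by (intro carrier_matI) auto
  have dc: "dim_col ?G = k" using G by auto
  have dims' [simp]: "dim_row \<Pi>\<^sub>z = n" "dim_col \<Pi>\<^sub>z = k" "dim_row H = q" "dim_col H = k"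
    "dim_row \<Lambda> = k" "dim_col \<Lambda> = k" using \<Pi>\<^sub>z H \<Lambda> by auto
  have gen: "\<exists>\<xi>. nulling \<xi> (?G *v const_vec c) (\<Pi>\<^sub>z *v c)"
    and gen_sp: "?G *v const_vec c \<in> strictly_proper_vecs q" if c: "c \<in> carrier_vec k" for c
  proof -
    define \<eta> where "\<eta> = resolvent \<Lambda> *v const_vec c"
    have \<eta>: "\<eta> \<in> carrier_vec k" using resolvent_dims[OF \<Lambda>] by (simp add: \<eta>_def)
    have eq: "zz *s \<eta> = const_mat \<Lambda> *v \<eta> + const_vec c"
      using resolvent_mult_eq_iff[OF \<Lambda> _ \<eta>, of "const_vec c"] c by (simp add: \<eta>_def)
    have G\<eta>: "?G *v const_vec c = const_mat H *v \<eta>"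
      using c resolvent_dims[OF \<Lambda>] by (simp add: \<eta>_def mat_mult_mv)
    have "\<eta> \<in> strictly_proper_vecs k"
      unfolding \<eta>_def using c by (intro resolvent_strictly_proper[OF \<Lambda>]) auto
    then show "?G *v const_vec c \<in> strictly_proper_vecs q"
      unfolding G\<eta> by (rule strictly_proper_vecs_mult[OF H])
    have "zz *s (const_mat \<Pi>\<^sub>z *v \<eta>) = const_mat \<Pi>\<^sub>z *v (zz *s \<eta>)" using \<eta> by (simp add: mv_simps)
    also have "\<dots> = const_mat (\<Pi>\<^sub>z * \<Lambda>) *v \<eta> + const_vec (\<Pi>\<^sub>z *v c)"
      unfolding eq using \<eta> c by (simp add: mv_simps const_simps)
    also have "\<dots> = const_mat A *v (const_mat \<Pi>\<^sub>z *v \<eta>) + const_mat B *v (const_mat H *v \<eta>) + const_vec (\<Pi>\<^sub>z *v c)"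
      unfolding state[symmetric] using \<eta> c by (simp add: mv_simps const_simps)
    finally have 1: "zz *s (const_mat \<Pi>\<^sub>z *v \<eta>) = \<dots>" .
    have "const_mat C *v (const_mat \<Pi>\<^sub>z *v \<eta>) + const_mat D *v (const_mat H *v \<eta>) = const_mat (C * \<Pi>\<^sub>z + D * H) *v \<eta>"
      using \<eta> by (simp add: mv_simps const_simps)
    also have "\<dots> = 0\<^sub>v p" unfolding out using \<eta> by (simp add: mv_simps const_simps)
    finally have "nulling (const_mat \<Pi>\<^sub>z *v \<eta>) (?G *v const_vec c) (\<Pi>\<^sub>z *v c)"
      unfolding nulling_def G\<eta> using 1 by simp
    then show "\<exists>\<xi>. nulling \<xi> (?G *v const_vec c) (\<Pi>\<^sub>z *v c)" ..
  qed
  have colG: "col ?G j = ?G *v const_vec (unit_vec k j)" if "j < k" for j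
  proof -
    have "const_vec (unit_vec k j) = (unit_vec k j :: rat_fun vec)"
      by (intro eq_vecI) (auto simp: unit_vec_def)
    then show ?thesis using mat_mult_unit[of j ?G] G that by auto
  qed
  have class_eq: "g +o sp_kernel F = (?G *v const_vec c) +o sp_kernel F \<longleftrightarrow> x = \<Pi>\<^sub>z *v c"
    if nul: "nulling \<xi> g x" and g: "g \<in> strictly_proper_vecs q" and c: "c \<in> carrier_vec k" for \<xi> g x c
  proof -
    obtain \<eta> where \<eta>: "nulling \<eta> (?G *v const_vec c) (\<Pi>\<^sub>z *v c)" using gen[OF c] ..
    note diff = nulling_diff[OF nul \<eta>]
    have "g +o sp_kernel F = (?G *v const_vec c) +o sp_kernel F \<longleftrightarrow> g - ?G *v const_vec c \<in> sp_kernel F"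
      using nullingD(2)[OF nul] nullingD(2)[OF \<eta>] by (rule sp_kernel_coset_eq_iff)
    also have "\<dots> \<longleftrightarrow> x - \<Pi>\<^sub>z *v c = 0\<^sub>v n"
    proof
      assume "g - ?G *v const_vec c \<in> sp_kernel F"
      then obtain \<zeta> where "nulling \<zeta> (g - ?G *v const_vec c) (0\<^sub>v n)" unfolding sp_kernel_iff by blast
      then show "x - \<Pi>\<^sub>z *v c = 0\<^sub>v n" by (rule nulling_state_unique[OF obs diff])
    next
      assume "x - \<Pi>\<^sub>z *v c = 0\<^sub>v n"
      with diff have "nulling (\<xi> - \<eta>) (g - ?G *v const_vec c) (0\<^sub>v n)" by metis
      then show "g - ?G *v const_vec c \<in> sp_kernel F"
        unfolding sp_kernel_iff using strictly_proper_vecs_diff[OF g gen_sp[OF c]] by blast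
    qed
    also have "\<dots> \<longleftrightarrow> x = \<Pi>\<^sub>z *v c"
      using nullingD(3)[OF nul] by (auto simp: vec_eq_iff simp del: index_mult_mat_vec)
    finally show ?thesis .
  qed
  have in_V: "\<Pi>\<^sub>z *v c \<in> V_star A B C D" if "c \<in> carrier_vec k" for c
    using gen[OF that] gen_sp[OF that] nulling_in_V_star by blast
  show ?thesis
  proof
    assume zb: "zero_basis F ?G"
    have cols: "col ?G j \<in> zero_space F" if "j < k" for j
      using zb that unfolding zero_basis_def dc by simp
    have ex1: "\<exists>!c. c \<in> carrier_vec k \<and> g +o sp_kernel F = (?G *v const_vec c) +o sp_kernel F"
      if "g \<in> zero_space F" for g
    proof -
      have "g +o sp_kernel F \<in> quotient_space (zero_space F) (sp_kernel F)"
        unfolding quotient_space_def using that by (rule imageI)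
      with zb show ?thesis unfolding zero_basis_def dc by simp
    qed
    have img_reach: "\<Pi>\<^sub>z *v c \<in> reachable A B" if c: "c \<in> carrier_vec k" for c
    proof (rule mat_mult_in_subspace[OF \<Pi>\<^sub>z Rsub c])
      fix j assume j: "j < k"
      obtain x \<xi> where x: "x \<in> reachable A B" "nulling \<xi> (?G *v const_vec (unit_vec k j)) x"
        using cols[OF j] colG[OF j] zero_space_iff by auto
      then show "\<Pi>\<^sub>z *v unit_vec k j \<in> reachable A B"
        using gen[of "unit_vec k j"] nulling_state_unique[OF obs] by (metis unit_vec_carrier)
    qed
    have inj: "c = 0\<^sub>v k" if c: "c \<in> carrier_vec k" "\<Pi>\<^sub>z *v c = 0\<^sub>v n" for c
    proof -
      have z: "0\<^sub>v q \<in> zero_space F"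
        using nulling_zero strictly_proper_vecs_zero vec_subspaceD(2)[OF Rsub] by (auto simp: zero_space_iff)
      have "0\<^sub>v q +o sp_kernel F = (?G *v const_vec c) +o sp_kernel F"
        "0\<^sub>v q +o sp_kernel F = (?G *v const_vec (0\<^sub>v k)) +o sp_kernel F"
        using class_eq[OF nulling_zero strictly_proper_vecs_zero] c by (auto simp: mv_zero)
      then show ?thesis using ex1[OF z] c(1) zero_carrier_vec[of k] by blast
    qed
    have "mat_image \<Pi>\<^sub>z = V_star A B C D \<inter> reachable A B"
    proof
      show "mat_image \<Pi>\<^sub>z \<subseteq> V_star A B C D \<inter> reachable A B"
        using in_V img_reach by (auto simp: mat_image_def)
      show "V_star A B C D \<inter> reachable A B \<subseteq> mat_image \<Pi>\<^sub>z"
      proof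
        fix x assume x: "x \<in> V_star A B C D \<inter> reachable A B"
        obtain \<xi> g where nul: "nulling \<xi> g x" "g \<in> strictly_proper_vecs q"
          using V_star_nulling[of x] x by blast
        then have "g \<in> zero_space F" using x zero_space_iff by blast
        then obtain c where c: "c \<in> carrier_vec k" "g +o sp_kernel F = (?G *v const_vec c) +o sp_kernel F"
          using ex1 by blast
        then have "x = \<Pi>\<^sub>z *v c" using class_eq[OF nul c(1)] by simp
        then show "x \<in> mat_image \<Pi>\<^sub>z" using c(1) by (auto simp: mat_image_def)
      qed
    qed
    then show "(\<forall>c \<in> carrier_vec k. \<Pi>\<^sub>z *v c = 0\<^sub>v n \<longrightarrow> c = 0\<^sub>v k) \<and> mat_image \<Pi>\<^sub>z = V_star A B C D \<inter> reachable A B"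
      using inj by blast
  next
    assume "(\<forall>c \<in> carrier_vec k. \<Pi>\<^sub>z *v c = 0\<^sub>v n \<longrightarrow> c = 0\<^sub>v k) \<and> mat_image \<Pi>\<^sub>z = V_star A B C D \<inter> reachable A B"
    then have inj: "\<And>c. c \<in> carrier_vec k \<Longrightarrow> \<Pi>\<^sub>z *v c = 0\<^sub>v n \<Longrightarrow> c = 0\<^sub>v k"
      and img: "mat_image \<Pi>\<^sub>z = V_star A B C D \<inter> reachable A B" by auto
    have inj': "c = d" if "c \<in> carrier_vec k" "d \<in> carrier_vec k" "\<Pi>\<^sub>z *v c = \<Pi>\<^sub>z *v d" for c d
    proof -
      have "\<Pi>\<^sub>z *v (c - d) = 0\<^sub>v n" using that
        by (intro eq_vecI) (simp_all add: mv_diff del: index_mult_mat_vec)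
      then have "c - d = 0\<^sub>v k" using inj that by simp
      then show ?thesis using that by (auto simp: vec_eq_iff)
    qed
    show "zero_basis F ?G"
      unfolding zero_basis_def
    proof (intro conjI allI impI ballI)
      show "?G \<in> carrier_mat (dim_col F) (dim_col ?G)" using G by auto
      fix j assume "j < dim_col ?G"
      then have j: "j < k" using G by auto
      have "\<Pi>\<^sub>z *v unit_vec k j \<in> mat_image \<Pi>\<^sub>z" by (auto simp: mat_image_def)
      then have "\<Pi>\<^sub>z *v unit_vec k j \<in> reachable A B" unfolding img by blast
      then show "col ?G j \<in> zero_space F"
        unfolding colG[OF j] zero_space_iff using gen gen_sp by (metis unit_vec_carrier)
    next
      fix \<gamma> assume "\<gamma> \<in> quotient_space (zero_space F) (sp_kernel F)"
      then obtain g where g: "g \<in> zero_space F" "\<gamma> = g +o sp_kernel F" by (auto simp: quotient_space_def)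
      then obtain x \<xi> where x: "x \<in> reachable A B" "nulling \<xi> g x" and sp: "g \<in> strictly_proper_vecs q"
        by (auto simp: zero_space_iff)
      have "x \<in> mat_image \<Pi>\<^sub>z" unfolding img using x nulling_in_V_star[OF x(2) sp] by blast
      then obtain c where c: "c \<in> carrier_vec k" "x = \<Pi>\<^sub>z *v c" by (auto simp: mat_image_def)
      show "\<exists>!c. c \<in> carrier_vec (dim_col ?G) \<and> \<gamma> = (?G *v const_vec c) +o sp_kernel F"
        unfolding dc g(2) using class_eq[OF x(2) sp] c inj' by (intro ex1I[of _ c]) auto
    qed
  qed
qed

end

section \<open>Matrix algebra with block matrices and adjoints\<close>

lemma mm_assoc: "dim_col X = dim_row Y \<Longrightarrow> dim_col Y = dim_row Z \<Longrightarrow>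
    X * Y * Z = X * (Y * (Z :: 'a::comm_ring_1 mat))"
  by (rule assoc_mult_mat[of _ "dim_row X" "dim_col X" _ "dim_col Y" _ "dim_col Z"]) auto

lemma mm_add_left: "dim_row X = dim_row Y \<Longrightarrow> dim_col X = dim_col Y \<Longrightarrow> dim_col Y = dim_row Z \<Longrightarrow>
    (X + Y) * Z = X * Z + Y * (Z :: 'a::comm_ring_1 mat)"
  by (rule add_mult_distrib_mat[of _ "dim_row X" "dim_col X"]) auto

lemma mm_diff_left: "dim_row X = dim_row Y \<Longrightarrow> dim_col X = dim_col Y \<Longrightarrow> dim_col Y = dim_row Z \<Longrightarrow>
    (X - Y) * Z = X * Z - Y * (Z :: 'a::comm_ring_1 mat)"
  by (rule minus_mult_distrib_mat[of _ "dim_row X" "dim_col X"]) auto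

lemma mm_add_right: "dim_row Y = dim_row Z \<Longrightarrow> dim_col Y = dim_col Z \<Longrightarrow> dim_col X = dim_row Z \<Longrightarrow>
    X * (Y + Z) = X * Y + X * (Z :: 'a::comm_ring_1 mat)"
  by (rule mult_add_distrib_mat[of _ "dim_row X" "dim_col X"]) auto

lemma mm_diff_right: "dim_row Y = dim_row Z \<Longrightarrow> dim_col Y = dim_col Z \<Longrightarrow> dim_col X = dim_row Z \<Longrightarrow>
    X * (Y - Z) = X * Y - X * (Z :: 'a::comm_ring_1 mat)"
  by (rule mult_minus_distrib_mat[of _ "dim_row X" "dim_col X"]) auto

lemma mm_one: "dim_row X = m \<Longrightarrow> 1\<^sub>m m * X = (X :: 'a::comm_ring_1 mat)"
  "dim_col X = m \<Longrightarrow> X * 1\<^sub>m m = X"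
  by (auto intro: left_mult_one_mat' right_mult_one_mat')

lemma mm_zero: "dim_row X = m \<Longrightarrow> 0\<^sub>m l m * X = (0\<^sub>m l (dim_col X) :: 'a::comm_ring_1 mat)"
  "dim_col X = m \<Longrightarrow> X * 0\<^sub>m m l = (0\<^sub>m (dim_row X) l :: 'a::comm_ring_1 mat)"
  by (intro eq_matI; simp add: scalar_prod_def)+

lemma mm_add_zero: "dim_row X = m \<Longrightarrow> dim_col X = l \<Longrightarrow> X + 0\<^sub>m m l = (X :: 'a::comm_ring_1 mat)"
  "dim_row X = m \<Longrightarrow> dim_col X = l \<Longrightarrow> 0\<^sub>m m l + X = (X :: 'a::comm_ring_1 mat)"
  by (intro eq_matI; simp)+

lemmas mm_simps = mm_assoc mm_add_left mm_diff_left mm_add_right mm_diff_right mm_one mm_zero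

lemma append_cols_dims [simp]:
  "dim_row (append_cols X Y) = dim_row X" "dim_col (append_cols X Y) = dim_col X + dim_col Y"
  by (simp_all add: append_cols_def)

lemma append_cols_index:
  assumes "i < dim_row X" "j < dim_col X + dim_col Y" "dim_row Y = dim_row X"
  shows "append_cols X Y $$ (i, j) = (if j < dim_col X then X $$ (i, j) else Y $$ (i, j - dim_col X))"
  using assms by (simp add: append_cols_def)

lemma append_cols_mv:
  assumes "dim_row Y = dim_row X" "dim_vec a = dim_col X" "dim_vec b = dim_col Y"
  shows "append_cols X Y *v (a @\<^sub>v b) = X *v a + Y *v (b :: 'a::comm_ring_1 vec)"
proof -
  have c: "X \<in> carrier_mat (dim_row X) (dim_col X)" "Y \<in> carrier_mat (dim_row X) (dim_col Y)"
    "a \<in> carrier_vec (dim_col X)" "b \<in> carrier_vec (dim_col Y)"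
    using assms by (auto intro: carrier_vecI carrier_matI)
  have "append_cols X Y *v (a @\<^sub>v b) =
      (X *v a + Y *v b) @\<^sub>v (0\<^sub>m 0 (dim_col X) *v a + 0\<^sub>m 0 (dim_col Y) *v b)"
    unfolding append_cols_def
    by (rule four_block_mat_mult_vec[OF c(1,2) zero_carrier_mat zero_carrier_mat c(3,4)])
  also have "\<dots> = X *v a + Y *v b" by (intro eq_vecI) auto
  finally show ?thesis .
qed

lemma mult_append_cols:
  fixes M :: "'a::comm_ring_1 mat"
  assumes "dim_col M = dim_row X" "dim_row Y = dim_row X"
  shows "M * append_cols X Y = append_cols (M * X) (M * Y)"
proof (rule eq_matI)
  fix i j assume ij: "i < dim_row (append_cols (M * X) (M * Y))" "j < dim_col (append_cols (M * X) (M * Y))"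
  have "col (append_cols X Y) j = (if j < dim_col X then col X j else col Y (j - dim_col X))"
    using ij assms by (intro eq_vecI) (auto simp: append_cols_index)
  then show "(M * append_cols X Y) $$ (i, j) = append_cols (M * X) (M * Y) $$ (i, j)"
    using ij assms by (auto simp: append_cols_index)
qed simp_all

lemma append_cols_add:
  assumes "dim_row X = dim_row X'" "dim_col X = dim_col X'" "dim_row Y = dim_row X" "dim_row Y' = dim_row X"
    "dim_col Y = dim_col Y'"
  shows "append_cols X Y + append_cols X' Y' = append_cols (X + X') (Y + Y' :: 'a::comm_ring_1 mat)"
  using assms by (intro eq_matI) (auto simp: append_cols_index)

lemma append_cols_mult_block:
  fixes X :: "'a::comm_ring_1 mat"
  assumes "X \<in> carrier_mat m a" "Y \<in> carrier_mat m b" "P \<in> carrier_mat a c" "Q \<in> carrier_mat a d"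
    "R \<in> carrier_mat b c" "S \<in> carrier_mat b d"
  shows "append_cols X Y * four_block_mat P Q R S = append_cols (X * P + Y * R) (X * Q + Y * S)"
proof -
  have "append_cols X Y * four_block_mat P Q R S =
    four_block_mat (X * P + Y * R) (X * Q + Y * S) (0\<^sub>m 0 a * P + 0\<^sub>m 0 b * R) (0\<^sub>m 0 a * Q + 0\<^sub>m 0 b * S)"
    unfolding append_cols_def using assms by (subst mult_four_block_mat[of _ m a _ b _ 0]) auto
  also have "\<dots> = append_cols (X * P + Y * R) (X * Q + Y * S)"
    unfolding append_cols_def using assms by (intro cong_four_block_mat) (auto intro!: eq_matI)
  finally show ?thesis .
qed

lemma append_cols_mult_rows:
  fixes X :: "'a::comm_ring_1 mat"
  assumes "X \<in> carrier_mat m a" "Y \<in> carrier_mat m b" "P \<in> carrier_mat a c" "R \<in> carrier_mat b c"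
  shows "append_cols X Y * (P @\<^sub>r R) = X * P + Y * R"
proof -
  have "append_cols X Y * (P @\<^sub>r R) = append_cols (X * P + Y * R) (X * 0\<^sub>m a 0 + Y * 0\<^sub>m b 0)"
    unfolding append_rows_def using assms by (subst append_cols_mult_block[of _ m a _ b]) auto
  also have "\<dots> = X * P + Y * R"
    using assms by (intro eq_matI) (auto simp: append_cols_index)
  finally show ?thesis .
qed

lemma append_cols_eq_iff:
  assumes "dim_row X = dim_row X'" "dim_col X = dim_col X'" "dim_row Y = dim_row X" "dim_row Y' = dim_row X"
    "dim_col Y = dim_col Y'"
  shows "append_cols X Y = append_cols X' Y' \<longleftrightarrow> X = X' \<and> Y = Y'"
proof
  assume eq: "append_cols X Y = append_cols X' Y'"
  show "X = X' \<and> Y = Y'"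
  proof (intro conjI eq_matI)
    fix i j assume "i < dim_row X'" "j < dim_col X'"
    then show "X $$ (i, j) = X' $$ (i, j)"
      using arg_cong[OF eq, of "\<lambda>M. M $$ (i, j)"] assms by (simp add: append_cols_index)
  next
    fix i j assume "i < dim_row Y'" "j < dim_col Y'"
    then show "Y $$ (i, j) = Y' $$ (i, j)"
      using arg_cong[OF eq, of "\<lambda>M. M $$ (i, j + dim_col X)"] assms by (simp add: append_cols_index)
  qed (use assms in auto)
qed simp

lemma append_cols_zero: "0\<^sub>m m (a + b) = append_cols (0\<^sub>m m a) (0\<^sub>m m b)"
  by (intro eq_matI) (auto simp: append_cols_index)

lemma unitary_append_cols:
  assumes R: "R \<in> carrier_mat q r" and L: "L \<in> carrier_mat q l" and U: "unitary_mat (append_cols R L)"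
  shows "R * adj R + L * adj L = 1\<^sub>m q" "adj L * L = 1\<^sub>m l"
    "adj R * L = 0\<^sub>m r l"
proof -
  let ?U = "append_cols R L"
  have sq: "r + l = q" using U R L by (simp add: unitary_mat_def)
  have adj: "adj ?U = adj R @\<^sub>r adj L"
    using R L by (intro eq_matI) (auto simp: mat_adjoint_index append_rows_def append_cols_index)
  show "R * adj R + L * adj L = 1\<^sub>m q"
    using U R L append_cols_mult_rows[of R q r L l "adj R" q "adj L"]
    by (simp add: unitary_mat_def adj)
  have UU: "adj ?U * ?U = 1\<^sub>m q" using U R by (simp add: unitary_mat_def)
  have entry: "(\<Sum>m<q. cnj (?U $$ (m, i)) * ?U $$ (m, j)) = (if i = j then 1 else 0)"
    if "i < q" "j < q" for i j
  proof -
    have "(adj ?U * ?U) $$ (i, j) = (\<Sum>m<q. cnj (?U $$ (m, i)) * ?U $$ (m, j))"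
      using that R L sq by (simp add: scalar_prod_def mat_adjoint_index atLeast0LessThan)
    then show ?thesis using UU that by simp
  qed
  show "adj L * L = 1\<^sub>m l"
  proof (rule eq_matI)
    fix i j assume ij: "i < dim_row (1\<^sub>m l :: complex mat)" "j < dim_col (1\<^sub>m l :: complex mat)"
    then show "(adj L * L) $$ (i, j) = 1\<^sub>m l $$ (i, j)"
      using entry[of "r + i" "r + j"] R L sq
      by (simp add: append_cols_index scalar_prod_def mat_adjoint_index atLeast0LessThan)
  qed (use L in auto)
  show "adj R * L = 0\<^sub>m r l"
  proof (rule eq_matI)
    fix i j assume ij: "i < dim_row (0\<^sub>m r l :: complex mat)" "j < dim_col (0\<^sub>m r l :: complex mat)"
    then show "(adj R * L) $$ (i, j) = 0\<^sub>m r l $$ (i, j)"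
      using entry[of i "r + j"] R L sq
      by (simp add: append_cols_index scalar_prod_def mat_adjoint_index atLeast0LessThan)
  qed (use R L in auto)
qed

section \<open>Intertwining maps between matrices without common eigenvalues\<close>

text \<open>In a Schur basis of \<open>M\<close> the claim follows by induction on the number of coordinates of \<open>y\<close>
  that may be nonzero: subtracting the last diagonal entry of the triangular factor removes one of them.\<close>

lemma intertwiner_vanishes:
  fixes M N T :: "complex mat"
  assumes M: "M \<in> carrier_mat n n" and N: "N \<in> carrier_mat k k" and T: "T \<in> carrier_mat k n"
    and W: "vec_subspace n W" and inv: "\<And>y. y \<in> W \<Longrightarrow> M *v y \<in> W"
    and intertwine: "\<And>y. y \<in> W \<Longrightarrow> T *v (M *v y) = N *v (T *v y)"
    and disjoint: "\<And>s. eigenvalue M s \<Longrightarrow> \<not> eigenvalue N s"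
    and y: "y \<in> W"
  shows "T *v y = 0\<^sub>v k"
proof -
  note WD = vec_subspaceD[OF W]
  obtain es where es: "char_poly M = (\<Prod>e\<leftarrow>es. [:- e, 1:])" using char_poly_factorized[OF M] by auto
  obtain U P Q where "schur_decomposition M es = (U, P, Q)" by (cases "schur_decomposition M es") auto
  from schur_decomposition[OF M es this]
  have wit: "similar_mat_wit M U P Q" and tri: "upper_triangular U" and diag: "diag_mat U = es" by auto
  from wit M have c: "U \<in> carrier_mat n n" "P \<in> carrier_mat n n" "Q \<in> carrier_mat n n"
    and PQ: "P * Q = 1\<^sub>m n" "Q * P = 1\<^sub>m n" "M = P * U * Q"
    by (auto simp: similar_mat_wit_def Let_def)
  have d [simp]: "dim_row M = n" "dim_col M = n" "dim_row U = n" "dim_col U = n" "dim_row P = n"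
    "dim_col P = n" "dim_row Q = n" "dim_col Q = n" "dim_row T = k" "dim_col T = n" "dim_row N = k" "dim_col N = k"
    using M c T N by auto
  have ev: "eigenvalue M (U $$ (m, m))" if "m < n" for m
  proof -
    have "U $$ (m, m) \<in> set es" unfolding diag[symmetric] diag_mat_def using that by simp
    then have "poly (char_poly M) (U $$ (m, m)) = 0" unfolding es by (induction es) auto
    then show ?thesis using eigenvalue_root_char_poly[OF M] by simp
  qed
  have QM: "Q *v (M *v v) = U *v (Q *v v)" if "dim_vec v = n" for v
  proof -
    have "Q *v (M *v v) = (Q * P) *v (U *v (Q *v v))" unfolding PQ(3) using that by (simp add: mat_mult_mv)
    then show ?thesis using that by (simp add: PQ(2) one_mv)
  qed
  have "T *v y = 0\<^sub>v k" if "m \<le> n" "y \<in> W" "\<And>i. m \<le> i \<Longrightarrow> i < n \<Longrightarrow> (Q *v y) $ i = 0" for m y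
    using that
  proof (induction m arbitrary: y)
    case 0
    have yn: "dim_vec y = n" using WD(5)[OF 0(2)] by simp
    have "Q *v y = 0\<^sub>v n" using 0(3) by (intro eq_vecI) (auto simp del: index_mult_mat_vec)
    moreover have "y = P *v (Q *v y)" using yn PQ(1) by (simp add: one_mv flip: mat_mult_mv)
    ultimately have "y = 0\<^sub>v n" by (simp add: mv_zero)
    then show ?case by (simp add: mv_zero)
  next
    case (Suc m)
    have yn: "dim_vec y = n" using WD(5)[OF Suc.prems(2)] by simp
    let ?e = "U $$ (m, m)"
    define y' where "y' = M *v y - ?e *s y"
    have y': "y' \<in> W"
      unfolding y'_def by (intro vec_subspace_diff[OF W] inv WD(4) Suc.prems)
    have Qy': "Q *v y' = U *v (Q *v y) - ?e *s (Q *v y)"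
      unfolding y'_def using yn by (simp add: mv_diff mv_smult QM)
    have "(Q *v y') $ i = 0" if i: "m \<le> i" "i < n" for i
    proof -
      have "(U *v (Q *v y)) $ i = (\<Sum>j<n. U $$ (i, j) * (Q *v y) $ j)"
        using i by (simp add: scalar_prod_def atLeast0LessThan del: index_mult_mat_vec(1)[of _ Q])
      also have "\<dots> = (\<Sum>j<n. if j = m then U $$ (i, m) * (Q *v y) $ m else 0)"
      proof (rule sum.cong)
        fix j assume j: "j \<in> {..<n}"
        show "U $$ (i, j) * (Q *v y) $ j = (if j = m then U $$ (i, m) * (Q *v y) $ m else 0)"
        proof (cases j m rule: linorder_cases)
          case less
          then have "U $$ (i, j) = 0" using tri i by (auto simp: upper_triangular_def)
          then show ?thesis using less by simp
        next
          case greater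
          then have "(Q *v y) $ j = 0" using Suc.prems(3)[of j] j by simp
          then show ?thesis using greater by (simp del: index_mult_mat_vec)
        qed simp
      qed simp
      also have "\<dots> = U $$ (i, m) * (Q *v y) $ m" using i by (simp del: index_mult_mat_vec)
      also have "\<dots> = ?e * (Q *v y) $ i"
      proof (cases "i = m")
        case False
        then have "U $$ (i, m) = 0" "(Q *v y) $ i = 0"
          using tri i Suc.prems(3)[of i] by (auto simp: upper_triangular_def simp del: index_mult_mat_vec)
        then show ?thesis by (simp del: index_mult_mat_vec)
      qed simp
      finally show ?thesis unfolding Qy' using i by (simp del: index_mult_mat_vec)
    qed
    then have "T *v y' = 0\<^sub>v k" using Suc.IH[of y'] Suc.prems(1) y' by simp
    then have "N *v (T *v y) - ?e *s (T *v y) = 0\<^sub>v k"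
      using yn intertwine[OF Suc.prems(2)] by (simp add: y'_def mv_diff mv_smult)
    then have "N *v (T *v y) = ?e *s (T *v y)"
      by (auto simp: vec_eq_iff simp del: index_mult_mat_vec)
    then have "T *v y \<noteq> 0\<^sub>v k \<Longrightarrow> eigenvalue N ?e"
      unfolding eigenvalue_def eigenvector_def by (intro exI[of _ "T *v y"]) simp
    then show ?case using disjoint[OF ev[of m]] Suc.prems(1) by auto
  qed
  from this[of n, OF _ y] show ?thesis by simp
qed

lemma eigenvalue_transpose:
  fixes M :: "complex mat"
  assumes "M \<in> carrier_mat n n"
  shows "eigenvalue M\<^sup>T s \<longleftrightarrow> eigenvalue M s"
  using eigenvalue_root_char_poly[OF assms] eigenvalue_root_char_poly[of "M\<^sup>T" n]
    char_poly_transpose_mat[OF assms] assms by simp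

lemma eigenvalue_uminus:
  fixes M :: "complex mat"
  assumes "M \<in> carrier_mat n n"
  shows "eigenvalue (- M) s \<longleftrightarrow> eigenvalue M (- s)"
proof -
  have "eigenvector (- M) v s \<longleftrightarrow> eigenvector M v (- s)" for v
  proof -
    have "- M *v v = s *s v \<longleftrightarrow> M *v v = (- s) *s v" if "dim_vec v = n"
    proof -
      have "- M *v v = - (M *v v)" using that assms by simp
      then show ?thesis
        using that assms by (auto simp: vec_eq_iff minus_equation_iff simp del: index_mult_mat_vec)
    qed
    then show ?thesis using assms by (auto simp: eigenvector_def)
  qed
  then show ?thesis by (simp add: eigenvalue_def)
qed

section \<open>The finite zero matrix of a system with trivial kernel\<close>

lemma append_cols_empty:
  assumes "X \<in> carrier_mat m 0" "Y \<in> carrier_mat m b"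
  shows "append_cols X Y = Y"
  using assms by (intro eq_matI) (auto simp: append_cols_index)

lemma four_block_mat_empty:
  assumes "X \<in> carrier_mat 0 0" "Y \<in> carrier_mat 0 f" "Z \<in> carrier_mat f f"
  shows "four_block_mat X Y (0\<^sub>m f 0) Z = Z"
  using assms by (intro eq_matI) auto

lemma append_rows_empty:
  assumes "X \<in> carrier_mat 0 r"
  shows "X @\<^sub>r 0\<^sub>m f r = 0\<^sub>m f r"
  unfolding append_rows_def using assms by (intro eq_matI) auto

lemma factor_through_image:
  fixes X Y :: "complex mat"
  assumes X: "X \<in> carrier_mat n a" and Y: "Y \<in> carrier_mat n b" and sub: "mat_image Y \<subseteq> mat_image X"
  obtains U where "U \<in> carrier_mat a b" "Y = X * U"
proof -
  have "\<exists>u. u \<in> carrier_vec a \<and> col Y j = X *v u" if "j < b" for j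
  proof -
    have "col Y j = Y *v unit_vec b j" using mat_mult_unit[of j Y] Y that by auto
    then have "col Y j \<in> mat_image Y" using Y by (auto simp: mat_image_def)
    then show ?thesis using sub X by (auto simp: mat_image_def)
  qed
  then obtain u where u: "\<And>j. j < b \<Longrightarrow> u j \<in> carrier_vec a" "\<And>j. j < b \<Longrightarrow> col Y j = X *v u j"
    by metis
  define U where "U = mat_of_cols a (map u [0..<b])"
  have U: "U \<in> carrier_mat a b" by (simp add: U_def mat_of_cols_def)
  have "Y = X * U"
  proof (rule eq_matI)
    fix i j assume ij: "i < dim_row (X * U)" "j < dim_col (X * U)"
    then have j: "j < b" and i: "i < n" using U X by auto
    have "col U j = u j" unfolding U_def using j u(1) by simp
    moreover have "Y $$ (i, j) = col Y j $ i" using i j Y by simp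
    ultimately show "Y $$ (i, j) = (X * U) $$ (i, j)" using u(2)[OF j] i j X U by simp
  qed (use X Y U in auto)
  then show thesis using that U by blast
qed

text \<open>Both dimensions are the trace of \<open>X Y\<close>.\<close>

lemma inverse_pair_dims:
  fixes X Y :: "complex mat"
  assumes X: "X \<in> carrier_mat a b" and Y: "Y \<in> carrier_mat b a" and "X * Y = 1\<^sub>m a" "Y * X = 1\<^sub>m b"
  shows "a = b"
proof -
  have "(\<Sum>i<a. \<Sum>j<b. X $$ (i, j) * Y $$ (j, i)) = (\<Sum>i<a. (X * Y) $$ (i, i))"
    using X Y by (intro sum.cong) (auto simp: scalar_prod_def atLeast0LessThan)
  also have "\<dots> = of_nat a" using assms(3) by simp
  finally have 1: "(\<Sum>i<a. \<Sum>j<b. X $$ (i, j) * Y $$ (j, i)) = of_nat a" .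
  have "(\<Sum>j<b. \<Sum>i<a. Y $$ (j, i) * X $$ (i, j)) = (\<Sum>j<b. (Y * X) $$ (j, j))"
    using X Y by (intro sum.cong) (auto simp: scalar_prod_def atLeast0LessThan)
  also have "\<dots> = of_nat b" using assms(4) by simp
  finally have "(\<Sum>j<b. \<Sum>i<a. X $$ (i, j) * Y $$ (j, i)) = of_nat b" by (simp add: mult.commute)
  then have "(of_nat a :: complex) = of_nat b" unfolding 1[symmetric] by (subst sum.swap)
  then show ?thesis by simp
qed

lemma zero_mat_if_annihilates:
  assumes "X \<in> carrier_mat a b" "\<And>v. v \<in> carrier_vec b \<Longrightarrow> X *v v = (0\<^sub>v a :: complex vec)"
  shows "X = 0\<^sub>m a b"
  by (rule mat_eqI_mv[OF assms(1)]) (use assms in \<open>auto simp: zero_mv\<close>)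

lemma reachable_zero_input:
  assumes A: "A \<in> carrier_mat n n"
  shows "reachable A (0\<^sub>m n q) = {0\<^sub>v n}"
proof
  have B: "(0\<^sub>m n q :: complex mat) \<in> carrier_mat n q" by simp
  show "reachable A (0\<^sub>m n q) \<subseteq> {0\<^sub>v n}"
    by (rule reachable_induct[OF A B]) (use A in \<open>auto simp: vec_subspace_iff mv_zero zero_mv\<close>)
  show "{0\<^sub>v n} \<subseteq> reachable A (0\<^sub>m n q)"
    using vec_subspaceD(2)[OF reachable_subspace[OF A B]] by blast
qed

context lti
begin

text \<open>Without jumps along \<open>\<V>\<^sup>*\<close> every solution of \<open>B R = P \<alpha>\<close>, \<open>D R = 0\<close> is zero, so controllability
  leaves no block \<open>\<Lambda>\<^sub>k\<close>, and the finite zero matrix is the matrix of the whole basis. Two bases are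
  related by the change of coordinates between two injective matrices with the same image.\<close>

lemma finite_zero_matrix_iff:
  assumes obs: "observable C A"
    and no_jump: "\<And>w. w \<in> carrier_vec q \<Longrightarrow> B *v w \<in> V_star A B C D \<Longrightarrow> D *v w = 0\<^sub>v p \<Longrightarrow> w = 0\<^sub>v q"
    and P: "P \<in> carrier_mat n m" and H: "H \<in> carrier_mat q m" and L: "L \<in> carrier_mat m m"
    and state: "A * P + B * H = P * L" and out: "C * P + D * H = 0\<^sub>m p m"
    and inj: "\<And>c. c \<in> carrier_vec m \<Longrightarrow> P *v c = 0\<^sub>v n \<Longrightarrow> c = 0\<^sub>v m"
    and img: "mat_image P = V_star A B C D \<inter> reachable A B"
  shows "finite_zero_matrix A B C D M \<longleftrightarrow> similar_mat M L"
proof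
  have Pd [simp]: "dim_row P = n" "dim_col P = m" "dim_row H = q" "dim_col H = m" "dim_row L = m" "dim_col L = m"
    using P H L by auto
  have inj_mat: "X = Y" if "X \<in> carrier_mat m a" "Y \<in> carrier_mat m a" "P * X = P * Y" for X Y a
  proof (rule mat_eqI_mv[OF that(1,2)])
    fix v assume v: "(v :: complex vec) \<in> carrier_vec a"
    have "P *v (X *v v - Y *v v) = (P * X) *v v - (P * Y) *v v"
      using that(1,2) v by (simp add: mv_diff mat_mult_mv)
    also have "\<dots> = 0\<^sub>v n" unfolding that(3) using that(2) v by (intro eq_vecI) (simp_all del: index_mult_mat_vec)
    finally have "X *v v - Y *v v = 0\<^sub>v m"
      using that(1,2) by (intro inj) (auto intro: carrier_vecI)
    then show "X *v v = Y *v v"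
      using that(1,2) by (auto simp: vec_eq_iff simp del: index_mult_mat_vec)
  qed
  {
    assume "finite_zero_matrix A B C D M"
    then obtain H\<^sub>k H\<^sub>f \<Lambda>\<^sub>k \<Lambda>\<^sub>k\<^sub>f \<Pi>\<^sub>k \<Pi>\<^sub>f R\<^sub>0 \<alpha>\<^sub>k where
      zd: "zero_data A B C D H\<^sub>k H\<^sub>f \<Lambda>\<^sub>k \<Lambda>\<^sub>k\<^sub>f M \<Pi>\<^sub>k \<Pi>\<^sub>f R\<^sub>0 \<alpha>\<^sub>k"
      by (auto simp: finite_zero_matrix_def)
    define k f r where "k = dim_row \<Lambda>\<^sub>k" and "f = dim_row M" and "r = dim_col R\<^sub>0"
    let ?\<Pi> = "append_cols \<Pi>\<^sub>k \<Pi>\<^sub>f" and ?H = "append_cols H\<^sub>k H\<^sub>f"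
      and ?\<Lambda> = "four_block_mat \<Lambda>\<^sub>k \<Lambda>\<^sub>k\<^sub>f (0\<^sub>m f k) M" and ?\<alpha> = "\<alpha>\<^sub>k @\<^sub>r 0\<^sub>m f r"
    have c: "H\<^sub>k \<in> carrier_mat q k" "H\<^sub>f \<in> carrier_mat q f" "\<Lambda>\<^sub>k \<in> carrier_mat k k" "\<Lambda>\<^sub>k\<^sub>f \<in> carrier_mat k f"
      "M \<in> carrier_mat f f" "\<Pi>\<^sub>k \<in> carrier_mat n k" "\<Pi>\<^sub>f \<in> carrier_mat n f" "R\<^sub>0 \<in> carrier_mat q r"
      "\<alpha>\<^sub>k \<in> carrier_mat k r"
      and zb: "zero_basis F (const_mat ?H * resolvent ?\<Lambda>)"
      and st: "A * ?\<Pi> + B * ?H = ?\<Pi> * ?\<Lambda>" and ou: "C * ?\<Pi> + D * ?H = 0\<^sub>m p (k + f)"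
      and sol: "R_solution B D ?\<Pi> R\<^sub>0 ?\<alpha>" and ctrl: "controllable \<Lambda>\<^sub>k \<alpha>\<^sub>k"
      using zd by (simp_all add: zero_data_def Let_def k_def f_def r_def maximal_R_solution_def)
    have cl: "?\<Pi> \<in> carrier_mat n (k + f)" "?H \<in> carrier_mat q (k + f)" "?\<Lambda> \<in> carrier_mat (k + f) (k + f)"
      using c by (auto intro!: carrier_matI)
    from zb zero_basis_iff[OF obs cl st ou]
    have inj': "\<And>c. c \<in> carrier_vec (k + f) \<Longrightarrow> ?\<Pi> *v c = 0\<^sub>v n \<Longrightarrow> c = 0\<^sub>v (k + f)"
      and img': "mat_image ?\<Pi> = V_star A B C D \<inter> reachable A B" by auto
    have \<alpha>: "?\<alpha> \<in> carrier_mat (k + f) r" using c(9) by auto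
    have \<alpha>0: "?\<alpha> *v b = 0\<^sub>v (k + f)" if b: "b \<in> carrier_vec r" for b
    proof -
      have BR: "B * R\<^sub>0 = ?\<Pi> * ?\<alpha>" "D * R\<^sub>0 = 0\<^sub>m p r" using sol by (auto simp: R_solution_def r_def)
      have "B *v (R\<^sub>0 *v b) = ?\<Pi> *v (?\<alpha> *v b)"
        using arg_cong[OF BR(1), of "\<lambda>X. X *v b"] c(8) cl(1) \<alpha> b by (simp add: mat_mult_mv)
      moreover have "?\<Pi> *v (?\<alpha> *v b) \<in> mat_image ?\<Pi>"
        unfolding mat_image_def using c(6,7) \<alpha> by (intro imageI) simp
      moreover have "D *v (R\<^sub>0 *v b) = 0\<^sub>v p"
        using arg_cong[OF BR(2), of "\<lambda>X. X *v b"] c(8) b by (simp add: mat_mult_mv zero_mv)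
      ultimately have "R\<^sub>0 *v b = 0\<^sub>v q" using no_jump[of "R\<^sub>0 *v b"] img' c(8) by auto
      then have "?\<Pi> *v (?\<alpha> *v b) = 0\<^sub>v n"
        using \<open>B *v (R\<^sub>0 *v b) = ?\<Pi> *v (?\<alpha> *v b)\<close> by (simp add: mv_zero)
      then show ?thesis using inj' \<alpha> by simp
    qed
    have "?\<alpha> = 0\<^sub>m (k + f) r" by (rule zero_mat_if_annihilates[OF \<alpha> \<alpha>0])
    have "\<alpha>\<^sub>k = 0\<^sub>m k r"
    proof (rule eq_matI)
      fix i j assume ij: "i < dim_row (0\<^sub>m k r :: complex mat)" "j < dim_col (0\<^sub>m k r :: complex mat)"
      then have "?\<alpha> $$ (i, j) = \<alpha>\<^sub>k $$ (i, j)" using c(9) by (simp add: append_rows_def)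
      then show "\<alpha>\<^sub>k $$ (i, j) = 0\<^sub>m k r $$ (i, j)"
        using ij unfolding \<open>?\<alpha> = 0\<^sub>m (k + f) r\<close> by simp
    qed (use c in auto)
    then have "carrier_vec k = {0\<^sub>v k :: complex vec}"
      using ctrl reachable_zero_input[OF c(3), of r] c(3) by (simp add: controllable_def)
    then have "unit_vec k 0 = (0\<^sub>v k :: complex vec)" using unit_vec_carrier[of k 0] by blast
    then have k0: "k = 0"
      using arg_cong[of "unit_vec k 0" "0\<^sub>v k :: complex vec" "\<lambda>v. v $ 0"] by (cases "k = 0") auto
    have P': "?\<Pi> = \<Pi>\<^sub>f" and H': "?H = H\<^sub>f" and \<Lambda>': "?\<Lambda> = M"
      using c k0 by (auto intro!: append_cols_empty four_block_mat_empty)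
    note [simp] = carrier_matD[OF c(2)] carrier_matD[OF c(5)] carrier_matD[OF c(7)]
    have st': "A * \<Pi>\<^sub>f + B * H\<^sub>f = \<Pi>\<^sub>f * M" and ou': "C * \<Pi>\<^sub>f + D * H\<^sub>f = 0\<^sub>m p f"
      using st ou unfolding P' H' \<Lambda>' by (simp_all add: k0)
    have inj2: "X = 0\<^sub>v f" if "X \<in> carrier_vec f" "\<Pi>\<^sub>f *v X = 0\<^sub>v n" for X
      using inj'[of X] that unfolding P' k0 by simp
    have imgs: "mat_image \<Pi>\<^sub>f = mat_image P" using img' img unfolding P' by simp
    obtain U where U: "U \<in> carrier_mat m f" "\<Pi>\<^sub>f = P * U"
      using factor_through_image[OF P c(7)] imgs by blast
    obtain U' where U': "U' \<in> carrier_mat f m" "P = \<Pi>\<^sub>f * U'"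
      using factor_through_image[OF c(7) P] imgs by blast
    note [simp] = carrier_matD[OF U(1)] carrier_matD[OF U'(1)]
    have UU': "U * U' = 1\<^sub>m m"
    proof (rule inj_mat)
      have "P * (U * U') = P * U * U'" by (simp add: mm_assoc)
      also have "\<dots> = P * 1\<^sub>m m" by (simp add: mm_one flip: U(2) U'(2))
      finally show "P * (U * U') = P * 1\<^sub>m m" .
    qed (auto intro!: carrier_matI)
    have U'U: "U' * U = 1\<^sub>m f"
    proof (rule mat_eqI_mv[of _ f f])
      fix v assume v: "(v :: complex vec) \<in> carrier_vec f"
      have "\<Pi>\<^sub>f *v ((U' * U) *v v - v) = (\<Pi>\<^sub>f * U' * U) *v v - \<Pi>\<^sub>f *v v"
        using v by (simp add: mv_diff mat_mult_mv)
      also have "\<dots> = 0\<^sub>v n"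
        unfolding U'(2)[symmetric] U(2)[symmetric] using v by (intro eq_vecI) (simp_all del: index_mult_mat_vec)
      finally have "(U' * U) *v v - v = 0\<^sub>v f" using v by (intro inj2) auto
      then show "(U' * U) *v v = 1\<^sub>m f *v v"
        using v by (auto simp: vec_eq_iff one_mv simp del: index_mult_mat_vec)
    qed (auto intro!: carrier_matI)
    have key: "(U * M) *v v = (L * U) *v v" if v: "v \<in> carrier_vec f" for v
    proof -
      have vf [simp]: "dim_vec v = f" using v by simp
      define w where "w = H\<^sub>f *v v - H *v (U *v v)"
      have w: "w \<in> carrier_vec q" by (simp add: w_def carrier_vecI)
      have s1: "A *v (\<Pi>\<^sub>f *v v) + B *v (H\<^sub>f *v v) = \<Pi>\<^sub>f *v (M *v v)"
        using arg_cong[OF st', of "\<lambda>X. X *v v"] by (simp add: mv_simps)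
      have s2: "A *v (\<Pi>\<^sub>f *v v) + B *v (H *v (U *v v)) = P *v (L *v (U *v v))"
        using arg_cong[OF state, of "\<lambda>X. X *v (U *v v)"] by (simp add: mv_simps U(2))
      have s3: "\<Pi>\<^sub>f *v (M *v v) = P *v (U *v (M *v v))" by (simp add: U(2) mv_simps)
      have "B *v w = (A *v (\<Pi>\<^sub>f *v v) + B *v (H\<^sub>f *v v)) - (A *v (\<Pi>\<^sub>f *v v) + B *v (H *v (U *v v)))"
        unfolding w_def by (intro eq_vecI) (simp_all add: mv_simps del: index_mult_mat_vec)
      also have "\<dots> = P *v (U *v (M *v v) - L *v (U *v v))"
        unfolding s1 s2 s3 by (simp add: mv_simps)
      finally have Bw: "B *v w = P *v (U *v (M *v v) - L *v (U *v v))" .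
      have o1: "C *v (\<Pi>\<^sub>f *v v) + D *v (H\<^sub>f *v v) = 0\<^sub>v p"
        using arg_cong[OF ou', of "\<lambda>X. X *v v"] by (simp add: mv_simps)
      have o2: "C *v (\<Pi>\<^sub>f *v v) + D *v (H *v (U *v v)) = 0\<^sub>v p"
        using arg_cong[OF out, of "\<lambda>X. X *v (U *v v)"] by (simp add: mv_simps U(2))
      have "D *v w = (C *v (\<Pi>\<^sub>f *v v) + D *v (H\<^sub>f *v v)) - (C *v (\<Pi>\<^sub>f *v v) + D *v (H *v (U *v v)))"
        unfolding w_def by (intro eq_vecI) (simp_all add: mv_simps del: index_mult_mat_vec)
      also have "\<dots> = 0\<^sub>v p" unfolding o1 o2 by (intro eq_vecI) simp_all
      finally have Dw: "D *v w = 0\<^sub>v p" .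
      have "B *v w \<in> mat_image P"
        unfolding Bw mat_image_def by (intro imageI) (simp add: carrier_vecI)
      then have "w = 0\<^sub>v q" using no_jump[OF w _ Dw] img by auto
      then have "U *v (M *v v) - L *v (U *v v) = 0\<^sub>v m"
        using Bw by (intro inj) (auto simp: mv_zero intro: carrier_vecI)
      then show ?thesis
        by (auto simp: vec_eq_iff mat_mult_mv simp del: index_mult_mat_vec)
    qed
    have UM: "U * M = L * U"
      by (rule mat_eqI_mv[OF _ _ key]) (auto intro!: carrier_matI)
    have mf: "m = f" by (rule inverse_pair_dims[OF U(1) U'(1) UU' U'U])
    have "M = U' * L * U"
    proof -
      have "M = U' * U * M" by (simp add: U'U mm_one)
      also have "\<dots> = U' * (L * U)" by (simp add: mm_assoc UM)
      finally show ?thesis by (simp add: mm_assoc)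
    qed
    then show "similar_mat M L"
      using U(1) U'(1) UU' U'U c(5) L mf by (intro similar_matI[of _ _ U' U f]) auto
  }
  assume "similar_mat M L"
  from similar_matD[OF this] obtain m' Q' Q where
    Q': "{M, L, Q', Q} \<subseteq> carrier_mat m' m'" "Q' * Q = 1\<^sub>m m'" "Q * Q' = 1\<^sub>m m'" "M = Q' * L * Q" by metis
  have "m' = m" using Q'(1) L by auto
  with Q' have Q: "M \<in> carrier_mat m m" "Q \<in> carrier_mat m m" "Q' \<in> carrier_mat m m"
    "Q' * Q = 1\<^sub>m m" "Q * Q' = 1\<^sub>m m" "M = Q' * L * Q" by simp_all
  note [simp] = carrier_matD[OF Q(1)] carrier_matD[OF Q(2)] carrier_matD[OF Q(3)]
  have QM: "Q * M = L * Q"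
  proof -
    have "Q * M = Q * Q' * (L * Q)" unfolding Q(6) by (simp add: mm_assoc)
    then show ?thesis by (simp add: Q(5) mm_one)
  qed
  let ?P = "P * Q" and ?H = "H * Q"
  have cl: "?P \<in> carrier_mat n m" "?H \<in> carrier_mat q m" by (auto intro!: carrier_matI)
  have st: "A * ?P + B * ?H = ?P * M"
  proof -
    have "A * ?P + B * ?H = (A * P + B * H) * Q" by (simp add: mm_simps)
    also have "\<dots> = ?P * M" unfolding state by (simp add: mm_assoc QM)
    finally show ?thesis .
  qed
  have ou: "C * ?P + D * ?H = 0\<^sub>m p m"
  proof -
    have "C * ?P + D * ?H = (C * P + D * H) * Q" by (simp add: mm_simps)
    then show ?thesis by (simp add: out mm_zero)
  qed
  have inj': "c = 0\<^sub>v m" if c: "c \<in> carrier_vec m" "?P *v c = 0\<^sub>v n" for c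
  proof -
    have "Q *v c = 0\<^sub>v m" using c by (intro inj) (auto simp: mat_mult_mv intro: carrier_vecI)
    moreover have "c = Q' *v (Q *v c)" using c Q(4) by (simp add: one_mv flip: mat_mult_mv)
    ultimately show ?thesis by (simp add: mv_zero)
  qed
  have img': "mat_image ?P = V_star A B C D \<inter> reachable A B"
  proof -
    have "P *v c \<in> mat_image ?P" if c: "c \<in> carrier_vec m" for c
    proof -
      have "P *v c = ?P *v (Q' *v c)" using c Q(5) by (simp add: one_mv mat_mult_mv flip: mat_mult_mv[of Q Q'])
      then show ?thesis unfolding mat_image_def by (auto intro: carrier_vecI)
    qed
    moreover have "?P *v c \<in> mat_image P" if c: "c \<in> carrier_vec m" for c
      using c unfolding mat_image_def by (auto simp: mat_mult_mv intro: carrier_vecI)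
    ultimately have "mat_image ?P = mat_image P" by (auto simp: mat_image_def)
    then show ?thesis using img by simp
  qed
  have zb: "zero_basis F (const_mat ?H * resolvent M)"
    using zero_basis_iff[OF obs cl Q(1) st ou] inj' img' by blast
  have "zero_data A B C D (0\<^sub>m q 0) ?H (0\<^sub>m 0 0) (0\<^sub>m 0 m) M (0\<^sub>m n 0) ?P (0\<^sub>m q 0) (0\<^sub>m 0 0)"
  proof -
    have e: "append_cols (0\<^sub>m q 0) ?H = ?H" "append_cols (0\<^sub>m n 0) ?P = ?P"
      "four_block_mat (0\<^sub>m 0 0) (0\<^sub>m 0 m) (0\<^sub>m m 0) M = M" "0\<^sub>m 0 0 @\<^sub>r 0\<^sub>m m 0 = (0\<^sub>m m 0 :: complex mat)"
      by (rule append_cols_empty[OF _ cl(2)] append_cols_empty[OF _ cl(1)]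
          four_block_mat_empty[OF _ _ Q(1)] append_rows_empty, simp_all)+
    have ctrl: "controllable (0\<^sub>m 0 0) (0\<^sub>m 0 0)"
    proof -
      have "v = 0\<^sub>v 0" if "v \<in> carrier_vec 0" for v :: "complex vec"
        using that by (intro eq_vecI) simp_all
      then have "carrier_vec 0 = {0\<^sub>v 0 :: complex vec}" using zero_carrier_vec[of 0] by blast
      then show ?thesis unfolding controllable_def using reachable_zero_input[of "0\<^sub>m 0 0" 0 0] by simp
    qed
    have sol: "R_solution B D ?P (0\<^sub>m q 0) (0\<^sub>m m 0)"
      unfolding R_solution_def by (simp add: mm_zero)
    have max: "mat_image R \<subseteq> mat_image (0\<^sub>m q 0)" if s: "R_solution B D ?P R \<alpha>" for R \<alpha>
    proof -
      have c: "R \<in> carrier_mat q (dim_col R)" "\<alpha> \<in> carrier_mat m (dim_col R)"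
        and BR: "B * R = ?P * \<alpha>" and DR: "D * R = 0\<^sub>m p (dim_col R)"
        using s by (auto simp: R_solution_def)
      note [simp] = carrier_matD(1)[OF c(1)] carrier_matD[OF c(2)]
      have "R *v b = 0\<^sub>v q" if b: "b \<in> carrier_vec (dim_col R)" for b
      proof (rule no_jump)
        have "B *v (R *v b) = ?P *v (\<alpha> *v b)"
          using arg_cong[OF BR, of "\<lambda>X. X *v b"] b by (simp add: mat_mult_mv)
        moreover have "?P *v (\<alpha> *v b) \<in> mat_image ?P" unfolding mat_image_def by (intro imageI) simp
        ultimately show "B *v (R *v b) \<in> V_star A B C D" unfolding img' by simp
        show "D *v (R *v b) = 0\<^sub>v p"
          using arg_cong[OF DR, of "\<lambda>X. X *v b"] b by (simp add: mat_mult_mv zero_mv)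
      qed simp
      moreover have "0\<^sub>v q \<in> mat_image (0\<^sub>m q 0 :: complex mat)"
        by (rule vec_subspaceD(2)[OF vec_subspace_mat_image[of _ q 0]]) simp
      ultimately show ?thesis by (auto simp: mat_image_def[of R])
    qed
    show ?thesis
      unfolding zero_data_def Let_def maximal_R_solution_def
      using cl Q(1) zb st ou ctrl sol max by (simp add: e)
  qed
  then show "finite_zero_matrix A B C D M" unfolding finite_zero_matrix_def by blast
qed

end

section \<open>The closed loop and the Riccati equation\<close>

text \<open>The data of the theorem in state space form. The basis condition appears as the injectivity and the
  image of \<open>[\<Pi>\<^sub>k, \<Pi>\<^sub>f]\<close>, and the maximality of \<open>R\<^sub>0\<close> is expressed by single input directions.\<close>

locale squaring_down = lti n q p A B C D for n q p A B C D +
  fixes k f r l :: nat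
    and H\<^sub>k H\<^sub>f \<Lambda>\<^sub>k \<Lambda>\<^sub>k\<^sub>f \<Lambda>\<^sub>f \<Pi>\<^sub>k \<Pi>\<^sub>f R\<^sub>0 \<alpha>\<^sub>k \<sigma> L\<^sub>0 :: "complex mat"
  assumes obs: "observable C A"
    and carriers: "H\<^sub>k \<in> carrier_mat q k" "H\<^sub>f \<in> carrier_mat q f" "\<Lambda>\<^sub>k \<in> carrier_mat k k"
      "\<Lambda>\<^sub>k\<^sub>f \<in> carrier_mat k f" "\<Lambda>\<^sub>f \<in> carrier_mat f f" "\<Pi>\<^sub>k \<in> carrier_mat n k" "\<Pi>\<^sub>f \<in> carrier_mat n f"
      "R\<^sub>0 \<in> carrier_mat q r" "\<alpha>\<^sub>k \<in> carrier_mat k r" "\<sigma> \<in> carrier_mat k k" "L\<^sub>0 \<in> carrier_mat q l"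
    and state_k: "A * \<Pi>\<^sub>k + B * H\<^sub>k = \<Pi>\<^sub>k * \<Lambda>\<^sub>k"
    and state_f: "A * \<Pi>\<^sub>f + B * H\<^sub>f = \<Pi>\<^sub>k * \<Lambda>\<^sub>k\<^sub>f + \<Pi>\<^sub>f * \<Lambda>\<^sub>f"
    and out_k: "C * \<Pi>\<^sub>k + D * H\<^sub>k = 0\<^sub>m p k"
    and out_f: "C * \<Pi>\<^sub>f + D * H\<^sub>f = 0\<^sub>m p f"
    and injective: "\<And>c. c \<in> carrier_vec (k + f) \<Longrightarrow> append_cols \<Pi>\<^sub>k \<Pi>\<^sub>f *v c = 0\<^sub>v n \<Longrightarrow> c = 0\<^sub>v (k + f)"
    and image: "mat_image (append_cols \<Pi>\<^sub>k \<Pi>\<^sub>f) = V_star A B C D \<inter> reachable A B"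
    and solution: "B * R\<^sub>0 = \<Pi>\<^sub>k * \<alpha>\<^sub>k" "D * R\<^sub>0 = 0\<^sub>m p r"
    and maximal: "\<And>w. w \<in> carrier_vec q \<Longrightarrow> B *v w \<in> V_star A B C D \<Longrightarrow> D *v w = 0\<^sub>v p \<Longrightarrow> w \<in> mat_image R\<^sub>0"
    and ctrl: "controllable \<Lambda>\<^sub>k \<alpha>\<^sub>k"
    and orthonormal: "adj R\<^sub>0 * R\<^sub>0 = 1\<^sub>m r"
    and complete: "R\<^sub>0 * adj R\<^sub>0 + L\<^sub>0 * adj L\<^sub>0 = 1\<^sub>m q"
    and L_orthonormal: "adj L\<^sub>0 * L\<^sub>0 = 1\<^sub>m l"
    and RL_orthogonal: "adj R\<^sub>0 * L\<^sub>0 = 0\<^sub>m r l"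
    and pos_def: "pos_def_mat \<sigma>"
    and riccati: "\<sigma> * (\<Lambda>\<^sub>k - \<alpha>\<^sub>k * adj R\<^sub>0 * H\<^sub>k) + adj (\<Lambda>\<^sub>k - \<alpha>\<^sub>k * adj R\<^sub>0 * H\<^sub>k) * \<sigma>
         - \<sigma> * \<alpha>\<^sub>k * adj \<alpha>\<^sub>k * \<sigma>
         + adj H\<^sub>k * (1\<^sub>m q - R\<^sub>0 * adj R\<^sub>0) * H\<^sub>k = 0\<^sub>m k k"
begin

definition \<beta>\<^sub>k where "\<beta>\<^sub>k = - (adj \<alpha>\<^sub>k * \<sigma>) - adj R\<^sub>0 * H\<^sub>k"
definition N where "N = H\<^sub>k + R\<^sub>0 * \<beta>\<^sub>k"
definition \<Lambda>\<^sub>\<beta> where "\<Lambda>\<^sub>\<beta> = \<Lambda>\<^sub>k + \<alpha>\<^sub>k * \<beta>\<^sub>k"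
definition S where "S = minv \<sigma>"
definition B\<^sub>r where "B\<^sub>r = (B + \<Pi>\<^sub>k * S * adj H\<^sub>k) * L\<^sub>0"
definition D\<^sub>r where "D\<^sub>r = D * L\<^sub>0"

lemmas carrier_dims [simp] = carriers[THEN carrier_matD(1)] carriers[THEN carrier_matD(2)]

lemma sigma_adjoint [simp]: "adj \<sigma> = \<sigma>"
  using pos_def by (simp add: pos_def_mat_def)

lemma S: "S \<in> carrier_mat k k" "\<sigma> * S = 1\<^sub>m k" "S * \<sigma> = 1\<^sub>m k"
proof -
  have inj: "v = 0\<^sub>v k" if "v \<in> carrier_vec k" "\<sigma> *v v = 0\<^sub>v k" for v
  proof (rule ccontr)
    assume "v \<noteq> 0\<^sub>v k"
    then have "0 < Re ((\<sigma> *v v) \<bullet>c v)" using pos_def that(1) by (simp add: pos_def_mat_def)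
    then show False using that by (simp add: scalar_prod_def)
  qed
  show "S \<in> carrier_mat k k" "\<sigma> * S = 1\<^sub>m k" "S * \<sigma> = 1\<^sub>m k"
    using invertible_if_injective[OF carriers(10) inj] by (auto simp: S_def)
qed

lemma derived_dims [simp]:
  "dim_row S = k" "dim_col S = k" "dim_row \<beta>\<^sub>k = r" "dim_col \<beta>\<^sub>k = k" "dim_row N = q" "dim_col N = k"
  "dim_row \<Lambda>\<^sub>\<beta> = k" "dim_col \<Lambda>\<^sub>\<beta> = k" "dim_row B\<^sub>r = n" "dim_col B\<^sub>r = l" "dim_row D\<^sub>r = p" "dim_col D\<^sub>r = l"
  using S(1) by (simp_all add: \<beta>\<^sub>k_def N_def \<Lambda>\<^sub>\<beta>_def B\<^sub>r_def D\<^sub>r_def)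

lemma derived_carriers:
  "N \<in> carrier_mat q k" "\<Lambda>\<^sub>\<beta> \<in> carrier_mat k k" "B\<^sub>r \<in> carrier_mat n l" "D\<^sub>r \<in> carrier_mat p l"
  by (auto intro: carrier_matI)

sublocale reduced: lti n l p A B\<^sub>r C D\<^sub>r
  by unfold_locales (simp_all add: A C derived_carriers)

text \<open>The known products, in the form in which they occur inside longer products associated to the
  right.\<close>

lemma products:
  "dim_row X = r \<Longrightarrow> adj R\<^sub>0 * (R\<^sub>0 * X) = X"
  "dim_row X = k \<Longrightarrow> S * (\<sigma> * X) = X" "dim_row X = k \<Longrightarrow> \<sigma> * (S * X) = X"
  "dim_row X = r \<Longrightarrow> B * (R\<^sub>0 * X) = \<Pi>\<^sub>k * (\<alpha>\<^sub>k * X)"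
  "dim_row X = r \<Longrightarrow> D * (R\<^sub>0 * X) = 0\<^sub>m p (dim_col X)"
  "dim_row X = l \<Longrightarrow> adj R\<^sub>0 * (L\<^sub>0 * X) = 0\<^sub>m r (dim_col X)"
  by (simp_all add: orthonormal S solution RL_orthogonal mm_one mm_zero flip: mm_assoc)

lemma N_eq: "N = H\<^sub>k - R\<^sub>0 * (adj \<alpha>\<^sub>k * \<sigma>) - R\<^sub>0 * (adj R\<^sub>0 * H\<^sub>k)"
  unfolding N_def \<beta>\<^sub>k_def
  by (intro eq_matI) (simp_all add: mm_simps uminus_mult_right_mat del: index_mult_mat(1))

lemma N_adjoint_eq: "adj N = adj H\<^sub>k - \<sigma> * (\<alpha>\<^sub>k * adj R\<^sub>0) - adj H\<^sub>k * (R\<^sub>0 * adj R\<^sub>0)"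
  unfolding N_eq by (simp add: mat_adjoint_simps mm_assoc)

lemma \<Lambda>\<^sub>\<beta>_eq: "\<Lambda>\<^sub>\<beta> = \<Lambda>\<^sub>k - \<alpha>\<^sub>k * (adj \<alpha>\<^sub>k * \<sigma>) - \<alpha>\<^sub>k * (adj R\<^sub>0 * H\<^sub>k)"
  unfolding \<Lambda>\<^sub>\<beta>_def \<beta>\<^sub>k_def
  by (intro eq_matI) (simp_all add: mm_simps uminus_mult_right_mat del: index_mult_mat(1))

text \<open>For the closed loop the Riccati equation becomes a Lyapunov equation: as the columns of \<open>R\<^sub>0\<close> are
  orthonormal, \<open>N\<^sup>* N = H\<^sub>k\<^sup>* (I - R\<^sub>0 R\<^sub>0\<^sup>*) H\<^sub>k + \<sigma> \<alpha>\<^sub>k \<alpha>\<^sub>k\<^sup>* \<sigma>\<close>.\<close>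

lemma lyapunov: "\<sigma> * \<Lambda>\<^sub>\<beta> + adj \<Lambda>\<^sub>\<beta> * \<sigma> + adj N * N = 0\<^sub>m k k"
proof (rule eq_matI)
  fix i j assume "i < dim_row (0\<^sub>m k k :: complex mat)" "j < dim_col (0\<^sub>m k k :: complex mat)"
  then have ij: "i < k" "j < k" by auto
  have "(\<sigma> * (\<Lambda>\<^sub>k - \<alpha>\<^sub>k * adj R\<^sub>0 * H\<^sub>k) + adj (\<Lambda>\<^sub>k - \<alpha>\<^sub>k * adj R\<^sub>0 * H\<^sub>k) * \<sigma>
         - \<sigma> * \<alpha>\<^sub>k * adj \<alpha>\<^sub>k * \<sigma>
         + adj H\<^sub>k * (1\<^sub>m q - R\<^sub>0 * adj R\<^sub>0) * H\<^sub>k) $$ (i, j) = 0"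
    unfolding riccati using ij by simp
  then have "(\<sigma> * \<Lambda>\<^sub>k) $$ (i, j) - (\<sigma> * (\<alpha>\<^sub>k * (adj R\<^sub>0 * H\<^sub>k))) $$ (i, j)
      + (adj \<Lambda>\<^sub>k * \<sigma>) $$ (i, j) - (adj H\<^sub>k * (R\<^sub>0 * (adj \<alpha>\<^sub>k * \<sigma>))) $$ (i, j)
      - (\<sigma> * (\<alpha>\<^sub>k * (adj \<alpha>\<^sub>k * \<sigma>))) $$ (i, j) + (adj H\<^sub>k * H\<^sub>k) $$ (i, j)
      - (adj H\<^sub>k * (R\<^sub>0 * (adj R\<^sub>0 * H\<^sub>k))) $$ (i, j) = 0"
    using ij by (simp add: mm_simps mat_adjoint_simps algebra_simps del: index_mult_mat(1))
  then show "(\<sigma> * \<Lambda>\<^sub>\<beta> + adj \<Lambda>\<^sub>\<beta> * \<sigma> + adj N * N) $$ (i, j) = 0\<^sub>m k k $$ (i, j)"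
    unfolding N_adjoint_eq \<Lambda>\<^sub>\<beta>_eq N_eq using ij
    by (simp add: mm_simps mat_adjoint_simps products algebra_simps del: index_mult_mat(1))
qed simp_all

lemma N_adjoint_R: "adj N * R\<^sub>0 = - (\<sigma> * \<alpha>\<^sub>k)"
  unfolding N_adjoint_eq
  by (intro eq_matI) (simp_all add: mm_simps orthonormal del: index_mult_mat(1))

lemma N_adjoint_L: "adj N * L\<^sub>0 = adj H\<^sub>k * L\<^sub>0"
  unfolding N_adjoint_eq
  by (intro eq_matI) (simp_all add: mm_simps RL_orthogonal del: index_mult_mat(1))

lemma state_N: "A * \<Pi>\<^sub>k + B * N = \<Pi>\<^sub>k * \<Lambda>\<^sub>\<beta>"
proof (rule eq_matI)
  fix i j assume "i < dim_row (\<Pi>\<^sub>k * \<Lambda>\<^sub>\<beta>)" "j < dim_col (\<Pi>\<^sub>k * \<Lambda>\<^sub>\<beta>)"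
  then have ij: "i < n" "j < k" by auto
  have "(A * \<Pi>\<^sub>k + B * H\<^sub>k) $$ (i, j) = (\<Pi>\<^sub>k * \<Lambda>\<^sub>k) $$ (i, j)" unfolding state_k ..
  then show "(A * \<Pi>\<^sub>k + B * N) $$ (i, j) = (\<Pi>\<^sub>k * \<Lambda>\<^sub>\<beta>) $$ (i, j)"
    unfolding N_def \<Lambda>\<^sub>\<beta>_def using ij by (simp add: mm_simps products del: index_mult_mat(1))
qed simp_all

lemma out_N: "C * \<Pi>\<^sub>k + D * N = 0\<^sub>m p k"
proof (rule eq_matI)
  fix i j assume "i < dim_row (0\<^sub>m p k :: complex mat)" "j < dim_col (0\<^sub>m p k :: complex mat)"
  then have ij: "i < p" "j < k" by auto
  have "(C * \<Pi>\<^sub>k + D * H\<^sub>k) $$ (i, j) = 0" unfolding out_k using ij by simp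
  then show "(C * \<Pi>\<^sub>k + D * N) $$ (i, j) = 0\<^sub>m p k $$ (i, j)"
    unfolding N_def using ij by (simp add: mm_simps products del: index_mult_mat(1))
qed simp_all

lemma B\<^sub>r_eq: "B\<^sub>r = B * L\<^sub>0 + \<Pi>\<^sub>k * (S * (adj N * L\<^sub>0))"
  unfolding B\<^sub>r_def N_adjoint_L by (simp add: mm_simps)

text \<open>On the orthogonal complement of the input directions \<open>R\<^sub>0\<close>, which \<open>L\<^sub>0 L\<^sub>0\<^sup>*\<close> projects to, the
  correction \<open>\<Pi>\<^sub>k \<sigma>\<^sup>-\<^sup>1 N\<^sup>*\<close> is that of \<open>B\<^sub>r\<close>; along \<open>R\<^sub>0\<close> it cancels \<open>B R\<^sub>0 = \<Pi>\<^sub>k \<alpha>\<^sub>k\<close>.\<close>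

lemma B\<^sub>r_L_adjoint: "B\<^sub>r * adj L\<^sub>0 = B + \<Pi>\<^sub>k * (S * adj N)"
proof -
  have LL: "L\<^sub>0 * adj L\<^sub>0 = 1\<^sub>m q - R\<^sub>0 * adj R\<^sub>0"
  proof (rule eq_matI)
    fix i j assume "i < dim_row (1\<^sub>m q - R\<^sub>0 * adj R\<^sub>0)" "j < dim_col (1\<^sub>m q - R\<^sub>0 * adj R\<^sub>0)"
    then have ij: "i < q" "j < q" by auto
    have "(R\<^sub>0 * adj R\<^sub>0 + L\<^sub>0 * adj L\<^sub>0) $$ (i, j) = 1\<^sub>m q $$ (i, j)" unfolding complete ..
    then show "(L\<^sub>0 * adj L\<^sub>0) $$ (i, j) = (1\<^sub>m q - R\<^sub>0 * adj R\<^sub>0) $$ (i, j)"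
      using ij by (simp add: algebra_simps del: index_mult_mat(1))
  qed simp_all
  have NRR: "adj N * (R\<^sub>0 * adj R\<^sub>0) = - (\<sigma> * (\<alpha>\<^sub>k * adj R\<^sub>0))"
    by (simp add: N_adjoint_R uminus_mult_left_mat mm_assoc flip: mm_assoc[of "adj N"])
  have "B\<^sub>r * adj L\<^sub>0 = B * (L\<^sub>0 * adj L\<^sub>0) + \<Pi>\<^sub>k * (S * (adj N * (L\<^sub>0 * adj L\<^sub>0)))"
    unfolding B\<^sub>r_eq by (simp add: mm_simps)
  also have "\<dots> = B + \<Pi>\<^sub>k * (S * adj N)"
    unfolding LL by (intro eq_matI)
      (simp_all add: mm_simps products NRR uminus_mult_right_mat del: index_mult_mat(1))
  finally show ?thesis .
qed

text \<open>The Lyapunov equation, multiplied by \<open>\<sigma>\<^sup>-\<^sup>1\<close> from both sides, exchanges \<open>\<Lambda>\<^sub>\<beta> \<sigma>\<^sup>-\<^sup>1\<close> for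
  \<open>- \<sigma>\<^sup>-\<^sup>1 \<Lambda>\<^sub>\<beta>\<^sup>*\<close> up to a term in \<open>N\<close>, which combines with \<open>B N\<close> to a multiple of \<open>B\<^sub>r\<close>.\<close>

lemma closed_loop_adjoint:
  "A * (\<Pi>\<^sub>k * S) + \<Pi>\<^sub>k * (S * adj \<Lambda>\<^sub>\<beta>) + B\<^sub>r * (adj L\<^sub>0 * (N * S)) = 0\<^sub>m n k"
proof (rule eq_matI)
  fix i j assume "i < dim_row (0\<^sub>m n k :: complex mat)" "j < dim_col (0\<^sub>m n k :: complex mat)"
  then have ij: "i < n" "j < k" by auto
  have "\<Pi>\<^sub>k * (S * (\<sigma> * \<Lambda>\<^sub>\<beta> + adj \<Lambda>\<^sub>\<beta> * \<sigma> + adj N * N) * S) = 0\<^sub>m n k"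
    unfolding lyapunov by (simp add: mm_zero)
  then have "(\<Pi>\<^sub>k * (S * (\<sigma> * \<Lambda>\<^sub>\<beta> + adj \<Lambda>\<^sub>\<beta> * \<sigma> + adj N * N) * S)) $$ (i, j) = 0"
    using ij by simp
  then have 1: "(\<Pi>\<^sub>k * (\<Lambda>\<^sub>\<beta> * S)) $$ (i, j) + (\<Pi>\<^sub>k * (S * adj \<Lambda>\<^sub>\<beta>)) $$ (i, j) +
      (\<Pi>\<^sub>k * (S * (adj N * (N * S)))) $$ (i, j) = 0"
    using ij by (simp add: mm_simps products S(2) del: index_mult_mat(1))
  have "((A * \<Pi>\<^sub>k + B * N) * S) $$ (i, j) = (\<Pi>\<^sub>k * (\<Lambda>\<^sub>\<beta> * S)) $$ (i, j)"
    unfolding state_N by (simp add: mm_assoc)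
  then have 2: "(A * (\<Pi>\<^sub>k * S)) $$ (i, j) + (B * (N * S)) $$ (i, j) = (\<Pi>\<^sub>k * (\<Lambda>\<^sub>\<beta> * S)) $$ (i, j)"
    using ij by (simp add: mm_simps del: index_mult_mat(1))
  have "B\<^sub>r * (adj L\<^sub>0 * (N * S)) = (B\<^sub>r * adj L\<^sub>0) * (N * S)" by (simp add: mm_assoc)
  also have "\<dots> = B * (N * S) + \<Pi>\<^sub>k * (S * (adj N * (N * S)))"
    unfolding B\<^sub>r_L_adjoint by (simp add: mm_simps)
  finally have 3: "B\<^sub>r * (adj L\<^sub>0 * (N * S)) = B * (N * S) + \<Pi>\<^sub>k * (S * (adj N * (N * S)))" .
  show "(A * (\<Pi>\<^sub>k * S) + \<Pi>\<^sub>k * (S * adj \<Lambda>\<^sub>\<beta>) + B\<^sub>r * (adj L\<^sub>0 * (N * S))) $$ (i, j) = 0\<^sub>m n k $$ (i, j)"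
    unfolding 3 using ij 1[folded 2] by (simp add: algebra_simps del: index_mult_mat(1))
qed simp_all

section \<open>The transfer function of the reduced system\<close>

definition L\<^sub>\<beta> where
  "L\<^sub>\<beta> = const_mat L\<^sub>0 - const_mat N * resolvent \<Lambda>\<^sub>\<beta> * const_mat (S * adj N * L\<^sub>0)"

lemma resolvent_\<Lambda>\<^sub>\<beta>_dims [simp]: "dim_row (resolvent \<Lambda>\<^sub>\<beta>) = k" "dim_col (resolvent \<Lambda>\<^sub>\<beta>) = k"
  using resolvent_dims[OF derived_carriers(2)] by auto

lemma resolvent_A_dims [simp]: "dim_row (resolvent A) = n" "dim_col (resolvent A) = n"
  using resolvent_dims[OF A] by auto

text \<open>The input \<open>N \<eta>\<close> together with the impulse \<open>\<Pi>\<^sub>k w\<close> drives the state along \<open>\<Pi>\<^sub>k \<eta>\<close> with zero output,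
  so \<open>N \<eta>\<close> alone produces the negative of the response to \<open>\<Pi>\<^sub>k w\<close>.\<close>

lemma closed_loop_response:
  assumes w: "w \<in> carrier_vec k"
  defines "\<eta> \<equiv> resolvent \<Lambda>\<^sub>\<beta> *v w"
  shows "F *v (const_mat N *v \<eta>) = - (const_mat C *v (resolvent A *v (const_mat \<Pi>\<^sub>k *v w)))"
proof -
  have \<eta>: "\<eta> \<in> carrier_vec k" and wk: "dim_vec w = k" using w by (simp_all add: \<eta>_def)
  have d [simp]: "dim_vec \<eta> = k" using \<eta> by simp
  have eq: "zz *s \<eta> = const_mat \<Lambda>\<^sub>\<beta> *v \<eta> + w"
    using resolvent_mult_eq_iff[OF derived_carriers(2) w \<eta>] by (simp add: \<eta>_def)
  let ?b = "const_mat B *v (const_mat N *v \<eta>) + const_mat \<Pi>\<^sub>k *v w"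
  have "zz *s (const_mat \<Pi>\<^sub>k *v \<eta>) = const_mat \<Pi>\<^sub>k *v (zz *s \<eta>)" by (simp add: mv_simps)
  also have "\<dots> = const_mat (\<Pi>\<^sub>k * \<Lambda>\<^sub>\<beta>) *v \<eta> + const_mat \<Pi>\<^sub>k *v w"
    unfolding eq using wk by (simp add: mv_simps const_simps)
  also have "\<dots> = const_mat A *v (const_mat \<Pi>\<^sub>k *v \<eta>) + ?b"
    unfolding state_N[symmetric] using wk
    by (intro eq_vecI) (simp_all add: mv_simps const_simps add.assoc del: index_mult_mat_vec)
  finally have "const_mat \<Pi>\<^sub>k *v \<eta> = resolvent A *v ?b"
    using resolvent_mult_eq_iff[OF A, of ?b "const_mat \<Pi>\<^sub>k *v \<eta>"] by simp
  also have "\<dots> = resolvent A *v (const_mat B *v (const_mat N *v \<eta>)) + resolvent A *v (const_mat \<Pi>\<^sub>k *v w)"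
    by (simp add: mv_simps)
  finally have P\<eta>: "const_mat \<Pi>\<^sub>k *v \<eta> = \<dots>" .
  have "const_mat C *v (const_mat \<Pi>\<^sub>k *v \<eta>) + const_mat D *v (const_mat N *v \<eta>) = const_mat (C * \<Pi>\<^sub>k + D * N) *v \<eta>"
    by (simp add: mv_simps const_simps)
  also have "\<dots> = 0\<^sub>v p" unfolding out_N by (simp add: mv_simps const_simps)
  finally have out: "const_mat C *v (const_mat \<Pi>\<^sub>k *v \<eta>) + const_mat D *v (const_mat N *v \<eta>) = 0\<^sub>v p" .
  have "F *v (const_mat N *v \<eta>) =
    (const_mat C *v (const_mat \<Pi>\<^sub>k *v \<eta>) + const_mat D *v (const_mat N *v \<eta>))
     - const_mat C *v (resolvent A *v (const_mat \<Pi>\<^sub>k *v w))"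
    unfolding P\<eta> by (subst F_mult) (simp, intro eq_vecI, simp_all add: mv_simps del: index_mult_mat_vec)
  also have "\<dots> = - (const_mat C *v (resolvent A *v (const_mat \<Pi>\<^sub>k *v w)))"
    unfolding out by (intro eq_vecI) (simp_all del: index_mult_mat_vec)
  finally show ?thesis .
qed

lemma reduced_transfer_function: "F * L\<^sub>\<beta> = reduced.F"
proof (rule mat_eqI_mv[of _ p l])
  have Ld [simp]: "dim_row L\<^sub>\<beta> = q" "dim_col L\<^sub>\<beta> = l" by (simp_all add: L\<^sub>\<beta>_def)
  show "F * L\<^sub>\<beta> \<in> carrier_mat p l" by (intro carrier_matI) simp_all
  show "reduced.F \<in> carrier_mat p l" by (rule reduced.F_carrier)
  fix v :: "rat_fun vec" assume v: "v \<in> carrier_vec l"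
  then have vl [simp]: "dim_vec v = l" by simp
  define w where "w = const_mat (S * adj N * L\<^sub>0) *v v"
  have w: "w \<in> carrier_vec k" by (simp add: w_def)
  then have wk [simp]: "dim_vec w = k" by simp
  define \<eta> where "\<eta> = resolvent \<Lambda>\<^sub>\<beta> *v w"
  have \<eta>k [simp]: "dim_vec \<eta> = k" by (simp add: \<eta>_def)
  have Lv: "L\<^sub>\<beta> *v v = const_mat L\<^sub>0 *v v - const_mat N *v \<eta>"
    unfolding L\<^sub>\<beta>_def \<eta>_def w_def by (simp add: mat_diff_mv mat_mult_mv)
  have BL: "const_mat B\<^sub>r *v v = const_mat B *v (const_mat L\<^sub>0 *v v) + const_mat \<Pi>\<^sub>k *v w"
    unfolding B\<^sub>r_eq w_def by (simp add: const_simps mv_simps)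
  have DL: "const_mat D\<^sub>r *v v = const_mat D *v (const_mat L\<^sub>0 *v v)"
    unfolding D\<^sub>r_def by (simp add: const_simps mv_simps)
  have "(F * L\<^sub>\<beta>) *v v = F *v (const_mat L\<^sub>0 *v v) - F *v (const_mat N *v \<eta>)"
    by (simp add: mat_mult_mv Lv mv_diff)
  also have "\<dots> = F *v (const_mat L\<^sub>0 *v v) + const_mat C *v (resolvent A *v (const_mat \<Pi>\<^sub>k *v w))"
    unfolding \<eta>_def closed_loop_response[OF w] by (intro eq_vecI) (simp_all del: index_mult_mat_vec)
  also have "\<dots> = reduced.F *v v"
    by (subst F_mult, simp, subst reduced.F_mult[OF v], unfold BL DL)
      (intro eq_vecI; simp add: mv_simps del: index_mult_mat_vec)
  finally show "(F * L\<^sub>\<beta>) *v v = reduced.F *v v" .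
qed

end

lemma transpose_simps:
  "dim_col X = dim_row Y \<Longrightarrow> (X * Y)\<^sup>T = Y\<^sup>T * (X :: 'a::comm_ring_1 mat)\<^sup>T"
  "dim_row X = dim_row Z \<Longrightarrow> dim_col X = dim_col Z \<Longrightarrow> (X + Z)\<^sup>T = X\<^sup>T + (Z :: 'a::comm_ring_1 mat)\<^sup>T"
  by (intro eq_matI; simp add: scalar_prod_def mult.commute)+

context squaring_down
begin

section \<open>Output nulling and controllability subspaces of the reduced system\<close>

lemma Pi_image:
  assumes c: "c \<in> carrier_vec k"
  shows "\<Pi>\<^sub>k *v c \<in> V_star A B C D" "\<Pi>\<^sub>k *v c \<in> reachable A B"
proof -
  have cd: "dim_vec c = k" using c by simp
  have "append_cols \<Pi>\<^sub>k \<Pi>\<^sub>f *v (c @\<^sub>v 0\<^sub>v f) = \<Pi>\<^sub>k *v c"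
    using cd by (simp add: append_cols_mv mv_zero add_zero_vec)
  moreover have "append_cols \<Pi>\<^sub>k \<Pi>\<^sub>f *v (c @\<^sub>v 0\<^sub>v f) \<in> mat_image (append_cols \<Pi>\<^sub>k \<Pi>\<^sub>f)"
    unfolding mat_image_def using cd by (intro imageI) (auto intro: carrier_vecI)
  ultimately show "\<Pi>\<^sub>k *v c \<in> V_star A B C D" "\<Pi>\<^sub>k *v c \<in> reachable A B"
    unfolding image by auto
qed

lemma Pi_injective:
  assumes c: "c \<in> carrier_vec k" and z: "\<Pi>\<^sub>k *v c = 0\<^sub>v n"
  shows "c = 0\<^sub>v k"
proof -
  have cd: "dim_vec c = k" using c by simp
  have "append_cols \<Pi>\<^sub>k \<Pi>\<^sub>f *v (c @\<^sub>v 0\<^sub>v f) = 0\<^sub>v n"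
    using cd z by (simp add: append_cols_mv mv_zero add_zero_vec)
  then have e: "c @\<^sub>v 0\<^sub>v f = 0\<^sub>v (k + f)" using cd by (intro injective) (auto intro: carrier_vecI)
  show ?thesis
  proof (rule eq_vecI)
    fix i assume "i < dim_vec (0\<^sub>v k :: complex vec)"
    then show "c $ i = 0\<^sub>v k $ i" using arg_cong[OF e, of "\<lambda>v. v $ i"] cd by simp
  qed (use cd in simp)
qed

text \<open>The states \<open>\<Pi>\<^sub>k c\<close> are reached with zero output because \<open>(\<Lambda>\<^sub>k, \<alpha>\<^sub>k)\<close> is controllable and
  \<open>\<Pi>\<^sub>k \<alpha>\<^sub>k = B R\<^sub>0\<close> with \<open>D R\<^sub>0 = 0\<close>.\<close>

lemma Pi_image_C_star:
  assumes c: "c \<in> carrier_vec k"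
  shows "\<Pi>\<^sub>k *v c \<in> C_star A B C D"
proof -
  note CD = vec_subspaceD[OF C_star_subspace]
  let ?S = "{c \<in> carrier_vec k. \<Pi>\<^sub>k *v c \<in> C_star A B C D}"
  have "reachable \<Lambda>\<^sub>k \<alpha>\<^sub>k \<subseteq> ?S"
  proof (rule reachable_induct[OF carriers(3,9)])
    show "vec_subspace k ?S" by (rule vec_subspace_vimage[OF carriers(6) C_star_subspace])
    fix u assume "(u :: complex vec) \<in> carrier_vec r"
    then have u: "dim_vec u = r" by simp
    have "\<Pi>\<^sub>k *v (\<alpha>\<^sub>k *v u) = A *v 0\<^sub>v n + B *v (R\<^sub>0 *v u)"
      using arg_cong[OF solution(1), of "\<lambda>X. X *v u"] u by (simp add: mv_zero mat_mult_mv)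
    moreover have "C *v 0\<^sub>v n + D *v (R\<^sub>0 *v u) = 0\<^sub>v p"
      using arg_cong[OF solution(2), of "\<lambda>X. X *v u"] u by (simp add: mv_zero mat_mult_mv zero_mv)
    ultimately show "\<alpha>\<^sub>k *v u \<in> ?S" using C_star_step[OF CD(2), of "R\<^sub>0 *v u"] by simp
  next
    fix x assume x: "x \<in> ?S"
    then have xk: "dim_vec x = k" by auto
    have "\<Pi>\<^sub>k *v (\<Lambda>\<^sub>k *v x) = A *v (\<Pi>\<^sub>k *v x) + B *v (H\<^sub>k *v x)"
      using arg_cong[OF state_k, of "\<lambda>X. X *v x"] xk by (simp add: mv_simps)
    moreover have "C *v (\<Pi>\<^sub>k *v x) + D *v (H\<^sub>k *v x) = 0\<^sub>v p"
      using arg_cong[OF out_k, of "\<lambda>X. X *v x"] xk by (simp add: mv_simps)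
    ultimately show "\<Lambda>\<^sub>k *v x \<in> ?S" using C_star_step[of "\<Pi>\<^sub>k *v x" "H\<^sub>k *v x"] x by simp
  qed
  then show ?thesis using ctrl c by (auto simp: controllable_def)
qed

lemma input_split:
  assumes u: "u \<in> carrier_vec q"
  shows "B *v u = \<Pi>\<^sub>k *v (\<alpha>\<^sub>k *v (adj R\<^sub>0 *v u)) + B *v (L\<^sub>0 *v (adj L\<^sub>0 *v u))"
    and "D *v u = D *v (L\<^sub>0 *v (adj L\<^sub>0 *v u))"
proof -
  have uq: "dim_vec u = q" using u by simp
  have split: "u = R\<^sub>0 *v (adj R\<^sub>0 *v u) + L\<^sub>0 *v (adj L\<^sub>0 *v u)"
    using arg_cong[OF complete, of "\<lambda>X. X *v u"] uq by (simp add: mv_simps)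
  have R: "B *v (R\<^sub>0 *v a) = \<Pi>\<^sub>k *v (\<alpha>\<^sub>k *v a)" "D *v (R\<^sub>0 *v a) = 0\<^sub>v p" if "dim_vec a = r" for a
    using arg_cong[OF solution(1), of "\<lambda>X. X *v a"] arg_cong[OF solution(2), of "\<lambda>X. X *v a"] that
    by (simp_all add: mat_mult_mv zero_mv)
  have "B *v u = B *v (R\<^sub>0 *v (adj R\<^sub>0 *v u) + L\<^sub>0 *v (adj L\<^sub>0 *v u))"
    "D *v u = D *v (R\<^sub>0 *v (adj R\<^sub>0 *v u) + L\<^sub>0 *v (adj L\<^sub>0 *v u))"
    using split by simp_all
  then show "B *v u = \<Pi>\<^sub>k *v (\<alpha>\<^sub>k *v (adj R\<^sub>0 *v u)) + B *v (L\<^sub>0 *v (adj L\<^sub>0 *v u))"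
    and "D *v u = D *v (L\<^sub>0 *v (adj L\<^sub>0 *v u))"
    by (simp_all add: mv_add R)
qed

text \<open>The coordinates of the state by which \<open>B\<^sub>r\<close> differs from \<open>B L\<^sub>0\<close>.\<close>

definition correction where "correction w = S *v (adj N *v (L\<^sub>0 *v w))"

lemma correction_dim [simp]: "dim_vec (correction w) = k"
  by (simp add: correction_def)

lemma reduced_input:
  assumes "w \<in> carrier_vec l"
  shows "B\<^sub>r *v w = B *v (L\<^sub>0 *v w) + \<Pi>\<^sub>k *v correction w" "D\<^sub>r *v w = D *v (L\<^sub>0 *v w)"
  using assms unfolding B\<^sub>r_eq D\<^sub>r_def correction_def by (simp_all add: mv_simps)

text \<open>An input of one system becomes an input of the other at the price of a state \<open>\<Pi>\<^sub>k c\<close>. One inclusion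
  holds because these states lie in \<open>\<V>\<^sup>*\<close>, the other because adding them to the subspace of the reduced
  system gives a weakly invariant subspace of the original one.\<close>

theorem V_star_reduced: "V_star A B\<^sub>r C D\<^sub>r = V_star A B C D"
proof
  note V = V_star_subspace and VD = vec_subspaceD[OF V_star_subspace]
  have "reduced.weakly_invariant (V_star A B C D)"
    unfolding reduced.weakly_invariant_def
  proof (intro conjI ballI V)
    fix v assume v: "v \<in> V_star A B C D"
    have vn: "dim_vec v = n" using VD(5)[OF v] by simp
    obtain u where u: "u \<in> carrier_vec q" "A *v v + B *v u \<in> V_star A B C D" "C *v v + D *v u = 0\<^sub>v p"
      using V_star_step[OF v] by blast
    let ?w = "adj L\<^sub>0 *v u" and ?a = "\<alpha>\<^sub>k *v (adj R\<^sub>0 *v u)"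
    have w: "?w \<in> carrier_vec l" by simp
    have "A *v v + B\<^sub>r *v ?w = (A *v v + B *v u) + \<Pi>\<^sub>k *v (correction ?w - ?a)"
      unfolding reduced_input(1)[OF w] input_split(1)[OF u(1)]
      by (intro eq_vecI) (simp_all add: mv_diff del: index_mult_mat_vec)
    also have "\<dots> \<in> V_star A B C D"
      by (intro VD(3) u(2) Pi_image) (auto intro: carrier_vecI)
    finally show "\<exists>w\<in>carrier_vec l. A *v v + B\<^sub>r *v w \<in> V_star A B C D \<and> C *v v + D\<^sub>r *v w = 0\<^sub>v p"
      using w u(3) unfolding input_split(2)[OF u(1)] reduced_input(2)[OF w, symmetric] by blast
  qed
  then show "V_star A B C D \<subseteq> V_star A B\<^sub>r C D\<^sub>r" by (rule reduced.V_star_greatest(2))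
  let ?V = "V_star A B\<^sub>r C D\<^sub>r" and ?W = "V_star A B\<^sub>r C D\<^sub>r + mat_image \<Pi>\<^sub>k"
  note RD = vec_subspaceD[OF reduced.V_star_subspace]
  have "weakly_invariant ?W"
    unfolding weakly_invariant_def
  proof (intro conjI ballI)
    show "vec_subspace n ?W"
      by (rule vec_subspace_sum[OF reduced.V_star_subspace vec_subspace_mat_image[OF carriers(6)]])
    fix x assume "x \<in> ?W"
    then obtain v c where x: "x = v + \<Pi>\<^sub>k *v c" and v: "v \<in> ?V" and c: "c \<in> carrier_vec k"
      by (auto simp: mat_image_def elim!: set_plus_elim)
    have vn: "dim_vec v = n" and ck: "dim_vec c = k" using RD(5)[OF v] c by simp_all
    obtain w where w: "w \<in> carrier_vec l" "A *v v + B\<^sub>r *v w \<in> ?V" "C *v v + D\<^sub>r *v w = 0\<^sub>v p"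
      using reduced.V_star_step[OF v] by blast
    let ?u = "L\<^sub>0 *v w + H\<^sub>k *v c"
    have wl: "dim_vec w = l" using w(1) by simp
    have Ac: "\<Pi>\<^sub>k *v (\<Lambda>\<^sub>k *v c) = A *v (\<Pi>\<^sub>k *v c) + B *v (H\<^sub>k *v c)"
      using arg_cong[OF state_k, of "\<lambda>X. X *v c"] ck by (simp add: mv_simps)
    have Cc: "C *v (\<Pi>\<^sub>k *v c) + D *v (H\<^sub>k *v c) = 0\<^sub>v p"
      using arg_cong[OF out_k, of "\<lambda>X. X *v c"] ck by (simp add: mv_simps)
    have "A *v x + B *v ?u = (A *v v + B\<^sub>r *v w) + \<Pi>\<^sub>k *v (\<Lambda>\<^sub>k *v c - correction w)"
      unfolding reduced_input(1)[OF w(1)] x using vn ck wl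
      by (intro eq_vecI) (simp_all add: mv_add mv_diff Ac del: index_mult_mat_vec)
    also have "\<dots> \<in> ?W"
      using w(2) by (intro set_plus_intro) (auto simp: mat_image_def intro!: imageI carrier_vecI)
    finally have 1: "A *v x + B *v ?u \<in> ?W" .
    have "C *v x + D *v ?u = (C *v v + D\<^sub>r *v w) + (C *v (\<Pi>\<^sub>k *v c) + D *v (H\<^sub>k *v c))"
      unfolding reduced_input(2)[OF w(1)] x using vn ck wl
      by (intro eq_vecI) (simp_all add: mv_add del: index_mult_mat_vec)
    then have "C *v x + D *v ?u = 0\<^sub>v p" using w(3) Cc by simp
    then show "\<exists>u\<in>carrier_vec q. A *v x + B *v u \<in> ?W \<and> C *v x + D *v u = 0\<^sub>v p"
      using 1 by (intro bexI[of _ ?u]) simp_all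
  qed
  then have W: "?W \<subseteq> V_star A B C D" by (rule V_star_greatest(2))
  show "?V \<subseteq> V_star A B C D"
  proof
    fix v assume v: "v \<in> ?V"
    have "v + 0\<^sub>v n \<in> ?W"
      by (rule set_plus_intro[OF v vec_subspaceD(2)[OF vec_subspace_mat_image[OF carriers(6)]]])
    then show "v \<in> V_star A B C D" using W RD(5)[OF v] by (auto simp: add_zero_vec)
  qed
qed

text \<open>An input of the reduced system that moves the zero state into \<open>\<V>\<^sup>*\<close> without output comes from a
  solution of \<open>B R = \<Pi> \<alpha>\<close>, \<open>D R = 0\<close>, hence from the image of \<open>R\<^sub>0\<close>, to which \<open>L\<^sub>0\<close> is orthogonal.\<close>

lemma reduced_no_jump:
  assumes w: "w \<in> carrier_vec l" and Bw: "B\<^sub>r *v w \<in> V_star A B\<^sub>r C D\<^sub>r" and Dw: "D\<^sub>r *v w = 0\<^sub>v p"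
  shows "w = 0\<^sub>v l"
proof -
  have wl: "dim_vec w = l" using w by simp
  have "B *v (L\<^sub>0 *v w) = B\<^sub>r *v w - \<Pi>\<^sub>k *v correction w"
    unfolding reduced_input(1)[OF w] by (intro eq_vecI) (simp_all del: index_mult_mat_vec)
  also have "\<dots> \<in> V_star A B C D"
    using Bw unfolding V_star_reduced
    by (intro vec_subspace_diff[OF V_star_subspace] Pi_image) (auto intro: carrier_vecI)
  finally have "L\<^sub>0 *v w \<in> mat_image R\<^sub>0"
    using Dw unfolding reduced_input(2)[OF w] by (intro maximal) simp_all
  then obtain b where "b \<in> carrier_vec r" and b2: "L\<^sub>0 *v w = R\<^sub>0 *v b" by (auto simp: mat_image_def)
  then have b: "dim_vec b = r" by simp
  have "w = (adj L\<^sub>0 * L\<^sub>0) *v w" using wl by (simp add: L_orthonormal one_mv)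
  also have "\<dots> = adj L\<^sub>0 *v (R\<^sub>0 *v b)" using wl b2 by (simp add: mat_mult_mv)
  also have "\<dots> = adj (adj R\<^sub>0 * L\<^sub>0) *v b" using b by (simp add: mat_adjoint_mult mat_mult_mv)
  also have "\<dots> = 0\<^sub>v l" using b by (simp add: RL_orthogonal zero_mv)
  finally show ?thesis .
qed

text \<open>By backward invariance all states of a trajectory that ends in \<open>\<V>\<^sup>*\<close> with zero output lie in
  \<open>\<V>\<^sup>*\<close>, so it cannot leave the zero state.\<close>

theorem V_star_C_star_reduced: "V_star A B\<^sub>r C D\<^sub>r \<inter> C_star A B\<^sub>r C D\<^sub>r = {0\<^sub>v n}"
proof -
  have "x = 0\<^sub>v n" if "x \<in> C_star A B\<^sub>r C D\<^sub>r" "x \<in> V_star A B\<^sub>r C D\<^sub>r" for x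
    using that
  proof (induction rule: reduced.C_star_induct)
    case (step x u)
    have "x \<in> carrier_vec n" using step.hyps(1) vec_subspaceD(5)[OF reduced.C_star_subspace] by blast
    then have x: "x = 0\<^sub>v n"
      using step.IH reduced.V_star_backward[OF _ step.hyps(2) step.prems step.hyps(3)] by blast
    then have "B\<^sub>r *v u \<in> V_star A B\<^sub>r C D\<^sub>r" "D\<^sub>r *v u = 0\<^sub>v p"
      using step.prems step.hyps(3) by (simp_all add: mv_zero)
    then have "u = 0\<^sub>v l" using step.hyps(2) reduced_no_jump by blast
    with x show ?case by (simp add: mv_zero)
  qed simp
  then show ?thesis
    using vec_subspaceD(2)[OF reduced.V_star_subspace] vec_subspaceD(2)[OF reduced.C_star_subspace] by blast
qed

lemma C_star_reduced_subset: "C_star A B\<^sub>r C D\<^sub>r \<subseteq> C_star A B C D"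
proof
  note CD = vec_subspaceD[OF C_star_subspace]
  fix x assume "x \<in> C_star A B\<^sub>r C D\<^sub>r"
  then show "x \<in> C_star A B C D"
  proof (induction rule: reduced.C_star_induct)
    case (step x w)
    have "A *v x + B\<^sub>r *v w = (A *v x + B *v (L\<^sub>0 *v w)) + \<Pi>\<^sub>k *v correction w"
      unfolding reduced_input(1)[OF step.hyps(2)] by (intro eq_vecI) (simp_all del: index_mult_mat_vec)
    also have "\<dots> \<in> C_star A B C D"
      using step.IH step.hyps(3) unfolding reduced_input(2)[OF step.hyps(2)]
      by (intro CD(3) C_star_step Pi_image_C_star) (simp_all add: correction_def)
    finally show ?case .
  qed (rule CD(2))
qed

text \<open>Along a trajectory the component in \<open>\<V>\<^sup>* \<inter> \<C>\<^sup>*\<close> is steered within \<open>\<V>\<^sup>*\<close>; the remaining input acts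
  on the other component like an input of the reduced system, up to states \<open>\<Pi>\<^sub>k c\<close> that go to the first
  component.\<close>

theorem C_star_decomposition:
  "(V_star A B C D \<inter> C_star A B C D) + C_star A B\<^sub>r C D\<^sub>r = C_star A B C D"
proof
  note CD = vec_subspaceD[OF C_star_subspace] and VD = vec_subspaceD[OF V_star_subspace]
    and RD = vec_subspaceD[OF reduced.C_star_subspace]
  show "(V_star A B C D \<inter> C_star A B C D) + C_star A B\<^sub>r C D\<^sub>r \<subseteq> C_star A B C D"
    using C_star_reduced_subset CD(3) by (auto elim!: set_plus_elim)
  show "C_star A B C D \<subseteq> (V_star A B C D \<inter> C_star A B C D) + C_star A B\<^sub>r C D\<^sub>r"
  proof
    fix x assume "x \<in> C_star A B C D"
    then show "x \<in> (V_star A B C D \<inter> C_star A B C D) + C_star A B\<^sub>r C D\<^sub>r"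
    proof (induction rule: C_star_induct)
      case zero
      have "0\<^sub>v n + 0\<^sub>v n \<in> (V_star A B C D \<inter> C_star A B C D) + C_star A B\<^sub>r C D\<^sub>r"
        using CD(2) VD(2) RD(2) by (intro set_plus_intro) auto
      then show ?case by simp
    next
      case (step x u)
      from step.IH obtain v y where x: "x = v + y" and v: "v \<in> V_star A B C D" "v \<in> C_star A B C D"
        and y: "y \<in> C_star A B\<^sub>r C D\<^sub>r" by (auto elim!: set_plus_elim)
      have d: "dim_vec v = n" "dim_vec y = n" using VD(5)[OF v(1)] RD(5)[OF y] by simp_all
      obtain a where a: "a \<in> carrier_vec q" "A *v v + B *v a \<in> V_star A B C D" "C *v v + D *v a = 0\<^sub>v p"
        using V_star_step[OF v(1)] by blast
      let ?u = "u - a"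
      have u: "?u \<in> carrier_vec q" "dim_vec u = q" "dim_vec a = q" using step.hyps(2) a(1) by simp_all
      let ?w = "adj L\<^sub>0 *v ?u" and ?b = "\<alpha>\<^sub>k *v (adj R\<^sub>0 *v ?u)"
      have w: "?w \<in> carrier_vec l" by simp
      have Du: "D *v u = D *v a + D *v ?u" and Bu: "B *v u = B *v a + B *v ?u"
        using u by (intro eq_vecI; simp add: mv_diff del: index_mult_mat_vec)+
      have "C *v x + D *v u = (C *v v + D *v a) + (C *v y + D\<^sub>r *v ?w)"
        unfolding x Du input_split(2)[OF u(1)] reduced_input(2)[OF w] using d
        by (intro eq_vecI) (simp_all add: mv_add del: index_mult_mat_vec)
      then have "C *v y + D\<^sub>r *v ?w = 0\<^sub>v p" using step.hyps(3) a(3) by simp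
      then have 1: "A *v y + B\<^sub>r *v ?w \<in> C_star A B\<^sub>r C D\<^sub>r" by (rule reduced.C_star_step[OF y w])
      have cl: "?b - correction ?w \<in> carrier_vec k" by (intro carrier_vecI) simp
      have P: "\<Pi>\<^sub>k *v (?b - correction ?w) \<in> V_star A B C D \<inter> C_star A B C D"
        using Pi_image(1)[OF cl] Pi_image_C_star[OF cl] by blast
      have "A *v v + B *v a \<in> V_star A B C D \<inter> C_star A B C D"
        using a C_star_step[OF v(2)] by blast
      with P have 2: "(A *v v + B *v a) + \<Pi>\<^sub>k *v (?b - correction ?w) \<in> V_star A B C D \<inter> C_star A B C D"
        using VD(3) CD(3) by blast
      have "A *v x + B *v u =
        ((A *v v + B *v a) + \<Pi>\<^sub>k *v (?b - correction ?w)) + (A *v y + B\<^sub>r *v ?w)"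
        unfolding x Bu input_split(1)[OF u(1)] reduced_input(1)[OF w] using d
        by (intro eq_vecI) (simp_all add: mv_add mv_diff[of _ "\<Pi>\<^sub>k"] del: index_mult_mat_vec)
      then show ?case using set_plus_intro[OF 2 1] by simp
    qed
  qed
qed

lemma kernel_reduced: "mat_kernel reduced.F = {0\<^sub>v l}"
  by (rule reduced.kernel_trivial) (rule reduced_no_jump)

theorem W_ker_reduced: "W_ker reduced.F = {0\<^sub>v l +o sp_kernel reduced.F}"
proof -
  have "pi_minus (0\<^sub>v l) = 0\<^sub>v l" by (intro eq_vecI) (auto simp: pi_minus_def)
  then show ?thesis by (simp add: W_ker_def quotient_space_def kernel_reduced)
qed

section \<open>Reachability\<close>

theorem reachable_reduced_subset: "reachable A B\<^sub>r \<subseteq> reachable A B"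
proof (rule reachable_induct[OF A derived_carriers(3) reachable_subspace[OF A B]])
  fix w assume w: "(w :: complex vec) \<in> carrier_vec l"
  show "B\<^sub>r *v w \<in> reachable A B"
    unfolding reduced_input(1)[OF w]
    by (intro vec_subspaceD(3)[OF reachable_subspace[OF A B]] reachable_input[OF A B] Pi_image)
      (auto intro: carrier_vecI)
qed (rule reachable_invariant[OF A B])

text \<open>The Lyapunov equation puts the eigenvalues of \<open>\<Lambda>\<^sub>\<beta>\<close> into the closed left half plane. An
  eigenvector for a purely imaginary one would be annihilated by \<open>N\<close>, and then \<open>\<Pi>\<^sub>k\<close> would map it to
  an unobservable eigenvector of \<open>A\<close>.\<close>

lemma \<Lambda>\<^sub>\<beta>_stable:
  assumes "eigenvalue \<Lambda>\<^sub>\<beta> s"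
  shows "Re s < 0"
proof -
  obtain v where v: "v \<in> carrier_vec k" "v \<noteq> 0\<^sub>v k" "\<Lambda>\<^sub>\<beta> *v v = s *s v"
    using assms unfolding eigenvalue_def eigenvector_def by auto
  have vk: "dim_vec v = k" using v(1) by simp
  define X where "X = (\<sigma> *v v) \<bullet>c v"
  define Y where "Y = (N *v v) \<bullet>c (N *v v)"
  have X: "0 < Re X" using pos_def v by (simp add: pos_def_mat_def X_def)
  have "(\<sigma> * \<Lambda>\<^sub>\<beta> + adj \<Lambda>\<^sub>\<beta> * \<sigma> + adj N * N) *v v = 0\<^sub>v k"
    unfolding lyapunov using vk by (simp add: zero_mv)
  then have e: "s *s (\<sigma> *v v) + adj \<Lambda>\<^sub>\<beta> *v (\<sigma> *v v) + adj N *v (N *v v) = 0\<^sub>v k"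
    using vk v(3) by (simp add: mv_simps)
  have add3: "(a + b + c) \<bullet>c v = a \<bullet>c v + b \<bullet>c v + c \<bullet>c v"
    if "dim_vec a = k" "dim_vec b = k" "dim_vec c = k" for a b c
    using that vk by (simp add: scalar_prod_def sum.distrib distrib_right)
  have "(s *s (\<sigma> *v v) + adj \<Lambda>\<^sub>\<beta> *v (\<sigma> *v v) + adj N *v (N *v v)) \<bullet>c v = 0"
    unfolding e using vk by (simp add: scalar_prod_def)
  then have "(s *s (\<sigma> *v v)) \<bullet>c v + (adj \<Lambda>\<^sub>\<beta> *v (\<sigma> *v v)) \<bullet>c v + (adj N *v (N *v v)) \<bullet>c v = 0"
    by (subst (asm) add3) simp_all
  moreover have "(adj \<Lambda>\<^sub>\<beta> *v (\<sigma> *v v)) \<bullet>c v = cnj s * X"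
    using cscalar_prod_adjoint[of "\<sigma> *v v" "adj \<Lambda>\<^sub>\<beta>" v] v vk
    by (simp add: X_def conjugate_smult_vec)
  moreover have "(adj N *v (N *v v)) \<bullet>c v = Y"
    using cscalar_prod_adjoint[of "N *v v" "adj N" v] v vk by (simp add: Y_def)
  ultimately have "s * X + cnj s * X + Y = 0" using vk by (simp add: X_def)
  then have "Re (s * X + cnj s * X + Y) = 0" by simp
  then have eq: "2 * Re s * Re X + Re Y = 0" by (simp add: algebra_simps)
  have Y: "0 < Re Y" if "N *v v \<noteq> 0\<^sub>v q"
    using conjugate_square_greater_0_vec[of "N *v v" q] that by (simp add: Y_def less_complex_def)
  have N0: "N *v v \<noteq> 0\<^sub>v q"
  proof
    assume Nv: "N *v v = 0\<^sub>v q"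
    let ?x = "\<Pi>\<^sub>k *v v"
    have Ax: "A *v ?x = s *s ?x"
      using arg_cong[OF state_N, of "\<lambda>X. X *v v"] vk v(3) Nv by (simp add: mv_simps add_zero_vec)
    have Cx: "C *v ?x = 0\<^sub>v p"
      using arg_cong[OF out_N, of "\<lambda>X. X *v v"] vk Nv by (simp add: mv_simps add_zero_vec)
    have "A ^\<^sub>m j *v ?x = s ^ j *s ?x" for j
    proof (induction j)
      case 0
      then show ?case by (simp add: one_mv)
    next
      case (Suc j)
      have "A ^\<^sub>m Suc j *v ?x = A *v (A ^\<^sub>m j *v ?x)" by (rule pow_mat_Suc_mv[OF A]) simp
      then show ?case by (simp add: Suc mv_simps Ax smult_smult_assoc mult.commute del: pow_mat.simps)
    qed
    then have "C *v (A ^\<^sub>m j *v ?x) = 0\<^sub>v p" for j by (simp add: mv_smult Cx smult_zero_vec_right)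
    then have "?x \<in> (\<Inter>j. mat_kernel (C * A ^\<^sub>m j))"
      using pow_carrier_mat[OF A] by (auto simp: mat_kernel_def mat_mult_mv)
    then have "?x = 0\<^sub>v n" using obs unfolding observable_def dims by blast
    then show False using Pi_injective[OF v(1)] v(2) by simp
  qed
  show ?thesis
  proof (rule ccontr)
    assume "\<not> Re s < 0"
    then have "0 \<le> Re s * Re X" using X by (intro mult_nonneg_nonneg) simp_all
    then show False using eq Y[OF N0] by linarith
  qed
qed

definition W where "W = {y \<in> carrier_vec n. \<forall>x\<in>reachable A B\<^sub>r. y \<bullet> x = 0}"

lemma W_dim: "y \<in> W \<Longrightarrow> dim_vec y = n"
  by (simp add: W_def)

lemma W_subspace: "vec_subspace n W"
proof -
  have d: "x \<in> carrier_vec n" if "x \<in> reachable A B\<^sub>r" for x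
    using vec_subspaceD(5)[OF reachable_subspace[OF A derived_carriers(3)] that] .
  then show ?thesis
    unfolding vec_subspace_iff W_def by (auto simp: add_scalar_prod_distrib[of _ n])
qed

lemma W_invariant:
  assumes y: "y \<in> W"
  shows "A\<^sup>T *v y \<in> W"
  unfolding W_def
proof (intro CollectI conjI ballI)
  show "A\<^sup>T *v y \<in> carrier_vec n" by simp
  fix x assume x: "x \<in> reachable A B\<^sub>r"
  have "(A\<^sup>T *v y) \<bullet> x = y \<bullet> (A *v x)"
    using y x vec_subspaceD(5)[OF reachable_subspace[OF A derived_carriers(3)] x]
    by (intro transpose_vec_mult_scalar[OF A]) (auto simp: W_def)
  also have "\<dots> = 0" using reachable_invariant[OF A derived_carriers(3) x] y by (simp add: W_def)
  finally show "(A\<^sup>T *v y) \<bullet> x = 0" .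
qed

lemma W_annihilates:
  assumes y: "y \<in> W"
  shows "B\<^sub>r\<^sup>T *v y = 0\<^sub>v l"
proof (rule eq_vecI)
  fix i assume "i < dim_vec (0\<^sub>v l :: complex vec)"
  then have i: "i < l" by simp
  have "(B\<^sub>r\<^sup>T *v y) \<bullet> unit_vec l i = y \<bullet> (B\<^sub>r *v unit_vec l i)"
    using W_dim[OF y] by (intro transpose_vec_mult_scalar[OF derived_carriers(3)]) (auto intro: carrier_vecI)
  also have "\<dots> = 0"
    using reachable_input[OF A derived_carriers(3), of "unit_vec l i"] y by (simp add: W_def)
  finally show "(B\<^sub>r\<^sup>T *v y) $ i = 0\<^sub>v l $ i"
    using i by (simp del: index_mult_mat_vec)
qed simp

lemma W_intertwines:
  assumes Z: "Z \<in> carrier_mat n m" and Y: "Y \<in> carrier_mat m m" and G: "G \<in> carrier_mat l m"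
    and eq: "A * Z + Z * Y + B\<^sub>r * G = 0\<^sub>m n m" and y: "y \<in> W"
  shows "Z\<^sup>T *v (A\<^sup>T *v y) = - Y\<^sup>T *v (Z\<^sup>T *v y)"
proof -
  note [simp] = carrier_matD[OF Z] carrier_matD[OF Y] carrier_matD[OF G] W_dim[OF y]
  have "(A * Z + Z * Y + B\<^sub>r * G)\<^sup>T *v y = 0\<^sub>v m" unfolding eq by (simp add: zero_mv)
  then have "Z\<^sup>T *v (A\<^sup>T *v y) + Y\<^sup>T *v (Z\<^sup>T *v y) = 0\<^sub>v m"
    by (simp add: transpose_simps mv_simps W_annihilates[OF y] add_zero_vec)
  then show ?thesis
    by (auto simp: vec_eq_iff eq_neg_iff_add_eq_0 simp del: index_mult_mat_vec)
qed

lemma W_input: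
  assumes y: "y \<in> W"
  shows "B\<^sup>T *v y = - ((adj N)\<^sup>T *v ((\<Pi>\<^sub>k * S)\<^sup>T *v y))"
proof -
  note [simp] = W_dim[OF y]
  have "(B\<^sub>r * adj L\<^sub>0)\<^sup>T *v y = 0\<^sub>v q"
    by (simp add: transpose_simps mat_mult_mv W_annihilates[OF y] mv_zero)
  then have "B\<^sup>T *v y + (adj N)\<^sup>T *v ((\<Pi>\<^sub>k * S)\<^sup>T *v y) = 0\<^sub>v q"
    unfolding B\<^sub>r_L_adjoint by (simp add: transpose_simps mv_simps)
  then show ?thesis
    by (auto simp: vec_eq_iff eq_neg_iff_add_eq_0 simp del: index_mult_mat_vec)
qed

lemma intertwined_eigenvalue:
  assumes "eigenvalue (- (adj \<Lambda>\<^sub>\<beta>)\<^sup>T) s"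
  shows "0 < Re s"
proof -
  have c: "adj \<Lambda>\<^sub>\<beta> \<in> carrier_mat k k" using derived_carriers(2) by simp
  then have ct: "(adj \<Lambda>\<^sub>\<beta>)\<^sup>T \<in> carrier_mat k k" by simp
  have "eigenvalue (adj \<Lambda>\<^sub>\<beta>) (- s)"
    using assms eigenvalue_uminus[OF ct] eigenvalue_transpose[OF c] by simp
  then have "eigenvalue \<Lambda>\<^sub>\<beta> (cnj (- s))" by (rule eigenvalue_adjoint[OF derived_carriers(2)])
  then show ?thesis using \<Lambda>\<^sub>\<beta>_stable by fastforce
qed

text \<open>The map \<open>(\<Pi>\<^sub>k \<sigma>\<^sup>-\<^sup>1)\<^sup>T\<close> intertwines the transpose of \<open>A\<close> on \<open>W\<close> with a matrix whose eigenvalues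
  have positive real part. If \<open>A\<^sup>T\<close> acts on \<open>W\<close> like a matrix without such eigenvalues, this map
  vanishes on \<open>W\<close>, and then the elements of \<open>W\<close> annihilate \<open>B\<close> together with \<open>B\<^sub>r\<close>.\<close>

lemma reachable_eq_if_stable_action:
  assumes M: "M \<in> carrier_mat n n" and act: "\<And>y. y \<in> W \<Longrightarrow> M *v y = A\<^sup>T *v y"
    and stable: "\<And>s. eigenvalue M s \<Longrightarrow> Re s \<le> 0"
  shows "reachable A B = reachable A B\<^sub>r"
proof
  let ?Z = "\<Pi>\<^sub>k * S" and ?N = "- (adj \<Lambda>\<^sub>\<beta>)\<^sup>T"
  have c: "?Z \<in> carrier_mat n k" "adj \<Lambda>\<^sub>\<beta> \<in> carrier_mat k k"
    "adj L\<^sub>0 * (N * S) \<in> carrier_mat l k"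
    by (intro carrier_matI; simp)+
  have eq: "A * ?Z + ?Z * adj \<Lambda>\<^sub>\<beta> + B\<^sub>r * (adj L\<^sub>0 * (N * S)) = 0\<^sub>m n k"
    using closed_loop_adjoint by (simp add: mm_assoc)
  have vanish: "?Z\<^sup>T *v y = 0\<^sub>v k" if y: "y \<in> W" for y
  proof (rule intertwiner_vanishes[OF M _ _ W_subspace _ _ _ y])
    show "?N \<in> carrier_mat k k" "?Z\<^sup>T \<in> carrier_mat k n" by (intro carrier_matI; simp)+
    show "M *v y \<in> W" if "y \<in> W" for y using act[OF that] W_invariant[OF that] by simp
    show "?Z\<^sup>T *v (M *v y) = ?N *v (?Z\<^sup>T *v y)" if "y \<in> W" for y
      unfolding act[OF that] by (rule W_intertwines[OF c eq that])
    show "\<not> eigenvalue ?N s" if "eigenvalue M s" for s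
      using stable[OF that] intertwined_eigenvalue[of s] by auto
  qed
  note RD = vec_subspaceD(5)[OF reachable_subspace[OF A B]]
  let ?S = "{x \<in> carrier_vec n. \<forall>y\<in>W. y \<bullet> x = 0}"
  have Wn: "y \<in> carrier_vec n" if "y \<in> W" for y using that by (simp add: W_def)
  have sub: "reachable A B \<subseteq> ?S"
  proof (rule reachable_induct[OF A B])
    show "vec_subspace n ?S"
      unfolding vec_subspace_iff using Wn by (auto simp: scalar_prod_add_distrib[of _ n])
    fix u assume u: "(u :: complex vec) \<in> carrier_vec q"
    have "y \<bullet> (B *v u) = 0" if y: "y \<in> W" for y
    proof -
      have "B\<^sup>T *v y = 0\<^sub>v q"
        unfolding W_input[OF y] vanish[OF y] by (intro eq_vecI) (simp_all add: mv_zero del: index_mult_mat_vec)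
      then show ?thesis using transpose_vec_mult_scalar[OF B u Wn[OF y]] u by simp
    qed
    then show "B *v u \<in> ?S" by simp
  next
    fix x assume x: "x \<in> ?S"
    have "y \<bullet> (A *v x) = 0" if y: "y \<in> W" for y
      using transpose_vec_mult_scalar[OF A, of x y] x Wn[OF y] W_invariant[OF y] by simp
    then show "A *v x \<in> ?S" by simp
  qed
  show "reachable A B \<subseteq> reachable A B\<^sub>r"
  proof
    fix x assume x: "x \<in> reachable A B"
    show "x \<in> reachable A B\<^sub>r"
    proof (rule ccontr)
      assume "x \<notin> reachable A B\<^sub>r"
      then obtain y where y: "y \<in> carrier_vec n" "\<And>v. v \<in> reachable A B\<^sub>r \<Longrightarrow> y \<bullet> v = 0" "y \<bullet> x \<noteq> 0"
        using separating_functional[OF reachable_subspace[OF A derived_carriers(3)] RD[OF x]] by blast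
      then have "y \<in> W" by (simp add: W_def)
      then show False using sub x y(3) by blast
    qed
  qed
qed (rule reachable_reduced_subset)

theorem reachable_eq_if_semistable:
  assumes "\<And>s. eigenvalue A s \<Longrightarrow> Re s \<le> 0"
  shows "reachable A B = reachable A B\<^sub>r"
  using assms A by (intro reachable_eq_if_stable_action[of "A\<^sup>T"]) (auto simp: eigenvalue_transpose[OF A])

text \<open>By the two Lyapunov equations, \<open>Q = P\<^sup>* + \<Pi>\<^sub>k \<sigma>\<^sup>-\<^sup>1 \<Pi>\<^sub>k\<^sup>*\<close> solves a Sylvester equation that is
  homogeneous up to a multiple of \<open>B\<^sub>r\<close>, so \<open>Q\<^sup>T\<close> vanishes on \<open>W\<close>. Hence \<open>W\<close> is annihilated by the
  transpose of the adjoint of \<open>C P + D B\<^sup>*\<close>, and on \<open>W\<close> a stabilizing feedback through this adjoint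
  changes nothing.\<close>

theorem reachable_eq_if_stabilizable:
  assumes disjoint: "\<And>s. eigenvalue A s \<Longrightarrow> \<not> eigenvalue (- adj A) s"
    and P: "P \<in> carrier_mat n n" and lyap: "A * P + P * adj A + B * adj B = 0\<^sub>m n n"
    and stab: "stabilizable A (adj (C * P + D * adj B))"
  shows "reachable A B = reachable A B\<^sub>r"
proof -
  note [simp] = carrier_matD[OF P]
  let ?E = "adj (C * P + D * adj B)" and ?P = "adj P"
  let ?X = "\<Pi>\<^sub>k * (S * adj \<Pi>\<^sub>k)"
  let ?Q = "?P + ?X" and ?G = "adj L\<^sub>0 * adj B + adj L\<^sub>0 * (N * (S * adj \<Pi>\<^sub>k))"
  have state: "adj \<Lambda>\<^sub>\<beta> * adj \<Pi>\<^sub>k = adj \<Pi>\<^sub>k * adj A + adj N * adj B"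
    using arg_cong[OF state_N, of adj] by (simp add: mat_adjoint_simps)
  have out: "adj \<Pi>\<^sub>k * adj C + adj N * adj D = 0\<^sub>m k p"
    using arg_cong[OF out_N, of adj] by (simp add: mat_adjoint_simps)
  have sylvester: "A * ?Q + ?Q * adj A + B\<^sub>r * ?G = 0\<^sub>m n n"
  proof (rule eq_matI)
    fix i j assume "i < dim_row (0\<^sub>m n n :: complex mat)" "j < dim_col (0\<^sub>m n n :: complex mat)"
    then have ij: "i < n" "j < n" by auto
    have "adj (A * P + P * adj A + B * adj B) $$ (i, j) = 0"
      unfolding lyap using ij by simp
    then have l: "(A * ?P) $$ (i, j) + (?P * adj A) $$ (i, j) + (B * adj B) $$ (i, j) = 0"
      using ij by (simp add: mat_adjoint_simps add_ac del: index_mult_mat(1))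
    have "((A * (\<Pi>\<^sub>k * S) + \<Pi>\<^sub>k * (S * adj \<Lambda>\<^sub>\<beta>) + B\<^sub>r * (adj L\<^sub>0 * (N * S))) * adj \<Pi>\<^sub>k) $$ (i, j) = 0"
      unfolding closed_loop_adjoint using ij by (simp add: mm_zero)
    then have c: "(A * ?X) $$ (i, j) + (\<Pi>\<^sub>k * (S * (adj \<Pi>\<^sub>k * adj A))) $$ (i, j)
       + (\<Pi>\<^sub>k * (S * (adj N * adj B))) $$ (i, j)
       + (B\<^sub>r * (adj L\<^sub>0 * (N * (S * adj \<Pi>\<^sub>k)))) $$ (i, j) = 0"
      using ij by (simp add: mm_simps state add_ac del: index_mult_mat(1))
    have "B\<^sub>r * (adj L\<^sub>0 * adj B) = (B\<^sub>r * adj L\<^sub>0) * adj B" by (simp add: mm_assoc)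
    also have "\<dots> = B * adj B + \<Pi>\<^sub>k * (S * (adj N * adj B))"
      unfolding B\<^sub>r_L_adjoint by (simp add: mm_simps)
    finally have b: "B\<^sub>r * (adj L\<^sub>0 * adj B) = \<dots>" .
    have "(A * ?Q + ?Q * adj A + B\<^sub>r * ?G) $$ (i, j) =
      ((A * ?P) $$ (i, j) + (?P * adj A) $$ (i, j) + (B * adj B) $$ (i, j)) +
      ((A * ?X) $$ (i, j) + (\<Pi>\<^sub>k * (S * (adj \<Pi>\<^sub>k * adj A))) $$ (i, j)
       + (\<Pi>\<^sub>k * (S * (adj N * adj B))) $$ (i, j)
       + (B\<^sub>r * (adj L\<^sub>0 * (N * (S * adj \<Pi>\<^sub>k)))) $$ (i, j))"
      using ij by (simp add: mm_simps b del: index_mult_mat(1))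
    also have "\<dots> = 0" unfolding l c by simp
    finally show "(A * ?Q + ?Q * adj A + B\<^sub>r * ?G) $$ (i, j) = 0\<^sub>m n n $$ (i, j)" using ij by simp
  qed simp_all
  have cl: "?Q \<in> carrier_mat n n" "adj A \<in> carrier_mat n n" "?G \<in> carrier_mat l n"
    by (intro carrier_matI; simp)+
  have QW: "?Q\<^sup>T *v y = 0\<^sub>v n" if y: "y \<in> W" for y
  proof (rule intertwiner_vanishes[OF _ _ _ W_subspace W_invariant W_intertwines[OF cl sylvester] _ y])
    show "A\<^sup>T \<in> carrier_mat n n" "- (adj A)\<^sup>T \<in> carrier_mat n n" "?Q\<^sup>T \<in> carrier_mat n n"
      by (intro carrier_matI; simp)+
    show "\<not> eigenvalue (- (adj A)\<^sup>T) s" if "eigenvalue A\<^sup>T s" for s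
    proof -
      have "(adj A)\<^sup>T \<in> carrier_mat n n" using cl(2) by simp
      then have "eigenvalue (- (adj A)\<^sup>T) s \<longleftrightarrow> eigenvalue (- adj A) s"
        using eigenvalue_uminus cl(2) eigenvalue_transpose[OF cl(2)] by metis
      then show ?thesis using disjoint that eigenvalue_transpose[OF A] by simp
    qed
  qed
  have EW: "?E\<^sup>T *v y = 0\<^sub>v p" if y: "y \<in> W" for y
  proof -
    note [simp] = W_dim[OF y]
    define t where "t = (\<Pi>\<^sub>k * S)\<^sup>T *v y"
    have t [simp]: "dim_vec t = k" by (simp add: t_def)
    have "?P\<^sup>T *v y + (adj \<Pi>\<^sub>k)\<^sup>T *v t = ?Q\<^sup>T *v y"
      by (simp add: t_def transpose_simps mv_simps)
    then have P: "?P\<^sup>T *v y = - ((adj \<Pi>\<^sub>k)\<^sup>T *v t)"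
      unfolding QW[OF y] by (auto simp: vec_eq_iff eq_neg_iff_add_eq_0 simp del: index_mult_mat_vec)
    have "(adj \<Pi>\<^sub>k * adj C + adj N * adj D)\<^sup>T *v t = 0\<^sub>v p"
      unfolding out by (simp add: zero_mv)
    then have o: "(adj C)\<^sup>T *v ((adj \<Pi>\<^sub>k)\<^sup>T *v t) + (adj D)\<^sup>T *v ((adj N)\<^sup>T *v t) = 0\<^sub>v p"
      by (simp add: transpose_simps mv_simps)
    have "?E\<^sup>T *v y = (adj C)\<^sup>T *v (?P\<^sup>T *v y) + (adj D)\<^sup>T *v (B\<^sup>T *v y)"
      by (simp add: mat_adjoint_simps transpose_simps mv_simps)
    also have "\<dots> = - ((adj C)\<^sup>T *v ((adj \<Pi>\<^sub>k)\<^sup>T *v t) + (adj D)\<^sup>T *v ((adj N)\<^sup>T *v t))"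
      unfolding P W_input[OF y] t_def[symmetric]
      by (intro eq_vecI) (simp_all add: mv_uminus del: index_mult_mat_vec)
    also have "\<dots> = 0\<^sub>v p" unfolding o by (intro eq_vecI) simp_all
    finally show ?thesis .
  qed
  obtain K where K: "K \<in> carrier_mat p n" "\<And>s. eigenvalue (A + ?E * K) s \<Longrightarrow> Re s < 0"
    using stab by (auto simp: stabilizable_def)
  note [simp] = carrier_matD[OF K(1)]
  have AK: "A + ?E * K \<in> carrier_mat n n" by (intro carrier_matI) simp_all
  show ?thesis
  proof (rule reachable_eq_if_stable_action[of "(A + ?E * K)\<^sup>T"])
    show "(A + ?E * K)\<^sup>T \<in> carrier_mat n n" using AK by simp
    show "Re s \<le> 0" if "eigenvalue (A + ?E * K)\<^sup>T s" for s
      using K(2)[of s] that eigenvalue_transpose[OF AK] by simp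
    show "(A + ?E * K)\<^sup>T *v y = A\<^sup>T *v y" if y: "y \<in> W" for y
    proof -
      have "(A + ?E * K)\<^sup>T *v y = A\<^sup>T *v y + K\<^sup>T *v (?E\<^sup>T *v y)"
        using W_dim[OF y] by (simp add: transpose_simps mv_simps)
      then show ?thesis using W_dim[OF y] by (simp add: EW[OF y] mv_zero add_zero_vec)
    qed
  qed
qed

section \<open>The finite zero matrix of the reduced system\<close>

text \<open>Since \<open>D L\<^sub>0 L\<^sub>0\<^sup>* = D\<close> and \<open>B\<^sub>r L\<^sub>0\<^sup>* = B + \<Pi>\<^sub>k \<sigma>\<^sup>-\<^sup>1 N\<^sup>*\<close>, the matrix \<open>[\<Pi>\<^sub>k, \<Pi>\<^sub>f]\<close> solves the equations of the
  reduced system for the outputs \<open>L\<^sub>0\<^sup>* [N, H\<^sub>f]\<close>, at the price of adding \<open>\<sigma>\<^sup>-\<^sup>1 N\<^sup>* [N, H\<^sub>f]\<close> to the first block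
  row of the matrix on the right.\<close>

theorem finite_zero_matrix_reduced:
  assumes reach: "reachable A B = reachable A B\<^sub>r"
  shows "finite_zero_matrix A B\<^sub>r C D\<^sub>r M \<longleftrightarrow> similar_mat M
    (four_block_mat (- (S * adj \<Lambda>\<^sub>\<beta> * \<sigma>)) (\<Lambda>\<^sub>k\<^sub>f + S * adj N * H\<^sub>f) (0\<^sub>m f k) \<Lambda>\<^sub>f)"
proof (rule reduced.finite_zero_matrix_iff[OF obs reduced_no_jump])
  let ?P = "append_cols \<Pi>\<^sub>k \<Pi>\<^sub>f" and ?H = "append_cols (adj L\<^sub>0 * N) (adj L\<^sub>0 * H\<^sub>f)"
    and ?X = "- (S * adj \<Lambda>\<^sub>\<beta> * \<sigma>)" and ?Y = "\<Lambda>\<^sub>k\<^sub>f + S * adj N * H\<^sub>f"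
  show "?P \<in> carrier_mat n (k + f)" "?H \<in> carrier_mat l (k + f)"
    "four_block_mat ?X ?Y (0\<^sub>m f k) \<Lambda>\<^sub>f \<in> carrier_mat (k + f) (k + f)"
    by (intro carrier_matI; simp)+
  show "\<And>c. c \<in> carrier_vec (k + f) \<Longrightarrow> ?P *v c = 0\<^sub>v n \<Longrightarrow> c = 0\<^sub>v (k + f)" by (rule injective)
  show "mat_image ?P = V_star A B\<^sub>r C D\<^sub>r \<inter> reachable A B\<^sub>r"
    using image unfolding V_star_reduced reach .
  have LL: "L\<^sub>0 * (adj L\<^sub>0 * Z) = Z - R\<^sub>0 * (adj R\<^sub>0 * Z)" if "dim_row Z = q" for Z
  proof (rule eq_matI)
    fix i j assume ij: "i < dim_row (Z - R\<^sub>0 * (adj R\<^sub>0 * Z))" "j < dim_col (Z - R\<^sub>0 * (adj R\<^sub>0 * Z))"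
    have "(R\<^sub>0 * adj R\<^sub>0 + L\<^sub>0 * adj L\<^sub>0) * Z = Z" unfolding complete using that by (simp add: mm_one)
    from arg_cong[OF this, of "\<lambda>X. X $$ (i, j)"]
    show "(L\<^sub>0 * (adj L\<^sub>0 * Z)) $$ (i, j) = (Z - R\<^sub>0 * (adj R\<^sub>0 * Z)) $$ (i, j)"
      using ij that by (simp add: mm_simps algebra_simps del: index_mult_mat(1))
  qed (use that in simp_all)
  have BL: "B\<^sub>r * (adj L\<^sub>0 * Z) = B * Z + \<Pi>\<^sub>k * (S * (adj N * Z))" if "dim_row Z = q" for Z
  proof -
    have "B\<^sub>r * (adj L\<^sub>0 * Z) = B\<^sub>r * adj L\<^sub>0 * Z" using that by (simp add: mm_assoc)
    then show ?thesis unfolding B\<^sub>r_L_adjoint using that by (simp add: mm_simps)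
  qed
  have DL: "D\<^sub>r * (adj L\<^sub>0 * Z) = D * Z" if "dim_row Z = q" for Z
    unfolding D\<^sub>r_def using that
    by (intro eq_matI) (simp_all add: mm_simps LL products del: index_mult_mat(1))
  have 1: "A * \<Pi>\<^sub>k + B\<^sub>r * (adj L\<^sub>0 * N) = \<Pi>\<^sub>k * ?X"
  proof (rule eq_matI)
    fix i j assume "i < dim_row (\<Pi>\<^sub>k * ?X)" "j < dim_col (\<Pi>\<^sub>k * ?X)"
    then have ij: "i < n" "j < k" by auto
    have "((A * (\<Pi>\<^sub>k * S) + \<Pi>\<^sub>k * (S * adj \<Lambda>\<^sub>\<beta>) + B\<^sub>r * (adj L\<^sub>0 * (N * S))) * \<sigma>) $$ (i, j) = 0"
      unfolding closed_loop_adjoint using ij by (simp add: mm_zero)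
    then have "(A * \<Pi>\<^sub>k) $$ (i, j) + (\<Pi>\<^sub>k * (S * (adj \<Lambda>\<^sub>\<beta> * \<sigma>))) $$ (i, j)
        + (B\<^sub>r * (adj L\<^sub>0 * N)) $$ (i, j) = 0"
      using ij by (simp add: mm_simps S(3) del: index_mult_mat(1))
    then show "(A * \<Pi>\<^sub>k + B\<^sub>r * (adj L\<^sub>0 * N)) $$ (i, j) = (\<Pi>\<^sub>k * ?X) $$ (i, j)"
      using ij by (simp add: mm_assoc uminus_mult_right_mat eq_neg_iff_add_eq_0 add_ac del: index_mult_mat(1))
  qed simp_all
  have 2: "A * \<Pi>\<^sub>f + B\<^sub>r * (adj L\<^sub>0 * H\<^sub>f) = \<Pi>\<^sub>k * ?Y + \<Pi>\<^sub>f * \<Lambda>\<^sub>f"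
  proof (rule eq_matI)
    fix i j assume "i < dim_row (\<Pi>\<^sub>k * ?Y + \<Pi>\<^sub>f * \<Lambda>\<^sub>f)" "j < dim_col (\<Pi>\<^sub>k * ?Y + \<Pi>\<^sub>f * \<Lambda>\<^sub>f)"
    then have ij: "i < n" "j < f" by auto
    have "(A * \<Pi>\<^sub>f + B * H\<^sub>f) $$ (i, j) = (\<Pi>\<^sub>k * \<Lambda>\<^sub>k\<^sub>f + \<Pi>\<^sub>f * \<Lambda>\<^sub>f) $$ (i, j)" unfolding state_f ..
    then show "(A * \<Pi>\<^sub>f + B\<^sub>r * (adj L\<^sub>0 * H\<^sub>f)) $$ (i, j) = (\<Pi>\<^sub>k * ?Y + \<Pi>\<^sub>f * \<Lambda>\<^sub>f) $$ (i, j)"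
      using ij by (simp add: BL mm_simps algebra_simps del: index_mult_mat(1))
  qed simp_all
  have "A * ?P + B\<^sub>r * ?H = append_cols (\<Pi>\<^sub>k * ?X) (\<Pi>\<^sub>k * ?Y + \<Pi>\<^sub>f * \<Lambda>\<^sub>f)"
    by (simp add: mult_append_cols append_cols_add 1 2)
  also have "\<dots> = append_cols (\<Pi>\<^sub>k * ?X + \<Pi>\<^sub>f * 0\<^sub>m f k) (\<Pi>\<^sub>k * ?Y + \<Pi>\<^sub>f * \<Lambda>\<^sub>f)"
    by (simp add: mm_zero mm_add_zero)
  also have "\<dots> = ?P * four_block_mat ?X ?Y (0\<^sub>m f k) \<Lambda>\<^sub>f"
    by (rule append_cols_mult_block[symmetric, of _ n k _ f]) (auto intro!: carrier_matI)
  finally show "A * ?P + B\<^sub>r * ?H = ?P * four_block_mat ?X ?Y (0\<^sub>m f k) \<Lambda>\<^sub>f" .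
  have "C * ?P + D\<^sub>r * ?H = append_cols (C * \<Pi>\<^sub>k + D * N) (C * \<Pi>\<^sub>f + D * H\<^sub>f)"
    by (simp add: mult_append_cols append_cols_add DL)
  then show "C * ?P + D\<^sub>r * ?H = 0\<^sub>m p (k + f)" by (simp add: out_N out_f append_cols_zero)
qed

end

section \<open>Reduction of the theorem to state space data\<close>

lemma in_mat_image_column: "w \<in> carrier_vec m \<Longrightarrow> w \<in> mat_image (mat_of_cols m [w :: complex vec])"
proof -
  assume w: "w \<in> carrier_vec m"
  have c: "mat_of_cols m [w] \<in> carrier_mat m 1" by (simp add: mat_of_cols_def)
  have "mat_of_cols m [w] *v unit_vec 1 0 = w" using mat_mult_unit[of 0 "mat_of_cols m [w]"] c w by simp
  then show ?thesis using c unfolding mat_image_def by (metis carrier_matD(2) imageI unit_vec_carrier)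
qed

lemma mult_column:
  assumes "M \<in> carrier_mat a m" "w \<in> carrier_vec m"
  shows "M * mat_of_cols m [w] = mat_of_cols a [M *v (w :: complex vec)]"
  using assms by (intro eq_matI) (auto simp: mat_of_cols_def scalar_prod_def)

theorem theorem3p7:
  fixes n p q :: nat
    and A B C D H\<^sub>k H\<^sub>f \<Lambda>\<^sub>k \<Lambda>\<^sub>k\<^sub>f \<Lambda>\<^sub>f \<Pi>\<^sub>k \<Pi>\<^sub>f R\<^sub>0 \<alpha>\<^sub>k \<sigma> \<beta>\<^sub>k L\<^sub>0 B\<^sub>r D\<^sub>r :: "complex mat"
    and F L\<^sub>\<beta> F\<^sub>r :: "rat_fun mat"
  assumes A: "A \<in> carrier_mat n n" and B: "B \<in> carrier_mat n q"
    and C: "C \<in> carrier_mat p n" and D: "D \<in> carrier_mat p q"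
    and F: "F = transfer_function A B C D"
    and obs: "observable C A"
    and data: "zero_data A B C D H\<^sub>k H\<^sub>f \<Lambda>\<^sub>k \<Lambda>\<^sub>k\<^sub>f \<Lambda>\<^sub>f \<Pi>\<^sub>k \<Pi>\<^sub>f R\<^sub>0 \<alpha>\<^sub>k"
    and orthonormal: "mat_adjoint R\<^sub>0 * R\<^sub>0 = 1\<^sub>m (dim_col R\<^sub>0)"
    and sigma: "\<sigma> \<in> carrier_mat (dim_row \<Lambda>\<^sub>k) (dim_row \<Lambda>\<^sub>k)" "pos_def_mat \<sigma>"
    and riccati:
      "\<sigma> * (\<Lambda>\<^sub>k - \<alpha>\<^sub>k * mat_adjoint R\<^sub>0 * H\<^sub>k) + mat_adjoint (\<Lambda>\<^sub>k - \<alpha>\<^sub>k * mat_adjoint R\<^sub>0 * H\<^sub>k) * \<sigma>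
         - \<sigma> * \<alpha>\<^sub>k * mat_adjoint \<alpha>\<^sub>k * \<sigma>
         + mat_adjoint H\<^sub>k * (1\<^sub>m q - R\<^sub>0 * mat_adjoint R\<^sub>0) * H\<^sub>k
       = 0\<^sub>m (dim_row \<Lambda>\<^sub>k) (dim_row \<Lambda>\<^sub>k)"
    and beta: "\<beta>\<^sub>k = - (mat_adjoint \<alpha>\<^sub>k * \<sigma>) - mat_adjoint R\<^sub>0 * H\<^sub>k"
    and L0: "L\<^sub>0 \<in> carrier_mat q (dim_col L\<^sub>0)" "unitary_mat (append_cols R\<^sub>0 L\<^sub>0)"
    and Lbeta:
      "L\<^sub>\<beta> = const_mat L\<^sub>0 - const_mat (H\<^sub>k + R\<^sub>0 * \<beta>\<^sub>k) * resolvent (\<Lambda>\<^sub>k + \<alpha>\<^sub>k * \<beta>\<^sub>k)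
              * const_mat (minv \<sigma> * mat_adjoint (H\<^sub>k + R\<^sub>0 * \<beta>\<^sub>k) * L\<^sub>0)"
    and Fr: "F\<^sub>r = F * L\<^sub>\<beta>"
    and Br: "B\<^sub>r = (B + \<Pi>\<^sub>k * minv \<sigma> * mat_adjoint H\<^sub>k) * L\<^sub>0"
    and Dr: "D\<^sub>r = D * L\<^sub>0"
  shows
    \<comment> \<open>(i)\<close>
    "F\<^sub>r = transfer_function A B\<^sub>r C D\<^sub>r \<and>
    \<comment> \<open>(ii)\<close>
     V_star A B\<^sub>r C D\<^sub>r = V_star A B C D \<and>
     V_star A B\<^sub>r C D\<^sub>r \<inter> C_star A B\<^sub>r C D\<^sub>r = {0\<^sub>v n} \<and>
     (V_star A B C D \<inter> C_star A B C D) + C_star A B\<^sub>r C D\<^sub>r = C_star A B C D \<and>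
     W_ker F\<^sub>r = {0\<^sub>v (dim_col F\<^sub>r) +o sp_kernel F\<^sub>r} \<and>
    \<comment> \<open>(iii)\<close>
     reachable A B\<^sub>r \<subseteq> reachable A B \<and>
     ((\<forall>s. eigenvalue A s \<longrightarrow> Re s \<le> 0) \<or>
      (\<not> (\<exists>s. eigenvalue A s \<and> eigenvalue (- mat_adjoint A) s) \<and>
       (\<exists>P \<in> carrier_mat n n.
          A * P + P * mat_adjoint A + B * mat_adjoint B = 0\<^sub>m n n \<and>
          stabilizable A (mat_adjoint (C * P + D * mat_adjoint B))))
      \<longrightarrow> reachable A B = reachable A B\<^sub>r) \<and>
    \<comment> \<open>(iv)\<close>
     (reachable A B = reachable A B\<^sub>r \<longrightarrow>
       (\<forall>M. finite_zero_matrix A B\<^sub>r C D\<^sub>r M \<longleftrightarrow>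
          similar_mat M
           (four_block_mat
             (- (minv \<sigma> * mat_adjoint (\<Lambda>\<^sub>k + \<alpha>\<^sub>k * \<beta>\<^sub>k) * \<sigma>))
             (\<Lambda>\<^sub>k\<^sub>f + minv \<sigma> * (mat_adjoint \<beta>\<^sub>k * mat_adjoint R\<^sub>0 + mat_adjoint H\<^sub>k) * H\<^sub>f)
             (0\<^sub>m (dim_row \<Lambda>\<^sub>f) (dim_row \<Lambda>\<^sub>k))
             \<Lambda>\<^sub>f)))"
proof -
  interpret sys: lti n q p A B C D by unfold_locales (fact A B C D)+
  define k f r l where "k = dim_row \<Lambda>\<^sub>k" and "f = dim_row \<Lambda>\<^sub>f" and "r = dim_col R\<^sub>0" and "l = dim_col L\<^sub>0"
  let ?\<Pi> = "append_cols \<Pi>\<^sub>k \<Pi>\<^sub>f" and ?H = "append_cols H\<^sub>k H\<^sub>f"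
    and ?\<Lambda> = "four_block_mat \<Lambda>\<^sub>k \<Lambda>\<^sub>k\<^sub>f (0\<^sub>m f k) \<Lambda>\<^sub>f" and ?\<alpha> = "\<alpha>\<^sub>k @\<^sub>r 0\<^sub>m f r"
  have c: "H\<^sub>k \<in> carrier_mat q k" "H\<^sub>f \<in> carrier_mat q f" "\<Lambda>\<^sub>k \<in> carrier_mat k k" "\<Lambda>\<^sub>k\<^sub>f \<in> carrier_mat k f"
    "\<Lambda>\<^sub>f \<in> carrier_mat f f" "\<Pi>\<^sub>k \<in> carrier_mat n k" "\<Pi>\<^sub>f \<in> carrier_mat n f" "R\<^sub>0 \<in> carrier_mat q r"
    "\<alpha>\<^sub>k \<in> carrier_mat k r"
    and zb: "zero_basis sys.F (const_mat ?H * resolvent ?\<Lambda>)"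
    and st: "A * ?\<Pi> + B * ?H = ?\<Pi> * ?\<Lambda>" and ou: "C * ?\<Pi> + D * ?H = 0\<^sub>m p (k + f)"
    and max_sol: "maximal_R_solution B D ?\<Pi> R\<^sub>0 ?\<alpha>"
    and ctrl: "controllable \<Lambda>\<^sub>k \<alpha>\<^sub>k"
    using data by (simp_all add: zero_data_def Let_def k_def f_def r_def)
  note max_sol = max_sol[unfolded maximal_R_solution_def]
  have sol: "R_solution B D ?\<Pi> R\<^sub>0 ?\<alpha>" using max_sol by (rule conjunct1)
  have max: "mat_image R \<subseteq> mat_image R\<^sub>0" if "R_solution B D ?\<Pi> R \<alpha>" for R \<alpha>
    using max_sol[THEN conjunct2] that by metis
  note \<sigma> = sigma(1)[folded k_def] and L = L0(1)[folded l_def]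
  note [simp] = c[THEN carrier_matD(1)] c[THEN carrier_matD(2)] carrier_matD[OF \<sigma>] carrier_matD[OF L]
  have cl: "?\<Pi> \<in> carrier_mat n (k + f)" "?H \<in> carrier_mat q (k + f)" "?\<Lambda> \<in> carrier_mat (k + f) (k + f)"
    by (intro carrier_matI; simp)+
  from zb sys.zero_basis_iff[OF obs cl st ou]
  have inj: "\<And>c. c \<in> carrier_vec (k + f) \<Longrightarrow> ?\<Pi> *v c = 0\<^sub>v n \<Longrightarrow> c = 0\<^sub>v (k + f)"
    and img: "mat_image ?\<Pi> = V_star A B C D \<inter> reachable A B" by auto
  \<comment> \<open>The equations for \<open>[\<Pi>\<^sub>k, \<Pi>\<^sub>f]\<close> separate into blocks.\<close>
  have "append_cols (A * \<Pi>\<^sub>k + B * H\<^sub>k) (A * \<Pi>\<^sub>f + B * H\<^sub>f) = A * ?\<Pi> + B * ?H"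
    by (simp add: mult_append_cols append_cols_add)
  also have "\<dots> = append_cols (\<Pi>\<^sub>k * \<Lambda>\<^sub>k + \<Pi>\<^sub>f * 0\<^sub>m f k) (\<Pi>\<^sub>k * \<Lambda>\<^sub>k\<^sub>f + \<Pi>\<^sub>f * \<Lambda>\<^sub>f)"
    unfolding st by (rule append_cols_mult_block[OF c(6,7,3,4) _ c(5)]) simp
  finally have states: "A * \<Pi>\<^sub>k + B * H\<^sub>k = \<Pi>\<^sub>k * \<Lambda>\<^sub>k" "A * \<Pi>\<^sub>f + B * H\<^sub>f = \<Pi>\<^sub>k * \<Lambda>\<^sub>k\<^sub>f + \<Pi>\<^sub>f * \<Lambda>\<^sub>f"
    by (simp_all add: append_cols_eq_iff mm_zero mm_add_zero)
  have "append_cols (C * \<Pi>\<^sub>k + D * H\<^sub>k) (C * \<Pi>\<^sub>f + D * H\<^sub>f) = append_cols (0\<^sub>m p k) (0\<^sub>m p f)"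
    using ou by (simp add: mult_append_cols append_cols_add append_cols_zero)
  then have outs: "C * \<Pi>\<^sub>k + D * H\<^sub>k = 0\<^sub>m p k" "C * \<Pi>\<^sub>f + D * H\<^sub>f = 0\<^sub>m p f"
    by (simp_all add: append_cols_eq_iff)
  have BR: "B * R\<^sub>0 = \<Pi>\<^sub>k * \<alpha>\<^sub>k" and DR: "D * R\<^sub>0 = 0\<^sub>m p r"
    using sol append_cols_mult_rows[OF c(6,7,9), of "0\<^sub>m f r"]
    by (simp_all add: R_solution_def mm_zero mm_add_zero)
  \<comment> \<open>An input moving zero into \<open>\<V>\<^sup>*\<close> moves it into the image of \<open>[\<Pi>\<^sub>k, \<Pi>\<^sub>f]\<close>, which makes it a solution
    with one column.\<close>
  have maximal: "w \<in> mat_image R\<^sub>0"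
    if w: "w \<in> carrier_vec q" "B *v w \<in> V_star A B C D" "D *v w = 0\<^sub>v p" for w
  proof -
    have "B *v w \<in> mat_image ?\<Pi>" using w reachable_input[OF A B w(1)] img by blast
    then obtain a where a: "a \<in> carrier_vec (k + f)" "B *v w = ?\<Pi> *v a" by (auto simp: mat_image_def)
    have "mat_of_cols p [0\<^sub>v p :: complex vec] = 0\<^sub>m p 1" by (intro eq_matI) (auto simp: mat_of_cols_def)
    then have "R_solution B D ?\<Pi> (mat_of_cols q [w]) (mat_of_cols (k + f) [a])"
      using mult_column[OF B w(1)] mult_column[OF D w(1)] mult_column[OF cl(1) a(1)] a(2) w(3)
      by (simp add: R_solution_def mat_of_cols_def)
    from max[OF this] show ?thesis using in_mat_image_column[OF w(1)] by blast
  qed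
  note unitary = unitary_append_cols[OF c(8) L L0(2)]
  interpret sd: squaring_down n q p A B C D k f r l H\<^sub>k H\<^sub>f \<Lambda>\<^sub>k \<Lambda>\<^sub>k\<^sub>f \<Lambda>\<^sub>f \<Pi>\<^sub>k \<Pi>\<^sub>f R\<^sub>0 \<alpha>\<^sub>k \<sigma> L\<^sub>0
    by unfold_locales (use obs c \<sigma> L states outs inj img BR DR maximal ctrl orthonormal unitary sigma(2) riccati
      in \<open>simp_all add: k_def[symmetric] r_def[symmetric]\<close>)
  have \<beta>: "\<beta>\<^sub>k = sd.\<beta>\<^sub>k" by (simp add: beta sd.\<beta>\<^sub>k_def)
  have N: "H\<^sub>k + R\<^sub>0 * \<beta>\<^sub>k = sd.N" and \<Lambda>: "\<Lambda>\<^sub>k + \<alpha>\<^sub>k * \<beta>\<^sub>k = sd.\<Lambda>\<^sub>\<beta>" and S: "minv \<sigma> = sd.S"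
    by (simp_all add: \<beta> sd.N_def sd.\<Lambda>\<^sub>\<beta>_def sd.S_def)
  have Br': "B\<^sub>r = sd.B\<^sub>r" and Dr': "D\<^sub>r = sd.D\<^sub>r"
    by (simp_all add: Br Dr sd.B\<^sub>r_def sd.D\<^sub>r_def S)
  have L': "L\<^sub>\<beta> = sd.L\<^sub>\<beta>" unfolding Lbeta N \<Lambda> S sd.L\<^sub>\<beta>_def ..
  have Fr': "F\<^sub>r = sd.reduced.F" unfolding Fr F L' by (rule sd.reduced_transfer_function)
  have NA: "mat_adjoint \<beta>\<^sub>k * mat_adjoint R\<^sub>0 + mat_adjoint H\<^sub>k = mat_adjoint sd.N"
    unfolding N[symmetric] \<beta>
    by (intro eq_matI) (simp_all add: mat_adjoint_simps add.commute del: index_mult_mat(1))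
  show ?thesis
    unfolding Br' Dr' Fr' S \<Lambda> NA k_def[symmetric] f_def[symmetric] sd.reduced.F_dims
  proof (intro conjI impI allI)
    assume "(\<forall>s. eigenvalue A s \<longrightarrow> Re s \<le> 0) \<or>
      (\<not> (\<exists>s. eigenvalue A s \<and> eigenvalue (- mat_adjoint A) s) \<and>
       (\<exists>P \<in> carrier_mat n n. A * P + P * mat_adjoint A + B * mat_adjoint B = 0\<^sub>m n n \<and>
          stabilizable A (mat_adjoint (C * P + D * mat_adjoint B))))"
    then show "reachable A B = reachable A sd.B\<^sub>r"
    proof (elim disjE conjE bexE)
      assume "\<forall>s. eigenvalue A s \<longrightarrow> Re s \<le> 0"
      then show ?thesis by (intro sd.reachable_eq_if_semistable) blast
    next
      fix P assume "\<not> (\<exists>s. eigenvalue A s \<and> eigenvalue (- mat_adjoint A) s)" "P \<in> carrier_mat n n"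
        "A * P + P * mat_adjoint A + B * mat_adjoint B = 0\<^sub>m n n"
        "stabilizable A (mat_adjoint (C * P + D * mat_adjoint B))"
      then show ?thesis by (intro sd.reachable_eq_if_stabilizable[of P]) blast+
    qed
  qed (rule refl sd.V_star_reduced sd.V_star_C_star_reduced sd.C_star_decomposition sd.W_ker_reduced
      sd.reachable_reduced_subset sd.finite_zero_matrix_reduced, assumption?)+
qed

end
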